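(* Let $d,q\in \mathbb{Z}_{\geq 0}$ with $d+q\geq 1$. For each $1\leq i\leq d$, let $(a^{(i)}_n)_{n=1}^\infty$ be a sequence of real numbers such that $0<a^{(i)}_1<a^{(i)}_2<\cdots$, $a^{(i)}_n\to\infty$ as $n\to\infty$, and $\frac{a^{(i)}_{n+1}}{a^{(i)}_n}\to 1$ as $n\to\infty$. For each $1\leq j\leq q$, let $(b^{(j)}_m)_{m=1}^\infty$ be a sequence of real numbers such that $0<b^{(j)}_1<b^{(j)}_2<\cdots$ and $\liminf_{m\to\infty}\frac{b^{(j)}_{m+1}}{b^{(j)}_m}>1$. Let \[N=\{(a^{(1)}_{n_1},\dots,a^{(d)}_{n_d},b^{(1)}_{m_1},\dots,b^{(q)}_{m_q}) : n_i,m_j\in\mathbb{N}\}\subset\mathbb{R}^{d+q}.\] Then the Lipschitz-free space $\mathcal{F}(N)$ satisfies \[\mathcal{F}(N)\sim\begin{cases}\mathcal{F}(\mathbb{Z}^d) & \text{if } d>0,\\ \ell_1 & \text{if } d=0 \text{ and } q>0.\end{cases}\]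
   Context: $\mathbb{N}=\{1,2,\dots\}$. All Banach spaces are real. For a metric space $M$ with a chosen basepoint $0_M\in M$, $\mathrm{Lip}_0(M)$ is the Banach space of Lipschitz functions $f:M\to\mathbb{R}$ with $f(0_M)=0$, normed by the Lipschitz constant. For $x\in M$, $\delta_M(x)\in\mathrm{Lip}_0(M)^*$ is the evaluation functional $\delta_M(x)(f)=f(x)$. The Lipschitz-free space is $\mathcal{F}(M)=\overline{\mathrm{span}}^{\|\cdot\|}\{\delta_M(x):x\in M\}\subset\mathrm{Lip}_0(M)^*$; up to isometric isomorphism it does not depend on the basepoint. $X\sim Y$ means that the Banach spaces $X$ and $Y$ are linearly isomorphic (via a bounded linear bijection with bounded inverse). Subsets of $\mathbb{R}^n$ (including $N$ and $\mathbb{Z}^d$) carry the metric induced by the norm $\|\cdot\|_\infty$. *)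

theory Defs
  imports "HOL-Analysis.Analysis" "HOL-Library.Function_Algebras"
begin

instantiation "fun" :: (type, real_vector) real_vector
begin

definition scaleR_fun :: "real \<Rightarrow> ('a \<Rightarrow> 'b) \<Rightarrow> 'a \<Rightarrow> 'b"
  where "scaleR_fun c f = (\<lambda>x. c *\<^sub>R f x)"

instance
  by standard (auto simp: scaleR_fun_def fun_eq_iff plus_fun_def scaleR_add_right scaleR_add_left)

end

text \<open>
  A normed space is represented as a linear subspace of an ambient real vector space together with
  a norm, of which only the values on that subspace matter.
\<close>

record 'v normed =
  vecs :: "'v set"
  nrm :: "'v \<Rightarrow> real"

definition bounded_linear_op ::
    "'v::real_vector normed \<Rightarrow> 'w::real_vector normed \<Rightarrow> ('v \<Rightarrow> 'w) \<Rightarrow> bool"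
  where "bounded_linear_op X Y T \<longleftrightarrow>
    T \<in> vecs X \<rightarrow> vecs Y \<and>
    (\<forall>u\<in>vecs X. \<forall>v\<in>vecs X. T (u + v) = T u + T v) \<and>
    (\<forall>c. \<forall>u\<in>vecs X. T (c *\<^sub>R u) = c *\<^sub>R T u) \<and>
    (\<exists>C. \<forall>u\<in>vecs X. nrm Y (T u) \<le> C * nrm X u)"

definition linearly_isomorphic ::
    "'v::real_vector normed \<Rightarrow> 'w::real_vector normed \<Rightarrow> bool"  (infix "\<sim>\<^sub>B" 50)
  where "X \<sim>\<^sub>B Y \<longleftrightarrow>
    (\<exists>T. bounded_linear_op X Y T \<and> bij_betw T (vecs X) (vecs Y) \<and>
         bounded_linear_op Y X (inv_into (vecs X) T))"

definition ell1 :: "(nat \<Rightarrow> real) normed"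
  where "ell1 = \<lparr>vecs = {x. summable (\<lambda>n. \<bar>x n\<bar>)}, nrm = (\<lambda>x. \<Sum>n. \<bar>x n\<bar>)\<rparr>"

text \<open>
  Elements of \<open>Lip\<^sub>0\<close> are extended by zero off the metric space, and functionals on \<open>Lip\<^sub>0\<close> by zero
  off \<open>Lip\<^sub>0\<close>, so that equality of the representing functions is equality of the objects.
  The Lipschitz constant is taken as an infimum of admissible constants instead of a supremum of
  difference quotients, so that it is \<open>0\<close> on a one-point space.
\<close>

definition Lip0 :: "'a metric \<Rightarrow> 'a \<Rightarrow> ('a \<Rightarrow> real) normed"
  where "Lip0 M p =
    \<lparr>vecs = {f. Lipschitz_continuous_map M euclidean_metric f \<and> f p = 0 \<and>
                (\<forall>x. x \<notin> mspace M \<longrightarrow> f x = 0)},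
     nrm = (\<lambda>f. Inf {L. 0 \<le> L \<and>
                (\<forall>x\<in>mspace M. \<forall>y\<in>mspace M. \<bar>f x - f y\<bar> \<le> L * mdist M x y)})\<rparr>"

definition dual :: "'v::real_vector normed \<Rightarrow> ('v \<Rightarrow> real) normed"
  where "dual X =
    \<lparr>vecs = {\<phi>. bounded_linear_op X \<lparr>vecs = UNIV, nrm = abs\<rparr> \<phi> \<and> (\<forall>u. u \<notin> vecs X \<longrightarrow> \<phi> u = 0)},
     nrm = (\<lambda>\<phi>. Sup {\<bar>\<phi> u\<bar> | u. u \<in> vecs X \<and> nrm X u \<le> 1})\<rparr>"

definition evaluation :: "'a metric \<Rightarrow> 'a \<Rightarrow> 'a \<Rightarrow> ('a \<Rightarrow> real) \<Rightarrow> real"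
  where "evaluation M p x = (\<lambda>f. if f \<in> vecs (Lip0 M p) then f x else 0)"

definition lipschitz_free :: "'a metric \<Rightarrow> 'a \<Rightarrow> (('a \<Rightarrow> real) \<Rightarrow> real) normed"
  where "lipschitz_free M p =
    \<lparr>vecs = {\<phi> \<in> vecs (dual (Lip0 M p)).
               \<forall>e>0. \<exists>\<psi> \<in> span (evaluation M p ` mspace M). nrm (dual (Lip0 M p)) (\<phi> - \<psi>) < e},
     nrm = nrm (dual (Lip0 M p))\<rparr>"

text \<open>
  Points of \<open>\<real>\<^sup>n\<close> are extensional functions on \<open>{1..n}\<close>; the inserted \<open>0\<close> in the maximum only
  matters for \<open>n = 0\<close>.
\<close>

definition sup_dist :: "nat \<Rightarrow> (nat \<Rightarrow> real) \<Rightarrow> (nat \<Rightarrow> real) \<Rightarrow> real"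
  where "sup_dist n x y = Max (insert 0 ((\<lambda>k. \<bar>x k - y k\<bar>) ` {1..n}))"

definition sup_metric :: "nat \<Rightarrow> (nat \<Rightarrow> real) metric"
  where "sup_metric n = metric ({1..n} \<rightarrow>\<^sub>E UNIV, sup_dist n)"

lemma sup_dist_le_iff: "sup_dist n x y \<le> c \<longleftrightarrow> 0 \<le> c \<and> (\<forall>k\<in>{1..n}. \<bar>x k - y k\<bar> \<le> c)"
  by (auto simp: sup_dist_def)

lemma Metric_space_sup_dist: "Metric_space ({1..n} \<rightarrow>\<^sub>E UNIV) (sup_dist n)"
proof
  fix x y z :: "nat \<Rightarrow> real"
  show nonneg: "0 \<le> sup_dist n x y" for x y
    using sup_dist_le_iff by blast
  show "sup_dist n x y = sup_dist n y x"
    by (simp add: sup_dist_def abs_minus_commute)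
  have bound: "\<bar>u k - v k\<bar> \<le> sup_dist n u v" if "k \<in> {1..n}" for k u v
    using sup_dist_le_iff that by blast
  show "sup_dist n x y = 0 \<longleftrightarrow> x = y"
    if "x \<in> {1..n} \<rightarrow>\<^sub>E UNIV" "y \<in> {1..n} \<rightarrow>\<^sub>E UNIV"
  proof
    assume "sup_dist n x y = 0"
    then have "x k = y k" if "k \<in> {1..n}" for k
      using bound[OF that, of x y] by simp
    then show "x = y"
      using that by (intro PiE_ext)
  next
    assume "x = y"
    then have "sup_dist n x y \<le> 0"
      by (simp add: sup_dist_le_iff)
    then show "sup_dist n x y = 0"
      using nonneg[of x y] by simp
  qed
  show "sup_dist n x z \<le> sup_dist n x y + sup_dist n y z"
    unfolding sup_dist_le_iff[of n x z]
  proof (intro conjI ballI)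
    show "0 \<le> sup_dist n x y + sup_dist n y z"
      using nonneg[of x y] nonneg[of y z] by simp
  next
    fix k assume "k \<in> {1..n}"
    then show "\<bar>x k - z k\<bar> \<le> sup_dist n x y + sup_dist n y z"
      using bound[of k x y] bound[of k y z] by linarith
  qed
qed

lemma mspace_sup_metric [simp]: "mspace (sup_metric n) = {1..n} \<rightarrow>\<^sub>E UNIV"
  and mdist_sup_metric [simp]: "mdist (sup_metric n) = sup_dist n"
  unfolding sup_metric_def
  by (fact Metric_space.mspace_metric[OF Metric_space_sup_dist]
      Metric_space.mdist_metric[OF Metric_space_sup_dist])+

definition int_lattice :: "nat \<Rightarrow> (nat \<Rightarrow> real) set"
  where "int_lattice d = {1..d} \<rightarrow>\<^sub>E \<int>"

definition product_grid ::
    "nat \<Rightarrow> nat \<Rightarrow> (nat \<Rightarrow> nat \<Rightarrow> real) \<Rightarrow> (nat \<Rightarrow> nat \<Rightarrow> real) \<Rightarrow> (nat \<Rightarrow> real) set"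
  where "product_grid d q a b =
    {x \<in> {1..d + q} \<rightarrow>\<^sub>E UNIV.
       (\<forall>i\<in>{1..d}. \<exists>n\<ge>1. x i = a i n) \<and> (\<forall>j\<in>{1..q}. \<exists>m\<ge>1. x (d + j) = b j m)}"

end

theory Submission
  imports Defs
begin

text \<open>
  All operators between Lipschitz-free spaces are adjoints of linear maps between spaces of Lipschitz
  functions whose values at each point depend on finitely many values of the argument, so the whole
  argument takes place on the level of such maps. With the \<open>\<ell>\<^sub>1\<close>-metric, \<open>\<F>(N)\<close> is
  compared with the \<open>\<ell>\<^sub>1\<close>-sum \<open>E\<close> of the spaces of all finite grids \<open>{0..k}\<^sup>d\<close> (with an extra point
  at distance \<open>k\<close>), each occurring infinitely often, so that \<open>E\<close> is isomorphic to its own infinite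
  \<open>\<ell>\<^sub>1\<close>-sum.

  \<open>\<F>(N)\<close> is complemented in \<open>E\<close>: a partition of unity over dyadic annuli reduces to bounded boxes.
  Along a lacunary coordinate the differences \<open>f(s, b\<^sub>m) - f(s, b\<^sub>1)\<close> are independent
  Lipschitz functions of \<open>s\<close>, bounded by \<open>b\<^sub>m - b\<^sub>1\<close>, which removes that coordinate at the cost of a smaller
  bound \<open>\<beta>\<close>. In the remaining \<open>d\<close> coordinates tents of width \<open>\<beta>\<close> cut the box into cubes of side \<open>2\<beta>\<close>,
  and piecewise linear interpolation embeds a finite product set in a fine regular grid.

  \<open>E\<close> is complemented in \<open>\<F>(N)\<close>: as the ratios tend to \<open>1\<close>, far out the set \<open>N\<close> contains almost
  regular grids of any size along the diagonal, and clamping coordinates projects onto all of them at once.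
  Pelczynski's decomposition method then gives \<open>\<F>(N) \<sim> E\<close>, and likewise \<open>\<F>(\<int>\<^sup>d) \<sim> E\<close>. For \<open>d = 0\<close> all
  grids are points and \<open>E\<close> is \<open>\<ell>\<^sub>1\<close>.
\<close>

section \<open>Spaces of Lipschitz functions and complemented embeddings\<close>

text \<open>Two demands shape the statements. A bounded map between spaces of Lipschitz functions
  need not be the adjoint of a map between free spaces; \<open>fin_fun\<close> and
  \<open>ker_op\<close> single out maps whose adjoint sends an evaluation to a finite combination of
  evaluations, and density does the rest. Moreover an infinite sum of pieces is controlled only if
  one constant serves all of them, so \<open>csub\<close> carries its constant. The bounds depend on
  the number of coordinates and on the lacunarity ratio, never on the size of a box, the number of
  its points or their spacing: these are absorbed by the choice of the grid that receives the box,
  and this is why \<open>E\<close> contains grids of every size. The pieces produced by cutting have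
  no natural base point, only a bound on their functions. Hence the weights are kept apart from the
  distances; a weight is the distance to an extra point. Removing a lacunary coordinate may lower
  this bound far below the diameter of the box, so the slow coordinates are cut last, at the scale
  of the bound that is left.\<close>

definition fin_fun :: "'a set \<Rightarrow> (('a \<Rightarrow> real) \<Rightarrow> real) \<Rightarrow> bool"
  where "fin_fun S \<phi> \<longleftrightarrow> \<phi> \<in> span ((\<lambda>x f. f x) ` S)"

lemma fin_fun_eval: "x \<in> S \<Longrightarrow> fin_fun S (\<lambda>f. f x)"
  by (auto simp: fin_fun_def intro: span_base)

lemma fin_fun_zero: "fin_fun S (\<lambda>f. 0)"
  using span_zero[of "(\<lambda>x f. f x) ` S"] by (simp add: fin_fun_def zero_fun_def)

lemma fin_fun_add: "fin_fun S \<phi> \<Longrightarrow> fin_fun S \<psi> \<Longrightarrow> fin_fun S (\<lambda>f. \<phi> f + \<psi> f)"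
  using span_add[of \<phi> "(\<lambda>x f. f x) ` S" \<psi>] by (simp add: fin_fun_def plus_fun_def)

lemma fin_fun_diff: "fin_fun S \<phi> \<Longrightarrow> fin_fun S \<psi> \<Longrightarrow> fin_fun S (\<lambda>f. \<phi> f - \<psi> f)"
  using span_diff[of \<phi> "(\<lambda>x f. f x) ` S" \<psi>] by (simp add: fin_fun_def fun_diff_def)

lemma fin_fun_scale: "fin_fun S \<phi> \<Longrightarrow> fin_fun S (\<lambda>f. c * \<phi> f)"
  using span_scale[of \<phi> "(\<lambda>x f. f x) ` S" c] by (simp add: fin_fun_def scaleR_fun_def)

lemma fin_fun_sum: "(\<And>i. i \<in> I \<Longrightarrow> fin_fun S (\<phi> i)) \<Longrightarrow> fin_fun S (\<lambda>f. \<Sum>i\<in>I. \<phi> i f)"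
  by (induction I rule: infinite_finite_induct) (auto intro: fin_fun_zero fin_fun_add)

lemma fin_fun_induct [consumes 1, case_names zero add eval]:
  assumes "fin_fun S \<phi>"
    and "P (\<lambda>f. 0)"
    and "\<And>\<phi> \<psi>. P \<phi> \<Longrightarrow> P \<psi> \<Longrightarrow> P (\<lambda>f. \<phi> f + \<psi> f)"
    and "\<And>c x. x \<in> S \<Longrightarrow> P (\<lambda>f. c * f x)"
  shows "P \<phi>"
proof -
  have "\<phi> \<in> span ((\<lambda>x f. f x) ` S)"
    using assms(1) by (simp add: fin_fun_def)
  then show ?thesis
  proof (induction rule: span_induct_alt)
    case base
    then show ?case using assms(2) by (simp add: zero_fun_def)
  next
    case (step c x y)
    then obtain s where "s \<in> S" "x = (\<lambda>f. f s)" by auto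
    then show ?case
      using assms(3)[OF assms(4)[of s c] step(2)] by (simp add: plus_fun_def scaleR_fun_def)
  qed
qed

lemma fin_fun_linear:
  assumes "fin_fun S \<phi>"
  shows "linear \<phi>"
  using assms
proof (induction rule: fin_fun_induct)
  case zero
  then show ?case by (simp add: linear_iff)
next
  case (add \<phi> \<psi>)
  then show ?case by (simp add: linear_compose_add)
next
  case (eval c x)
  then show ?case by (simp add: linear_iff scaleR_fun_def algebra_simps)
qed

lemma fin_fun_cong:
  assumes "fin_fun S \<phi>" "\<And>x. x \<in> S \<Longrightarrow> f x = g x"
  shows "\<phi> f = \<phi> g"
  using assms by (induction rule: fin_fun_induct) auto

lemma fin_fun_comp:
  assumes "fin_fun S \<phi>" "\<And>x. x \<in> S \<Longrightarrow> fin_fun T (\<lambda>f. V f x)"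
  shows "fin_fun T (\<lambda>f. \<phi> (V f))"
  using assms(1)
proof (induction rule: fin_fun_induct)
  case zero
  show ?case by (rule fin_fun_zero)
next
  case (add \<phi> \<psi>)
  then show ?case by (rule fin_fun_add)
next
  case (eval c x)
  then show ?case by (intro fin_fun_scale assms(2))
qed

section \<open>Maps with finite kernels between spaces of functions\<close>

definition ker_op :: "'b set \<Rightarrow> 'a set \<Rightarrow> (('b \<Rightarrow> real) \<Rightarrow> 'a \<Rightarrow> real) \<Rightarrow> bool"
  where "ker_op T S U \<longleftrightarrow> (\<forall>x\<in>S. fin_fun T (\<lambda>f. U f x))"

lemma ker_opI: "(\<And>x. x \<in> S \<Longrightarrow> fin_fun T (\<lambda>f. U f x)) \<Longrightarrow> ker_op T S U"
  by (simp add: ker_op_def)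

lemma ker_opD: "ker_op T S U \<Longrightarrow> x \<in> S \<Longrightarrow> fin_fun T (\<lambda>f. U f x)"
  by (simp add: ker_op_def)

lemma ker_op_comp: "ker_op T S U \<Longrightarrow> ker_op R T V \<Longrightarrow> ker_op R S (\<lambda>f. U (V f))"
  unfolding ker_op_def by (auto intro: fin_fun_comp)

text \<open>A combination of evaluations in \<open>T\<close> cannot see the values off
  \<open>T\<close>. The operators act on total functions, so this is how an equality that holds on
  the points only is passed through an operator.\<close>

lemma ker_op_cong:
  "ker_op T S U \<Longrightarrow> (\<And>y. y \<in> T \<Longrightarrow> f y = g y) \<Longrightarrow> x \<in> S \<Longrightarrow> U f x = U g x"
  by (rule fin_fun_cong[OF ker_opD])

text \<open>The base point is left out of \<open>pts\<close> and survives only through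
  \<open>wt\<close>, its distance to the other points. A weight may also be a mere bound that comes
  from no point of the surrounding space.\<close>

record 'a lspace =
  pts :: "'a set"
  wt :: "'a \<Rightarrow> real"
  ds :: "'a \<Rightarrow> 'a \<Rightarrow> real"

definition lip_le :: "'a lspace \<Rightarrow> real \<Rightarrow> ('a \<Rightarrow> real) \<Rightarrow> bool"
  where "lip_le X L f \<longleftrightarrow> (\<forall>x\<in>pts X. \<bar>f x\<bar> \<le> L * wt X x) \<and>
    (\<forall>x\<in>pts X. \<forall>y\<in>pts X. \<bar>f x - f y\<bar> \<le> L * ds X x y)"

lemma lip_leI:
  assumes "\<And>x. x \<in> pts X \<Longrightarrow> \<bar>f x\<bar> \<le> L * wt X x"
    and "\<And>x y. x \<in> pts X \<Longrightarrow> y \<in> pts X \<Longrightarrow> \<bar>f x - f y\<bar> \<le> L * ds X x y"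
  shows "lip_le X L f"
  using assms by (auto simp: lip_le_def)

lemma lip_leD:
  assumes "lip_le X L f" "x \<in> pts X"
  shows "\<bar>f x\<bar> \<le> L * wt X x" "y \<in> pts X \<Longrightarrow> \<bar>f x - f y\<bar> \<le> L * ds X x y"
  using assms by (auto simp: lip_le_def)

lemma lip_le_cong:
  "lip_le X L f \<Longrightarrow> (\<And>x. x \<in> pts X \<Longrightarrow> f x = g x) \<Longrightarrow> lip_le X L g"
  by (simp add: lip_le_def)

lemma lip_le_add:
  assumes "lip_le X L f" "lip_le X M g"
  shows "lip_le X (L + M) (f + g)"
proof (rule lip_leI)
  fix x assume "x \<in> pts X"
  then show "\<bar>(f + g) x\<bar> \<le> (L + M) * wt X x"
    using lip_leD(1)[OF assms(1), of x] lip_leD(1)[OF assms(2), of x] by (simp add: algebra_simps)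
next
  fix x y assume "x \<in> pts X" "y \<in> pts X"
  then show "\<bar>(f + g) x - (f + g) y\<bar> \<le> (L + M) * ds X x y"
    using lip_leD(2)[OF assms(1), of x y] lip_leD(2)[OF assms(2), of x y]
    by (simp add: algebra_simps)
qed

lemma lip_le_diff:
  assumes "lip_le X L f" "lip_le X M g"
  shows "lip_le X (L + M) (f - g)"
proof -
  have "lip_le X M (- g)"
    using assms(2) by (simp add: lip_le_def) (metis abs_minus_commute)
  from lip_le_add[OF assms(1) this] show ?thesis by simp
qed

text \<open>
  The functionals spanned by point evaluations on the functions with finite \<open>lip_le\<close>-constant
  generate a space that is complemented in the one belonging to the second argument: \<open>V\<close> is
  the adjoint of the projection and \<open>U\<close> is the adjoint of the embedding.
\<close>

definition csub_ops :: "real \<Rightarrow> 'a lspace \<Rightarrow> 'b lspace \<Rightarrow>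
    (('b \<Rightarrow> real) \<Rightarrow> 'a \<Rightarrow> real) \<Rightarrow> (('a \<Rightarrow> real) \<Rightarrow> 'b \<Rightarrow> real) \<Rightarrow> bool"
  where "csub_ops C X Y U V \<longleftrightarrow> ker_op (pts Y) (pts X) U \<and> ker_op (pts X) (pts Y) V \<and>
    (\<forall>L\<ge>0. \<forall>f. lip_le Y L f \<longrightarrow> lip_le X (C * L) (U f)) \<and>
    (\<forall>L\<ge>0. \<forall>f. lip_le X L f \<longrightarrow> lip_le Y (C * L) (V f)) \<and>
    (\<forall>f. \<forall>x\<in>pts X. U (V f) x = f x)"

definition csub :: "real \<Rightarrow> 'a lspace \<Rightarrow> 'b lspace \<Rightarrow> bool"
  where "csub C X Y \<longleftrightarrow> 0 \<le> C \<and> (\<exists>U V. csub_ops C X Y U V)"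

definition ciso :: "'a lspace \<Rightarrow> 'b lspace \<Rightarrow> bool"
  where "ciso X Y \<longleftrightarrow> (\<exists>C U V. 0 \<le> C \<and> csub_ops C X Y U V \<and> csub_ops C Y X V U)"

lemma csub_opsD:
  assumes "csub_ops C X Y U V"
  shows "ker_op (pts Y) (pts X) U" "ker_op (pts X) (pts Y) V"
    "\<And>L f. 0 \<le> L \<Longrightarrow> lip_le Y L f \<Longrightarrow> lip_le X (C * L) (U f)"
    "\<And>L f. 0 \<le> L \<Longrightarrow> lip_le X L f \<Longrightarrow> lip_le Y (C * L) (V f)"
    "\<And>f x. x \<in> pts X \<Longrightarrow> U (V f) x = f x"
  using assms by (simp_all add: csub_ops_def)

lemma csub_opsI:
  assumes "ker_op (pts Y) (pts X) U" "ker_op (pts X) (pts Y) V"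
    "\<And>L f. 0 \<le> L \<Longrightarrow> lip_le Y L f \<Longrightarrow> lip_le X (C * L) (U f)"
    "\<And>L f. 0 \<le> L \<Longrightarrow> lip_le X L f \<Longrightarrow> lip_le Y (C * L) (V f)"
    "\<And>f x. x \<in> pts X \<Longrightarrow> U (V f) x = f x"
  shows "csub_ops C X Y U V"
  using assms by (simp add: csub_ops_def)

lemma csubI:
  assumes "0 \<le> C" "ker_op (pts Y) (pts X) U" "ker_op (pts X) (pts Y) V"
    "\<And>L f. 0 \<le> L \<Longrightarrow> lip_le Y L f \<Longrightarrow> lip_le X (C * L) (U f)"
    "\<And>L f. 0 \<le> L \<Longrightarrow> lip_le X L f \<Longrightarrow> lip_le Y (C * L) (V f)"
    "\<And>f x. x \<in> pts X \<Longrightarrow> U (V f) x = f x"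
  shows "csub C X Y"
  using assms csub_opsI unfolding csub_def by metis

lemma csubE:
  assumes "csub C X Y"
  obtains U V where "0 \<le> C" "csub_ops C X Y U V"
  using assms unfolding csub_def by auto

definition wf_lspace :: "'a lspace \<Rightarrow> bool"
  where "wf_lspace X \<longleftrightarrow> (\<forall>x\<in>pts X. 0 \<le> wt X x) \<and> (\<forall>x\<in>pts X. \<forall>y\<in>pts X. 0 \<le> ds X x y)"

lemma lip_le_mono:
  assumes "wf_lspace X" "lip_le X L f" "L \<le> M"
  shows "lip_le X M f"
proof (rule lip_leI)
  show "\<bar>f x\<bar> \<le> M * wt X x" if "x \<in> pts X" for x
    using lip_leD(1)[OF assms(2) that] mult_right_mono[OF assms(3), of "wt X x"] assms(1) that
    by (fastforce simp: wf_lspace_def)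
  show "\<bar>f x - f y\<bar> \<le> M * ds X x y" if "x \<in> pts X" "y \<in> pts X" for x y
    using lip_leD(2)[OF assms(2) that] mult_right_mono[OF assms(3), of "ds X x y"] assms(1) that
    by (fastforce simp: wf_lspace_def)
qed

lemma csub_ops_trans:
  assumes C: "0 \<le> C" and UV: "csub_ops C X Y U V" and D: "0 \<le> D" and UV': "csub_ops D Y Z U' V'"
  shows "csub_ops (C * D) X Z (\<lambda>f. U (U' f)) (\<lambda>f. V' (V f))"
proof (rule csub_opsI)
  show "lip_le X (C * D * L) (U (U' f))" if "0 \<le> L" "lip_le Z L f" for L f
    using csub_opsD(3)[OF UV _ csub_opsD(3)[OF UV' that]] that D by (simp add: mult.assoc)
  show "lip_le Z (C * D * L) (V' (V f))" if "0 \<le> L" "lip_le X L f" for L f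
    using csub_opsD(4)[OF UV' _ csub_opsD(4)[OF UV that]] that C
    by (simp add: mult.assoc mult.left_commute)
  show "U (U' (V' (V f))) x = f x" if "x \<in> pts X" for f x
    using ker_op_cong[OF csub_opsD(1)[OF UV] _ that, of "U' (V' (V f))" "V f"] csub_opsD(5)[OF UV']
      csub_opsD(5)[OF UV that] by simp
qed (use csub_opsD(1,2)[OF UV] csub_opsD(1,2)[OF UV'] in \<open>auto intro: ker_op_comp\<close>)

lemma csub_trans:
  assumes "csub C X Y" "csub D Y Z"
  shows "csub (C * D) X Z"
proof -
  obtain U V where 1: "0 \<le> C" "csub_ops C X Y U V"
    using assms(1) by (rule csubE)
  obtain U' V' where 2: "0 \<le> D" "csub_ops D Y Z U' V'"
    using assms(2) by (rule csubE)
  show ?thesis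
    unfolding csub_def using 1(1) 2(1) csub_ops_trans[OF 1 2] by auto
qed

text \<open>Setting all values off the points to \<open>0\<close> turns identities on the points
  into identities between functions. Then \<open>V\<close> after \<open>U\<close> is a genuine
  linear projection, and the shift argument becomes linear algebra.\<close>

lemma csub_normalised:
  assumes "csub C X Y"
  obtains U V where "0 \<le> C" "ker_op (pts Y) (pts X) U" "ker_op (pts X) (pts Y) V" "linear U" "linear V"
    "\<And>L f. 0 \<le> L \<Longrightarrow> lip_le Y L f \<Longrightarrow> lip_le X (C * L) (U f)"
    "\<And>L f. 0 \<le> L \<Longrightarrow> lip_le X L f \<Longrightarrow> lip_le Y (C * L) (V f)"
    "\<And>f x. x \<in> pts X \<Longrightarrow> U (V f) x = f x"
    "\<And>g. U (V (U g)) = U g" "\<And>f. V (U (V f)) = V f"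
proof -
  obtain U V where C: "0 \<le> C" and ops: "csub_ops C X Y U V"
    using assms(1) by (rule csubE)
  note UV = C csub_opsD[OF ops]
  define U' where "U' f = (\<lambda>x. if x \<in> pts X then U f x else 0)" for f
  define V' where "V' f = (\<lambda>x. if x \<in> pts Y then V f x else 0)" for f
  have lin: "linear (\<lambda>f x. if x \<in> S then W f x else 0)" if "ker_op T S W"
    for S :: "'x set" and T :: "'y set" and W
  proof -
    have "linear (\<lambda>f. W f x)" if "x \<in> S" for x
      using fin_fun_linear[OF ker_opD[OF \<open>ker_op T S W\<close> that]] .
    then show ?thesis
      by (auto simp: linear_iff fun_eq_iff plus_fun_def scaleR_fun_def)
  qed
  have UV1: "U (V' f) x = f x" if "x \<in> pts X" for f x
    using ker_op_cong[OF UV(2) _ that, of "V' f" "V f"] UV(6)[OF that] by (simp add: V'_def)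
  show ?thesis
  proof (rule that[of U' V'])
    show "ker_op (pts Y) (pts X) U'" "ker_op (pts X) (pts Y) V'"
      using UV(2,3) by (auto simp: ker_op_def U'_def V'_def)
    show "linear U'" "linear V'"
      unfolding U'_def V'_def using lin UV(2,3) by blast+
    show "lip_le X (C * L) (U' f)" if "0 \<le> L" "lip_le Y L f" for L f
      using UV(4)[OF that] by (rule lip_le_cong) (simp add: U'_def)
    show "lip_le Y (C * L) (V' f)" if "0 \<le> L" "lip_le X L f" for L f
      using UV(5)[OF that] by (rule lip_le_cong) (simp add: V'_def)
    show "U' (V' f) x = f x" if "x \<in> pts X" for f x
      using that UV1 by (simp add: U'_def)
    then show "U' (V' (U' g)) = U' g" for g
      by (auto simp: U'_def fun_eq_iff)
    show "V' (U' (V' f)) = V' f" for f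
    proof
      fix y
      show "V' (U' (V' f)) y = V' f y"
      proof (cases "y \<in> pts Y")
        case True
        have "V (U' (V' f)) y = V f y"
          by (rule ker_op_cong[OF UV(3) _ True]) (simp add: U'_def UV1)
        then show ?thesis by (simp add: V'_def)
      qed (simp add: V'_def)
    qed
  qed (use UV in auto)
qed

lemma ciso_sym: "ciso X Y \<Longrightarrow> ciso Y X"
  unfolding ciso_def by blast

lemma ciso_trans:
  assumes "ciso X Y" "ciso Y Z"
  shows "ciso X Z"
proof -
  obtain C U V where UV: "0 \<le> C" "csub_ops C X Y U V" "csub_ops C Y X V U"
    using assms(1) unfolding ciso_def by auto
  obtain D U' V' where UV': "0 \<le> D" "csub_ops D Y Z U' V'" "csub_ops D Z Y V' U'"
    using assms(2) unfolding ciso_def by auto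
  have "csub_ops (C * D) X Z (\<lambda>f. U (U' f)) (\<lambda>f. V' (V f))"
    by (rule csub_ops_trans[OF UV(1,2) UV'(1,2)])
  moreover have "csub_ops (C * D) Z X (\<lambda>f. V' (V f)) (\<lambda>f. U (U' f))"
    unfolding mult.commute[of C D] by (rule csub_ops_trans[OF UV'(1,3) UV(1,3)])
  ultimately show ?thesis
    using UV(1) UV'(1) unfolding ciso_def by (metis mult_nonneg_nonneg)
qed

text \<open>
  The \<open>\<ell>\<^sub>1\<close>-sum: the distance between points of different summands adds nothing to the bounds by the
  weights.
\<close>

definition wedge :: "'j set \<Rightarrow> ('j \<Rightarrow> 'a lspace) \<Rightarrow> ('j \<times> 'a) lspace"
  where "wedge J K = \<lparr>pts = Sigma J (\<lambda>j. pts (K j)), wt = (\<lambda>(j, x). wt (K j) x),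
    ds = (\<lambda>(i, x) (j, y). if i = j then ds (K j) x y else wt (K i) x + wt (K j) y)\<rparr>"

lemma pts_wedge [simp]: "(j, x) \<in> pts (wedge J K) \<longleftrightarrow> j \<in> J \<and> x \<in> pts (K j)"
  by (simp add: wedge_def)

lemma lip_le_wedge: "lip_le (wedge J K) L f \<longleftrightarrow> (\<forall>j\<in>J. lip_le (K j) L (\<lambda>x. f (j, x)))"
proof
  assume *: "\<forall>j\<in>J. lip_le (K j) L (\<lambda>x. f (j, x))"
  show "lip_le (wedge J K) L f"
  proof (rule lip_leI)
    fix x y assume "x \<in> pts (wedge J K)" "y \<in> pts (wedge J K)"
    moreover obtain i s j t where "x = (i, s)" "y = (j, t)" by fastforce
    ultimately have xy: "x = (i, s)" "y = (j, t)" "i \<in> J" "j \<in> J" "s \<in> pts (K i)" "t \<in> pts (K j)"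
      by auto
    have i: "\<bar>f (i, s)\<bar> \<le> L * wt (K i) s" and j: "\<bar>f (j, t)\<bar> \<le> L * wt (K j) t"
      using lip_leD(1)[OF *[rule_format]] xy by auto
    show "\<bar>f x - f y\<bar> \<le> L * ds (wedge J K) x y"
    proof (cases "i = j")
      case True
      then show ?thesis
        using lip_leD(2)[OF *[rule_format, of j]] xy by (auto simp: wedge_def)
    next
      case False
      then show ?thesis
        using i j xy by (simp add: wedge_def distrib_left)
    qed
  next
    fix x assume "x \<in> pts (wedge J K)"
    then show "\<bar>f x\<bar> \<le> L * wt (wedge J K) x"
      using * by (auto simp: wedge_def lip_le_def)
  qed
next
  assume *: "lip_le (wedge J K) L f"
  show "\<forall>j\<in>J. lip_le (K j) L (\<lambda>x. f (j, x))"
  proof (intro ballI lip_leI)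
    fix j x y assume "j \<in> J" "x \<in> pts (K j)" "y \<in> pts (K j)"
    then show "\<bar>f (j, x) - f (j, y)\<bar> \<le> L * ds (K j) x y"
      using lip_leD(2)[OF *, of "(j, x)" "(j, y)"] by (simp add: wedge_def)
  next
    fix j x assume "j \<in> J" "x \<in> pts (K j)"
    then show "\<bar>f (j, x)\<bar> \<le> L * wt (K j) x"
      using lip_leD(1)[OF *, of "(j, x)"] by (simp add: wedge_def)
  qed
qed

lemma wf_wedge: "(\<And>j. j \<in> J \<Longrightarrow> wf_lspace (K j)) \<Longrightarrow> wf_lspace (wedge J K)"
  by (auto simp: wf_lspace_def wedge_def)

lemma csub_summand:
  assumes "j \<in> J" "\<And>j. j \<in> J \<Longrightarrow> wf_lspace (K j)"
  shows "csub 1 (K j) (wedge J K)"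
proof (rule csubI[of _ _ _ "\<lambda>g x. g (j, x)" "\<lambda>f (i, x). if i = j then f x else 0"])
  show "lip_le (K j) (1 * L) (\<lambda>x. f (j, x))" if "lip_le (wedge J K) L f" for L f
    using that assms by (simp add: lip_le_wedge)
  show "lip_le (wedge J K) (1 * L) (\<lambda>(i, x). if i = j then f x else 0)"
    if "0 \<le> L" "lip_le (K j) L f" for L f
    unfolding lip_le_wedge
    using that assms by (auto simp: lip_le_def wf_lspace_def)
  show "ker_op (pts (K j)) (pts (wedge J K)) (\<lambda>f (i, x). if i = j then f x else 0)"
  proof (rule ker_opI)
    fix z assume "z \<in> pts (wedge J K)"
    then obtain i x where z: "z = (i, x)" "i \<in> J" "x \<in> pts (K i)"
      by (cases z) auto
    show "fin_fun (pts (K j)) (\<lambda>f. case z of (i, x) \<Rightarrow> if i = j then f x else 0)"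
      using z by (cases "i = j") (simp_all add: fin_fun_eval fin_fun_zero)
  qed
qed (auto simp: ker_op_def assms intro: fin_fun_eval)

lemma csub_empty:
  assumes "pts X = {}" "wf_lspace Y" "0 \<le> C"
  shows "csub C X Y"
  using assms
  by (intro csubI[of _ _ _ "\<lambda>_ _. 0" "\<lambda>_ _. 0"])
    (auto simp: ker_op_def lip_le_def wf_lspace_def intro: fin_fun_zero)

lemma csub_wedge_mono:
  assumes "0 \<le> C" "\<And>j. j \<in> J \<Longrightarrow> csub C (K j) (K' j)"
  shows "csub C (wedge J K) (wedge J K')"
proof -
  have "\<forall>j\<in>J. \<exists>U V. csub_ops C (K j) (K' j) U V"
    using assms(2) unfolding csub_def by blast
  then obtain U V where ops: "csub_ops C (K j) (K' j) (U j) (V j)" if "j \<in> J" for j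
    by metis
  note UV = csub_opsD[OF ops]
  show ?thesis
  proof (rule csubI[of _ _ _ "\<lambda>g (j, x). U j (\<lambda>y. g (j, y)) x" "\<lambda>g (j, x). V j (\<lambda>y. g (j, y)) x"])
    show "ker_op (pts (wedge J K')) (pts (wedge J K)) (\<lambda>g (j, x). U j (\<lambda>y. g (j, y)) x)"
      "ker_op (pts (wedge J K)) (pts (wedge J K')) (\<lambda>g (j, x). V j (\<lambda>y. g (j, y)) x)"
      by (auto simp: ker_op_def intro!: fin_fun_comp[OF ker_opD[OF UV(1)]]
        fin_fun_comp[OF ker_opD[OF UV(2)]] fin_fun_eval)
  qed (use assms(1) UV(3-5) in \<open>auto simp: lip_le_wedge\<close>)
qed

section \<open>Pelczynski's decomposition method\<close>

text \<open>\<open>\<iota>\<close> is a bijective pairing of indices whose second component alone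
  determines the space. So every summand recurs in each of countably many copies, and
  \<open>E\<close> is isometric to the sum of countably many copies of itself.\<close>

locale self_similar =
  fixes K :: "nat \<Rightarrow> 'a lspace" and \<iota> :: "nat \<Rightarrow> nat \<Rightarrow> nat" and fst' snd' :: "nat \<Rightarrow> nat"
  assumes wf_K: "wf_lspace (K n)"
    and fst' [simp]: "fst' (\<iota> j m) = j" and snd' [simp]: "snd' (\<iota> j m) = m"
    and \<iota>_eta [simp]: "\<iota> (fst' n) (snd' n) = n"
    and K_\<iota> [simp]: "K (\<iota> j m) = K m"
begin

abbreviation "E \<equiv> wedge UNIV K"

text \<open>The \<open>j\<close>-th component of \<open>g\<close> when \<open>E\<close> is read as a
  sum of copies of \<open>E\<close>; \<open>glue\<close> is the inverse identification.\<close>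

definition slice :: "nat \<Rightarrow> (nat \<times> 'a \<Rightarrow> real) \<Rightarrow> nat \<times> 'a \<Rightarrow> real"
  where "slice j g = (\<lambda>(m, t). g (\<iota> j m, t))"

definition glue :: "(nat \<Rightarrow> nat \<times> 'a \<Rightarrow> real) \<Rightarrow> nat \<times> 'a \<Rightarrow> real"
  where "glue G = (\<lambda>(n, t). G (fst' n) (snd' n, t))"

lemma slice_glue [simp]: "slice j (glue G) = G j"
  by (simp add: slice_def glue_def fun_eq_iff)

lemma glue_slice [simp]: "glue (\<lambda>j. slice j g) = g"
  by (simp add: slice_def glue_def fun_eq_iff)

lemma K_snd' [simp]: "K (snd' n) = K n"
  using K_\<iota>[of "fst' n" "snd' n"] by simp

lemma wf_E: "wf_lspace E"
  by (intro wf_wedge wf_K)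

lemma lip_le_slice: "lip_le E L g \<Longrightarrow> lip_le E L (slice j g)"
  unfolding lip_le_wedge slice_def by simp (metis K_\<iota>)

lemma lip_le_glue: "(\<And>j. lip_le E L (G j)) \<Longrightarrow> lip_le E L (glue G)"
  unfolding lip_le_wedge glue_def by simp (metis K_snd')

lemma fin_fun_slice:
  assumes "fin_fun (pts E) \<phi>"
  shows "fin_fun (pts E) (\<lambda>g. \<phi> (slice j g))"
  by (rule fin_fun_comp[OF assms]) (auto simp: slice_def intro: fin_fun_eval)

lemma ker_op_slice: "ker_op (pts E) (pts E) (slice j)"
  by (auto simp: ker_op_def slice_def intro: fin_fun_eval)

lemma ker_op_glue: "(\<And>j. ker_op S (pts E) (\<lambda>f. G f j)) \<Longrightarrow> ker_op S (pts E) (\<lambda>f. glue (G f))"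
  by (auto simp: ker_op_def glue_def)

lemma csub_wedge_into:
  fixes H :: "'j \<Rightarrow> 'b lspace"
  assumes "countable J" "0 \<le> C" "\<And>j. j \<in> J \<Longrightarrow> csub C (H j) E"
  shows "csub C (wedge J H) E"
proof -
  have "\<forall>j\<in>J. \<exists>U V. csub_ops C (H j) E U V"
    using assms(3) unfolding csub_def by blast
  then obtain U V where ops: "csub_ops C (H j) E (U j) (V j)" if "j \<in> J" for j
    by metis
  note UV = csub_opsD[OF ops]
  define tn where "tn = to_nat_on J"
  define jn where "jn = inv_into J tn"
  have inj: "inj_on tn J"
    unfolding tn_def using assms(1) by (rule inj_on_to_nat_on)
  have jn: "jn (tn j) = j" if "j \<in> J" for j
    unfolding jn_def using inj that by simp
  have jn_J: "jn i \<in> J" if "i \<in> tn ` J" for i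
    using that jn by auto
  \<comment> \<open>The summand \<open>j\<close> is placed in the copy number \<open>tn j\<close> of
    \<open>E\<close>; copies with no \<open>j\<close> receive the zero function.\<close>
  define G where "G f i = (if i \<in> tn ` J then V (jn i) (\<lambda>x. f (jn i, x)) else (\<lambda>_. 0))" for f i
  have G_tn: "G f (tn j) = V j (\<lambda>x. f (j, x))" if "j \<in> J" for f j
    using that by (simp add: G_def jn)
  show ?thesis
  proof (rule csubI[of _ _ _ "\<lambda>g (j, x). U j (slice (tn j) g) x" "\<lambda>f. glue (G f)"])
    show "ker_op (pts E) (pts (wedge J H)) (\<lambda>g (j, x). U j (slice (tn j) g) x)"
      by (auto simp: ker_op_def intro!: fin_fun_slice ker_opD[OF UV(1)])
    show "ker_op (pts (wedge J H)) (pts E) (\<lambda>f. glue (G f))"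
    proof (intro ker_op_glue ker_opI)
      fix i x assume x: "x \<in> pts E"
      show "fin_fun (pts (wedge J H)) (\<lambda>f. G f i x)"
      proof (cases "i \<in> tn ` J")
        case True
        have "fin_fun (pts (wedge J H)) (\<lambda>f. V (jn i) (\<lambda>x. f (jn i, x)) x)"
          by (rule fin_fun_comp[OF ker_opD[OF UV(2)[OF jn_J[OF True]] x]])
            (use jn_J[OF True] in \<open>auto intro: fin_fun_eval\<close>)
        then show ?thesis
          using True by (simp add: G_def)
      qed (simp add: G_def fin_fun_zero)
    qed
    show "lip_le (wedge J H) (C * L) (\<lambda>(j, x). U j (slice (tn j) f) x)"
      if "0 \<le> L" "lip_le E L f" for L f
      unfolding lip_le_wedge[of J] using UV(3) that lip_le_slice by auto
    show "lip_le E (C * L) (glue (G f))" if "0 \<le> L" "lip_le (wedge J H) L f" for L f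
    proof (rule lip_le_glue)
      fix i
      show "lip_le E (C * L) (G f i)"
      proof (cases "i \<in> tn ` J")
        case True
        then show ?thesis
          using UV(4)[OF jn_J[OF True] that(1)] that(2) jn_J[OF True]
          by (simp add: G_def lip_le_wedge[of J])
      next
        case False
        have "lip_le E (C * L) (\<lambda>_. 0)"
          using wf_E assms(2) that(1) by (intro lip_leI) (auto simp: wf_lspace_def)
        then show ?thesis
          using False by (simp add: G_def)
      qed
    qed
    show "(\<lambda>(j, x). U j (slice (tn j) (glue (G f))) x) x = f x" if "x \<in> pts (wedge J H)" for f x
      using that UV(5) by (auto simp: G_tn split: prod.splits)
  qed (rule assms(2))
qed

end

definition sum_lspace :: "'a lspace \<Rightarrow> 'b lspace \<Rightarrow> ('a + 'b) lspace"
  where "sum_lspace X Y = \<lparr>pts = pts X <+> pts Y, wt = case_sum (wt X) (wt Y),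
    ds = (\<lambda>u v. case (u, v) of (Inl x, Inl x') \<Rightarrow> ds X x x' | (Inr y, Inr y') \<Rightarrow> ds Y y y' |
       (Inl x, Inr y) \<Rightarrow> wt X x + wt Y y | (Inr y, Inl x) \<Rightarrow> wt X x + wt Y y)\<rparr>"

lemma pts_sum_lspace [simp]: "Inl x \<in> pts (sum_lspace X Y) \<longleftrightarrow> x \<in> pts X"
  "Inr y \<in> pts (sum_lspace X Y) \<longleftrightarrow> y \<in> pts Y"
  by (auto simp: sum_lspace_def)

lemma wt_sum_lspace [simp]: "wt (sum_lspace X Y) (Inl x) = wt X x" "wt (sum_lspace X Y) (Inr y) = wt Y y"
  and ds_sum_lspace [simp]: "ds (sum_lspace X Y) (Inl x) (Inl x') = ds X x x'"
  "ds (sum_lspace X Y) (Inr y) (Inr y') = ds Y y y'"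
  "ds (sum_lspace X Y) (Inl x) (Inr y) = wt X x + wt Y y"
  "ds (sum_lspace X Y) (Inr y) (Inl x) = wt X x + wt Y y"
  by (simp_all add: sum_lspace_def)

lemma lip_le_sum_lspace:
  "lip_le (sum_lspace X Y) L f \<longleftrightarrow> lip_le X L (\<lambda>x. f (Inl x)) \<and> lip_le Y L (\<lambda>y. f (Inr y))"
proof
  assume *: "lip_le (sum_lspace X Y) L f"
  show "lip_le X L (\<lambda>x. f (Inl x)) \<and> lip_le Y L (\<lambda>y. f (Inr y))"
  proof (intro conjI lip_leI)
    show "\<bar>f (Inl x)\<bar> \<le> L * wt X x" if "x \<in> pts X" for x
      using lip_leD(1)[OF *, of "Inl x"] that by simp
    show "\<bar>f (Inr y)\<bar> \<le> L * wt Y y" if "y \<in> pts Y" for y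
      using lip_leD(1)[OF *, of "Inr y"] that by simp
    show "\<bar>f (Inl x) - f (Inl y)\<bar> \<le> L * ds X x y" if "x \<in> pts X" "y \<in> pts X" for x y
      using lip_leD(2)[OF *, of "Inl x" "Inl y"] that by simp
    show "\<bar>f (Inr x) - f (Inr y)\<bar> \<le> L * ds Y x y" if "x \<in> pts Y" "y \<in> pts Y" for x y
      using lip_leD(2)[OF *, of "Inr x" "Inr y"] that by simp
  qed
next
  assume *: "lip_le X L (\<lambda>x. f (Inl x)) \<and> lip_le Y L (\<lambda>y. f (Inr y))"
  have wX: "\<bar>f (Inl x)\<bar> \<le> L * wt X x" if "x \<in> pts X" for x
    using * that by (auto simp: lip_le_def)
  have wY: "\<bar>f (Inr y)\<bar> \<le> L * wt Y y" if "y \<in> pts Y" for y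
    using * that by (auto simp: lip_le_def)
  have XY: "\<bar>f (Inl x) - f (Inr y)\<bar> \<le> L * (wt X x + wt Y y)"
    "\<bar>f (Inr y) - f (Inl x)\<bar> \<le> L * (wt X x + wt Y y)" if "x \<in> pts X" "y \<in> pts Y" for x y
    using wX[OF that(1)] wY[OF that(2)] by (simp_all add: distrib_left)
  show "lip_le (sum_lspace X Y) L f"
  proof (rule lip_leI)
    fix u assume "u \<in> pts (sum_lspace X Y)"
    then show "\<bar>f u\<bar> \<le> L * wt (sum_lspace X Y) u"
      using wX wY by (cases u) auto
  next
    fix u v assume "u \<in> pts (sum_lspace X Y)" "v \<in> pts (sum_lspace X Y)"
    then show "\<bar>f u - f v\<bar> \<le> L * ds (sum_lspace X Y) u v"
      using XY * by (cases u; cases v) (auto simp: lip_le_def)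
  qed
qed

lemma ker_op_sum_lspaceI:
  assumes "ker_op S (pts X) (\<lambda>f x. U f (Inl x))" "ker_op S (pts Y) (\<lambda>f y. U f (Inr y))"
  shows "ker_op S (pts (sum_lspace X Y)) U"
proof (rule ker_opI)
  fix u assume "u \<in> pts (sum_lspace X Y)"
  then show "fin_fun S (\<lambda>f. U f u)"
    using assms by (cases u) (auto simp: ker_op_def)
qed

lemma ker_op_Inl: "ker_op (pts (sum_lspace X Y)) (pts X) (\<lambda>f x. f (Inl x))"
  and ker_op_Inr: "ker_op (pts (sum_lspace X Y)) (pts Y) (\<lambda>f y. f (Inr y))"
  by (auto simp: ker_op_def intro: fin_fun_eval)

lemma ker_op_add: "ker_op T S U \<Longrightarrow> ker_op T S V \<Longrightarrow> ker_op T S (\<lambda>f. U f + V f)"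
  and ker_op_diff: "ker_op T S U \<Longrightarrow> ker_op T S V \<Longrightarrow> ker_op T S (\<lambda>f. U f - V f)"
  by (auto simp: ker_op_def intro: fin_fun_add fin_fun_diff)

lemma ker_op_id: "ker_op S S (\<lambda>f. f)"
  by (auto simp: ker_op_def intro: fin_fun_eval)

context self_similar
begin

text \<open>
  The shift of Pelczynski's decomposition method: with \<open>E \<sim> Y \<oplus> Z\<close>, the isomorphism
  \<open>Y \<oplus> \<Sum>(Y \<oplus> Z) \<sim> \<Sum>(Y \<oplus> Z)\<close> moves the \<open>Y\<close>-parts one place and keeps the \<open>Z\<close>-parts.
\<close>

lemma ciso_absorb_complemented:
  assumes "csub C Y E" "wf_lspace Y"
  shows "ciso (sum_lspace Y E) E"
proof -
  note wfY = assms(2)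
  from assms(1) obtain U V where C: "0 \<le> C"
    and ker: "ker_op (pts E) (pts Y) U" "ker_op (pts Y) (pts E) V"
    and lin: "linear U" "linear V"
    and bd: "\<And>L f. 0 \<le> L \<Longrightarrow> lip_le E L f \<Longrightarrow> lip_le Y (C * L) (U f)"
      "\<And>L f. 0 \<le> L \<Longrightarrow> lip_le Y L f \<Longrightarrow> lip_le E (C * L) (V f)"
    and UV: "\<And>f x. x \<in> pts Y \<Longrightarrow> U (V f) x = f x"
    and UVU [simp]: "\<And>g. U (V (U g)) = U g" and VUV [simp]: "\<And>f. V (U (V f)) = V f"
    by (rule csub_normalised) blast
  note simps = lin[THEN linear_add] lin[THEN linear_diff]
  \<comment> \<open>\<open>A\<close> moves the part of each copy in the range of \<open>V\<close>
    one copy down and leaves the complementary part where it is; the part of copy \<open>0\<close>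
    leaves \<open>E\<close> and becomes a function on \<open>Y\<close>. \<open>B\<close> moves
    everything back up.\<close>
  define AA where "AA g j = slice j g - V (U (slice j g)) + V (U (slice (Suc j) g))" for g j
  define A where "A g = case_sum (U (slice 0 g)) (glue (AA g))" for g
  define BB where "BB f h j = (case j of 0 \<Rightarrow> V f + (slice 0 h - V (U (slice 0 h)))
     | Suc i \<Rightarrow> V (U (slice i h)) + (slice (Suc i) h - V (U (slice (Suc i) h))))" for f h j
  define B where "B F = glue (BB (\<lambda>y. F (Inl y)) (\<lambda>e. F (Inr e)))" for F
  have BA: "B (A g) = g" for g
  proof -
    have 1: "slice j (glue (AA g)) = slice j g - V (U (slice j g)) + V (U (slice (Suc j) g))" for j
      by (simp only: slice_glue AA_def)
    \<comment> \<open>The projection annihilates the complementary part and fixes its range, so only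
      the shifted part remains.\<close>
    have 2: "V (U (slice j (glue (AA g)))) = V (U (slice (Suc j) g))" for j
      by (simp add: 1 simps del: slice_glue)
    have "BB (U (slice 0 g)) (glue (AA g)) j = slice j g" for j
      by (cases j) (simp_all only: BB_def 2 nat.case, simp_all add: 1 del: slice_glue)
    then have "BB (U (slice 0 g)) (glue (AA g)) = (\<lambda>j. slice j g)"
      by blast
    then show ?thesis
      by (simp add: A_def B_def)
  qed
  have AB: "A (B F) u = F u" if "u \<in> pts (sum_lspace Y E)" for F u
  proof (cases u)
    case (Inl y)
    have "slice 0 (B F) = V (\<lambda>y. F (Inl y)) + (slice 0 (\<lambda>e. F (Inr e)) - V (U (slice 0 (\<lambda>e. F (Inr e)))))"
      by (simp only: B_def slice_glue BB_def nat.case)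
    then have "U (slice 0 (B F)) = U (V (\<lambda>y. F (Inl y)))"
      by (simp add: simps)
    then show ?thesis
      using Inl that UV by (simp add: A_def)
  next
    case (Inr e)
    define f h where "f = (\<lambda>y. F (Inl y))" and "h = (\<lambda>e. F (Inr e))"
    have BB_0: "BB f h 0 = V f + (slice 0 h - V (U (slice 0 h)))"
      and BB_Suc: "BB f h (Suc i) = V (U (slice i h)) + (slice (Suc i) h - V (U (slice (Suc i) h)))" for i
      by (simp_all only: BB_def nat.case)
    have VU_0: "V (U (BB f h 0)) = V f" and VU_Suc: "V (U (BB f h (Suc i))) = V (U (slice i h))" for i
      unfolding BB_0 BB_Suc by (simp_all add: simps)
    have "AA (glue (BB f h)) j = slice j h" for j
      unfolding AA_def slice_glue by (cases j) (simp_all only: VU_0 VU_Suc, simp_all add: BB_0 BB_Suc)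
    then have "AA (glue (BB f h)) = (\<lambda>j. slice j h)"
      by blast
    then show ?thesis
      using Inr by (simp add: A_def B_def f_def h_def)
  qed
  have kVU: "ker_op S (pts E) (\<lambda>f. V (U (W f)))" if "ker_op S (pts E) W" for S :: "'z set" and W
    by (rule ker_op_comp[OF ker_op_comp[OF ker(2,1)] that])
  have ksl: "ker_op S (pts E) (\<lambda>f. slice j (W f))" if "ker_op S (pts E) W" for S :: "'z set" and W j
    by (rule ker_op_comp[OF ker_op_slice that])
  have kA: "ker_op (pts E) (pts (sum_lspace Y E)) A"
  proof (rule ker_op_sum_lspaceI)
    show "ker_op (pts E) (pts Y) (\<lambda>f x. A f (Inl x))"
      using ker_op_comp[OF ker(1) ker_op_slice] by (simp add: A_def)
    show "ker_op (pts E) (pts E) (\<lambda>f x. A f (Inr x))"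
      unfolding A_def AA_def sum.case
      by (intro ker_op_glue ker_op_add ker_op_diff kVU ker_op_slice)
  qed
  have kB: "ker_op (pts (sum_lspace Y E)) (pts E) B"
    unfolding B_def
  proof (rule ker_op_glue)
    fix j
    show "ker_op (pts (sum_lspace Y E)) (pts E) (\<lambda>F. BB (\<lambda>y. F (Inl y)) (\<lambda>e. F (Inr e)) j)"
      unfolding BB_def
      by (cases j) (auto intro!: ker_op_add ker_op_diff kVU ksl ker_op_Inr
         ker_op_comp[OF ker(2) ker_op_Inl])
  qed
  have VU: "lip_le E (C * (C * L)) (V (U g))" if "0 \<le> L" "lip_le E L g" for g L
    using bd that C by simp
  \<comment> \<open>One bound for the constants of all components of \<open>A\<close> and
    \<open>B\<close>; each is a sum of terms with constants among \<open>1\<close>, \<open>C\<close>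
    and \<open>C * C\<close>.\<close>
  define D where "D = C + 1 + 2 * (C * C)"
  have D: "L + C * (C * L) + C * (C * L) \<le> D * L" "C * L + (L + C * (C * L)) \<le> D * L"
    "C * (C * L) + (L + C * (C * L)) \<le> D * L" "C * L \<le> D * L" "0 \<le> D" if "0 \<le> L" for L
    using C that unfolding D_def by (auto simp: algebra_simps intro: add_nonneg_nonneg)
  have AA: "lip_le E (D * L) (AA g j)" if L: "0 \<le> L" and g: "lip_le E L g" for g L j
    unfolding AA_def
    by (rule lip_le_mono[OF wf_E _ D(1)[OF L]]) (intro lip_le_add lip_le_diff lip_le_slice VU L g)
  have BB: "lip_le E (D * L) (BB f h j)"
    if L: "0 \<le> L" and f: "lip_le Y L f" and h: "lip_le E L h" for f h L j
  proof (cases j)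
    case 0
    show ?thesis
      unfolding BB_def 0 nat.case
      by (rule lip_le_mono[OF wf_E _ D(2)[OF L]]) (intro lip_le_add lip_le_diff lip_le_slice VU bd L f h)
  next
    case (Suc i)
    show ?thesis
      unfolding BB_def Suc nat.case
      by (rule lip_le_mono[OF wf_E _ D(3)[OF L]]) (intro lip_le_add lip_le_diff lip_le_slice VU L h)
  qed
  have "csub_ops D E (sum_lspace Y E) B A"
  proof (rule csub_opsI)
    fix L :: real and F
    assume "0 \<le> L" "lip_le (sum_lspace Y E) L F"
    then show "lip_le E (D * L) (B F)"
      unfolding B_def by (intro lip_le_glue BB) (auto simp: lip_le_sum_lspace)
  next
    fix L :: real and g
    assume L: "0 \<le> L" "lip_le E L g"
    have "lip_le Y (D * L) (U (slice 0 g))"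
      using bd(1)[OF L(1) lip_le_slice[OF L(2)]]
      by (rule lip_le_mono[OF wfY _ D(4)[OF L(1)]])
    then show "lip_le (sum_lspace Y E) (D * L) (A g)"
      using AA[OF L] by (auto simp: lip_le_sum_lspace A_def intro!: lip_le_glue)
  qed (use kA kB BA in auto)
  moreover have "csub_ops D (sum_lspace Y E) E A B"
    using csub_opsD(1-4)[OF calculation] AB by (intro csub_opsI)
  ultimately show ?thesis
    unfolding ciso_def using D(5)[of 0] by blast
qed

text \<open>The complemented copy of \<open>E\<close> inside \<open>Y\<close> makes the room: its
  head is split off as the new summand, its tail takes the place of the whole copy, and the
  complement of the copy is untouched.\<close>

lemma ciso_absorb_model:
  assumes "csub C E Y" "wf_lspace Y"
  shows "ciso (sum_lspace Y E) Y"
proof -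
  note wfY = assms(2)
  from assms(1) obtain U V where C: "0 \<le> C"
    and ker: "ker_op (pts Y) (pts E) U" "ker_op (pts E) (pts Y) V"
    and lin: "linear U" "linear V"
    and bd: "\<And>L f. 0 \<le> L \<Longrightarrow> lip_le Y L f \<Longrightarrow> lip_le E (C * L) (U f)"
      "\<And>L f. 0 \<le> L \<Longrightarrow> lip_le E L f \<Longrightarrow> lip_le Y (C * L) (V f)"
    and UV: "\<And>f x. x \<in> pts E \<Longrightarrow> U (V f) x = f x"
    and UVU [simp]: "\<And>g. U (V (U g)) = U g" and VUV [simp]: "\<And>f. V (U (V f)) = V f"
    by (rule csub_normalised) blast
  note simps = lin[THEN linear_add] lin[THEN linear_diff]
  \<comment> \<open>Head and tail realise \<open>E (+) E ~ E\<close>: copy \<open>0\<close> of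
    \<open>E\<close> is the head, the other copies form the tail.\<close>
  define cons where "cons h e = glue (\<lambda>j. case j of 0 \<Rightarrow> h | Suc i \<Rightarrow> slice i e)" for h e
  define tl where "tl e = glue (\<lambda>j. slice (Suc j) e)" for e
  have slice_cons [simp]: "slice 0 (cons h e) = h" and tl_cons [simp]: "tl (cons h e) = e" for h e
    by (simp_all add: cons_def tl_def)
  have cons_tl [simp]: "cons (slice 0 e) (tl e) = e" for e
  proof -
    have "(case j of 0 \<Rightarrow> slice 0 e | Suc i \<Rightarrow> slice i (tl e)) = slice j e" for j
      by (cases j) (simp_all add: tl_def)
    then show ?thesis
      by (simp add: cons_def)
  qed
  define A where "A f = case_sum (V (tl (U f)) + (f - V (U f))) (slice 0 (U f))" for f
  define B' where "B' f h = V (cons h (U f)) + (f - V (U f))" for f h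
  define B where "B F = B' (\<lambda>y. F (Inl y)) (\<lambda>e. F (Inr e))" for F
  \<comment> \<open>\<open>U (V f) = f\<close> is available only on the points of \<open>E\<close>,
    so these equalities have to be carried through each operator separately.\<close>
  have slice_cong: "slice j g e = slice j g' e" if "\<And>e. e \<in> pts E \<Longrightarrow> g e = g' e" "e \<in> pts E" for j g g' e
    by (rule ker_op_cong[OF ker_op_slice that])
  have glue_cong: "glue G e = glue G' e" if "\<And>j e. e \<in> pts E \<Longrightarrow> G j e = G' j e" "e \<in> pts E" for G G' e
    using that by (cases e) (auto simp: glue_def)
  have tl_cong: "tl g e = tl g' e" if "\<And>e. e \<in> pts E \<Longrightarrow> g e = g' e" "e \<in> pts E" for g g' e
    unfolding tl_def using that by (intro glue_cong slice_cong) auto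
  have cons_cong: "cons h g e = cons h' g' e"
    if "\<And>e. e \<in> pts E \<Longrightarrow> h e = h' e" "\<And>e. e \<in> pts E \<Longrightarrow> g e = g' e" "e \<in> pts E" for h h' g g' e
    unfolding cons_def using that by (intro glue_cong) (auto split: nat.split intro: slice_cong)
  have V_cong: "V g y = V g' y" if "\<And>e. e \<in> pts E \<Longrightarrow> g e = g' e" "y \<in> pts Y" for g g' y
    by (rule ker_op_cong[OF ker(2) that])
  have BA: "B (A f) y = f y" if y: "y \<in> pts Y" for f y
  proof -
    define f' where "f' = V (tl (U f)) + (f - V (U f))"
    have Uf': "U f' = U (V (tl (U f)))"
      by (simp add: f'_def simps)
    have "cons (slice 0 (U f)) (U f') e = U f e" if "e \<in> pts E" for e
      using cons_cong[of "slice 0 (U f)" "slice 0 (U f)" "U f'" "tl (U f)" e] that UV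
      by (simp add: Uf')
    then have "V (cons (slice 0 (U f)) (U f')) y = V (U f) y"
      using V_cong y by blast
    then show ?thesis
      by (simp add: A_def B_def B'_def flip: f'_def) (simp add: Uf', simp add: f'_def)
  qed
  have AB: "A (B F) u = F u" if u: "u \<in> pts (sum_lspace Y E)" for F u
  proof -
    define f h where "f = (\<lambda>y. F (Inl y))" and "h = (\<lambda>e. F (Inr e))"
    have UB: "U (B' f h) = U (V (cons h (U f)))"
      by (simp add: B'_def simps)
    then have UB': "U (B' f h) e = cons h (U f) e" if "e \<in> pts E" for e
      using UV[OF that] by simp
    show ?thesis
    proof (cases u)
      case (Inl y)
      then have "V (tl (U (B' f h))) y = V (U f) y"
        using tl_cong[OF UB'] u by (intro V_cong) auto
      then show ?thesis
        using Inl by (simp add: A_def B_def flip: f_def h_def) (simp add: UB, simp add: B'_def f_def)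
    next
      case (Inr e)
      then have "slice 0 (U (B' f h)) e = slice 0 (cons h (U f)) e"
        using u by (intro slice_cong UB') auto
      then show ?thesis
        using Inr by (simp add: A_def B_def flip: f_def h_def) (simp add: h_def)
    qed
  qed
  have kVU: "ker_op S (pts Y) (\<lambda>f. V (U (W f)))" if "ker_op S (pts Y) W" for S :: "'z set" and W
    by (rule ker_op_comp[OF ker_op_comp[OF ker(2,1)] that])
  have ktl: "ker_op (pts E) (pts E) tl"
    unfolding tl_def by (intro ker_op_glue ker_op_slice)
  have kA: "ker_op (pts Y) (pts (sum_lspace Y E)) A"
  proof (rule ker_op_sum_lspaceI)
    show "ker_op (pts Y) (pts Y) (\<lambda>f x. A f (Inl x))"
      unfolding A_def sum.case
      by (intro ker_op_add ker_op_diff kVU ker_op_id ker_op_comp[OF ker(2) ker_op_comp[OF ktl ker(1)]])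
    show "ker_op (pts Y) (pts E) (\<lambda>f x. A f (Inr x))"
      unfolding A_def sum.case by (rule ker_op_comp[OF ker_op_slice ker(1)])
  qed
  have kcons: "ker_op (pts (sum_lspace Y E)) (pts E) (\<lambda>F. cons (\<lambda>e. F (Inr e)) (U (\<lambda>y. F (Inl y))))"
    unfolding cons_def
  proof (rule ker_op_glue)
    fix j
    show "ker_op (pts (sum_lspace Y E)) (pts E)
        (\<lambda>F. case j of 0 \<Rightarrow> \<lambda>e. F (Inr e) | Suc i \<Rightarrow> slice i (U (\<lambda>y. F (Inl y))))"
      by (cases j) (auto intro!: ker_op_Inr ker_op_comp[OF ker_op_slice ker_op_comp[OF ker(1) ker_op_Inl]])
  qed
  have kB: "ker_op (pts (sum_lspace Y E)) (pts Y) B"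
    unfolding B_def B'_def
    by (intro ker_op_add ker_op_diff ker_op_comp[OF ker(2) kcons] kVU ker_op_Inl)
  define D where "D = C * C + 1 + C * C + C"
  have D: "C * (C * L) + (L + C * (C * L)) \<le> D * L" "C * L \<le> D * L"
    "C * ((1 + C) * L) + (L + C * (C * L)) \<le> D * L" "0 \<le> D" if "0 \<le> L" for L
    using C that unfolding D_def by (auto simp: algebra_simps intro: add_nonneg_nonneg)
  have VU: "lip_le Y (C * (C * L)) (V (U g))" if "0 \<le> L" "lip_le Y L g" for g L
    using bd that C by simp
  have A: "lip_le (sum_lspace Y E) (D * L) (A f)" if L: "0 \<le> L" and f: "lip_le Y L f" for f L
    unfolding lip_le_sum_lspace
  proof
    have "lip_le E (C * L) (tl (U f))"
      unfolding tl_def by (intro lip_le_glue lip_le_slice bd L f)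
    then have "lip_le Y (C * (C * L)) (V (tl (U f)))"
      using bd(2) C L by simp
    from lip_le_mono[OF wfY lip_le_add[OF this lip_le_diff[OF f VU[OF L f]]] D(1)[OF L]]
    show "lip_le Y (D * L) (\<lambda>x. A f (Inl x))"
      by (simp only: A_def sum.case)
    show "lip_le E (D * L) (\<lambda>y. A f (Inr y))"
      using lip_le_mono[OF wf_E lip_le_slice[OF bd(1)[OF L f]] D(2)[OF L]] by (simp add: A_def)
  qed
  have B: "lip_le Y (D * L) (B F)" if L: "0 \<le> L" and F: "lip_le (sum_lspace Y E) L F" for F L
  proof -
    define f h where "f = (\<lambda>y. F (Inl y))" and "h = (\<lambda>e. F (Inr e))"
    have f: "lip_le Y L f" and h: "lip_le E L h"
      using F by (simp_all add: lip_le_sum_lspace f_def h_def)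
    have "L \<le> (1 + C) * L" "C * L \<le> (1 + C) * L"
      using C L by (simp_all add: distrib_right)
    then have *: "lip_le E ((1 + C) * L) h" "lip_le E ((1 + C) * L) (U f)"
      using lip_le_mono[OF wf_E] h bd(1)[OF L f] by blast+
    have "lip_le E ((1 + C) * L) (cons h (U f))"
      unfolding cons_def by (intro lip_le_glue) (auto split: nat.split intro: * lip_le_slice)
    then have "lip_le Y (C * ((1 + C) * L)) (V (cons h (U f)))"
      using bd(2) C L by simp
    from lip_le_mono[OF wfY lip_le_add[OF this lip_le_diff[OF f VU[OF L f]]] D(3)[OF L]]
    show ?thesis
      by (simp add: B_def B'_def f_def h_def)
  qed
  have "csub_ops D Y (sum_lspace Y E) B A" "csub_ops D (sum_lspace Y E) Y A B"
    using A B kA kB AB BA by (auto intro!: csub_opsI)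
  then show ?thesis
    unfolding ciso_def using D(4)[of 0] by blast
qed

text \<open>Both sides are isomorphic to \<open>Y (+) E\<close>: each space absorbs the
  other.\<close>

lemma ciso_model:
  assumes "csub C Y E" "csub D E Y" "wf_lspace Y"
  shows "ciso Y E"
  using ciso_trans[OF ciso_sym[OF ciso_absorb_model] ciso_absorb_complemented] assms by blast

end

section \<open>Boxes: localisation, lacunary coordinates and change of nodes\<close>

text \<open>Functions are restricted to the pieces and glued with the weights \<open>\<phi>\<close>.
  On the piece \<open>j\<close> the values are at most \<open>L * \<beta> j\<close>, which pays for
  a partition function of Lipschitz constant \<open>K / \<beta> j\<close>. A pair of points meets at
  most four active indices, and each contributes a change of \<open>\<phi> j\<close> and a change of
  \<open>g\<close>; hence \<open>8 * K\<close>.\<close>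

lemma csub_partition:
  fixes X :: "'a lspace" and \<phi> :: "'j \<Rightarrow> 'a \<Rightarrow> real" and \<beta> :: "'j \<Rightarrow> real"
  assumes act: "\<And>x. x \<in> pts X \<Longrightarrow> finite (act x)" "\<And>x. x \<in> pts X \<Longrightarrow> card (act x) \<le> 2"
      "\<And>x. x \<in> pts X \<Longrightarrow> act x \<subseteq> J"
    and in_S: "\<And>x j. x \<in> pts X \<Longrightarrow> j \<in> act x \<Longrightarrow> x \<in> S j"
    and zero: "\<And>x j. x \<in> pts X \<Longrightarrow> j \<notin> act x \<Longrightarrow> \<phi> j x = 0"
    and sum_1: "\<And>x. x \<in> pts X \<Longrightarrow> (\<Sum>j\<in>act x. \<phi> j x) = 1"
    and le_1: "\<And>x j. x \<in> pts X \<Longrightarrow> \<bar>\<phi> j x\<bar> \<le> 1"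
    and lip: "\<And>x y j. x \<in> pts X \<Longrightarrow> y \<in> pts X \<Longrightarrow> j \<in> J \<Longrightarrow> \<beta> j * \<bar>\<phi> j x - \<phi> j y\<bar> \<le> K * ds X x y"
    and \<beta>_le: "\<And>x j. x \<in> pts X \<Longrightarrow> j \<in> act x \<Longrightarrow> \<beta> j \<le> K * wt X x"
    and wt_le: "\<And>x j. j \<in> J \<Longrightarrow> x \<in> S j \<Longrightarrow> wt X x \<le> K * \<beta> j"
    and S_sub: "\<And>j. j \<in> J \<Longrightarrow> S j \<subseteq> pts X"
    and wf: "wf_lspace X" and \<beta>_nonneg: "\<And>j. j \<in> J \<Longrightarrow> 0 \<le> \<beta> j" and K: "1 \<le> K"
  shows "csub (8 * K) X (wedge J (\<lambda>j. \<lparr>pts = S j, wt = (\<lambda>_. \<beta> j), ds = ds X\<rparr>))"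
    (is "csub _ X (wedge J ?Y)")
proof (rule csubI[of _ _ _ "\<lambda>g x. \<Sum>j\<in>act x. \<phi> j x * g (j, x)" "\<lambda>f (j, x). f x"])
  show "ker_op (pts (wedge J ?Y)) (pts X) (\<lambda>g x. \<Sum>j\<in>act x. \<phi> j x * g (j, x))"
    using act(3) in_S by (intro ker_opI fin_fun_sum fin_fun_scale fin_fun_eval) auto
  show "ker_op (pts X) (pts (wedge J ?Y)) (\<lambda>f (j, x). f x)"
    using subsetD[OF S_sub] by (auto simp: ker_op_def intro!: fin_fun_eval)
  show "(\<Sum>j\<in>act x. \<phi> j x * (case (j, x) of (j, x) \<Rightarrow> f x)) = f x" if "x \<in> pts X" for f x
    using sum_1[OF that] by (simp flip: sum_distrib_right)
  have wt: "0 \<le> wt X x" if "x \<in> pts X" for x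
    using wf that by (simp add: wf_lspace_def)
  have ds: "0 \<le> ds X x y" if "x \<in> pts X" "y \<in> pts X" for x y
    using wf that by (simp add: wf_lspace_def)
  show "lip_le (wedge J ?Y) (8 * K * L) (\<lambda>(j, x). f x)" if "0 \<le> L" and f: "lip_le X L f" for L f
    unfolding lip_le_wedge
  proof (intro ballI)
    fix j assume j: "j \<in> J"
    have "lip_le (?Y j) (8 * K * L) f"
    proof (rule lip_leI)
      fix x assume "x \<in> pts (?Y j)"
      then have x: "x \<in> S j" "x \<in> pts X"
        using S_sub[OF j] by auto
      have "\<bar>f x\<bar> \<le> L * wt X x"
        by (rule lip_leD(1)[OF f x(2)])
      also have "\<dots> \<le> L * (K * \<beta> j)"
        using wt_le[OF j x(1)] that(1) by (rule mult_left_mono)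
      also have "\<dots> \<le> 8 * K * L * \<beta> j"
        using that(1) K \<beta>_nonneg[OF j] by simp
      finally show "\<bar>f x\<bar> \<le> 8 * K * L * wt (?Y j) x"
        by simp
    next
      fix x y assume "x \<in> pts (?Y j)" "y \<in> pts (?Y j)"
      then have x: "x \<in> pts X" "y \<in> pts X"
        using S_sub[OF j] by auto
      have "\<bar>f x - f y\<bar> \<le> L * ds X x y"
        by (rule lip_leD(2)[OF f x])
      also have "\<dots> \<le> 8 * K * L * ds X x y"
        using that(1) K ds[OF x] by (intro mult_right_mono) (auto simp: mult_le_cancel_right1)
      finally show "\<bar>f x - f y\<bar> \<le> 8 * K * L * ds (?Y j) x y"
        by simp
    qed
    then show "lip_le (?Y j) (8 * K * L) (\<lambda>x. case (j, x) of (j, x) \<Rightarrow> f x)"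
      by simp
  qed
  show "lip_le X (8 * K * L) (\<lambda>x. \<Sum>j\<in>act x. \<phi> j x * g (j, x))"
    if L: "0 \<le> L" and g: "lip_le (wedge J ?Y) L g" for L g
  proof (rule lip_leI)
    have gj: "lip_le (?Y j) L (\<lambda>x. g (j, x))" if "j \<in> J" for j
      using g that by (simp add: lip_le_wedge)
    have g1: "\<bar>g (j, x)\<bar> \<le> L * \<beta> j" if "j \<in> J" "x \<in> S j" for j x
      using lip_leD(1)[OF gj[OF that(1)], of x] that(2) by simp
    have g2: "\<bar>g (j, x) - g (j, y)\<bar> \<le> L * ds X x y" if "j \<in> J" "x \<in> S j" "y \<in> S j" for j x y
      using lip_leD(2)[OF gj[OF that(1)], of x y] that(2,3) by simp
    {
      fix x assume x: "x \<in> pts X"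
      have "\<bar>\<phi> j x * g (j, x)\<bar> \<le> L * (K * wt X x)" if j: "j \<in> act x" for j
      proof -
        have J: "j \<in> J"
          using act(3)[OF x] j by auto
        have "\<bar>\<phi> j x * g (j, x)\<bar> \<le> 1 * (L * \<beta> j)"
          unfolding abs_mult by (intro mult_mono le_1 g1 x J in_S j) auto
        also have "\<dots> \<le> L * (K * wt X x)"
          using \<beta>_le[OF x j] L by (simp add: mult_left_mono)
        finally show ?thesis .
      qed
      then have "\<bar>\<Sum>j\<in>act x. \<phi> j x * g (j, x)\<bar> \<le> of_nat (card (act x)) * (L * (K * wt X x))"
        by (intro order_trans[OF sum_abs] sum_bounded_above)
      also have "\<dots> \<le> 8 * (L * (K * wt X x))"
        using act(2)[OF x] L K wt[OF x] by (intro mult_right_mono mult_nonneg_nonneg) auto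
      finally show "\<bar>\<Sum>j\<in>act x. \<phi> j x * g (j, x)\<bar> \<le> 8 * K * L * wt X x"
        by (simp add: ac_simps)
    }
    fix x y assume x: "x \<in> pts X" and y: "y \<in> pts X"
    define F where "F = act x \<union> act y"
    have F: "finite F" "card F \<le> 4" "F \<subseteq> J"
      using act(1,3)[OF x] act(1,3)[OF y] act(2)[OF x] act(2)[OF y] card_Un_le[of "act x" "act y"]
      by (auto simp: F_def)
    have sum_x: "(\<Sum>j\<in>act x. \<phi> j x * g (j, x)) = (\<Sum>j\<in>F. \<phi> j x * g (j, x))"
      using F zero[OF x] by (intro sum.mono_neutral_left) (auto simp: F_def)
    have sum_y: "(\<Sum>j\<in>act y. \<phi> j y * g (j, y)) = (\<Sum>j\<in>F. \<phi> j y * g (j, y))"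
      using F zero[OF y] by (intro sum.mono_neutral_left) (auto simp: F_def)
    \<comment> \<open>Off \<open>S j\<close> the function \<open>\<phi> j\<close> is
      \<open>0\<close>, so its value at the other point is a difference and falls under the
      Lipschitz bound.\<close>
    have half: "\<bar>\<phi> j w * g (j, w)\<bar> \<le> K * L * ds X x y"
      if "z \<notin> S j" "z \<in> pts X" "w \<in> pts X" "j \<in> J" "\<beta> j * \<bar>\<phi> j z - \<phi> j w\<bar> \<le> K * ds X x y" for j z w
    proof (cases "w \<in> S j")
      case True
      have "\<phi> j z = 0"
        using zero in_S that by blast
      then have "\<bar>\<phi> j w * g (j, w)\<bar> \<le> \<bar>\<phi> j z - \<phi> j w\<bar> * (L * \<beta> j)"
        unfolding abs_mult using g1[OF that(4) True] by (intro mult_mono) auto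
      also have "\<dots> \<le> L * (K * ds X x y)"
        using mult_left_mono[OF that(5) L] by (simp add: ac_simps)
      finally show ?thesis by (simp add: ac_simps)
    next
      case False
      then have "\<phi> j w = 0"
        using zero in_S that by blast
      then show ?thesis
        using K L ds[OF x y] by simp
    qed
    have "\<bar>\<phi> j x * g (j, x) - \<phi> j y * g (j, y)\<bar> \<le> 2 * (K * L * ds X x y)" if "j \<in> F" for j
    proof -
      have j: "j \<in> J"
        using F that by auto
      have nn: "0 \<le> K * L * ds X x y"
        using K L ds[OF x y] by simp
      note l = lip[OF x y j]
      have l': "\<beta> j * \<bar>\<phi> j y - \<phi> j x\<bar> \<le> K * ds X x y"
        using l by (simp add: abs_minus_commute)
      consider "x \<notin> S j" | "y \<notin> S j" | "x \<in> S j" "y \<in> S j"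
        by blast
      then show ?thesis
      proof cases
        case 1
        then have "\<phi> j x = 0"
          using zero in_S x by blast
        then show ?thesis
          using half[OF 1 x y j l] nn by simp
      next
        case 2
        then have "\<phi> j y = 0"
          using zero in_S y by blast
        then show ?thesis
          using half[OF 2 y x j l'] nn by simp
      next
        case 3
        have "\<bar>\<phi> j x - \<phi> j y\<bar> * \<bar>g (j, x)\<bar> \<le> \<bar>\<phi> j x - \<phi> j y\<bar> * (L * \<beta> j)"
          by (intro mult_left_mono g1 j 3) auto
        also have "\<dots> \<le> L * (K * ds X x y)"
          using mult_left_mono[OF l L] by (simp add: ac_simps)
        finally have a: "\<bar>(\<phi> j x - \<phi> j y) * g (j, x)\<bar> \<le> K * L * ds X x y"
          by (simp add: abs_mult ac_simps)
        have "\<bar>\<phi> j y\<bar> * \<bar>g (j, x) - g (j, y)\<bar> \<le> 1 * (L * ds X x y)"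
          by (intro mult_mono le_1 y g2 j 3) auto
        also have "\<dots> \<le> K * L * ds X x y"
          using K L ds[OF x y] by (simp add: mult_right_mono mult_le_cancel_right1)
        finally have b: "\<bar>\<phi> j y * (g (j, x) - g (j, y))\<bar> \<le> K * L * ds X x y"
          by (simp add: abs_mult)
        show ?thesis
          using a b by (simp add: algebra_simps)
      qed
    qed
    then have "(\<Sum>j\<in>F. \<bar>\<phi> j x * g (j, x) - \<phi> j y * g (j, y)\<bar>) \<le> of_nat (card F) * (2 * (K * L * ds X x y))"
      by (intro sum_bounded_above)
    also have "\<dots> \<le> 4 * (2 * (K * L * ds X x y))"
      using F(2) K L ds[OF x y] by (intro mult_right_mono) auto
    finally show "\<bar>(\<Sum>j\<in>act x. \<phi> j x * g (j, x)) - (\<Sum>j\<in>act y. \<phi> j y * g (j, y))\<bar> \<le> 8 * K * L * ds X x y"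
      unfolding sum_x sum_y sum_subtractf[symmetric]
      by (intro order_trans[OF sum_abs]) (simp add: mult.assoc)
  qed
qed (use K in auto)

section \<open>Boxes with constant weight and their decomposition along one coordinate\<close>

definition l1d :: "nat set \<Rightarrow> (nat \<Rightarrow> real) \<Rightarrow> (nat \<Rightarrow> real) \<Rightarrow> real"
  where "l1d I x y = (\<Sum>i\<in>I. \<bar>x i - y i\<bar>)"

lemma l1d_nonneg [simp]: "0 \<le> l1d I x y"
  by (simp add: l1d_def sum_nonneg)

lemma l1d_self [simp]: "l1d I x x = 0"
  by (simp add: l1d_def)

lemma l1d_commute: "l1d I x y = l1d I y x"
  by (simp add: l1d_def abs_minus_commute)

lemma l1d_triangle: "l1d I x z \<le> l1d I x y + l1d I y z"
  unfolding l1d_def sum.distrib[symmetric] by (intro sum_mono) auto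

lemma abs_le_l1d: "finite I \<Longrightarrow> i \<in> I \<Longrightarrow> \<bar>x i - y i\<bar> \<le> l1d I x y"
  unfolding l1d_def by (rule member_le_sum) auto

lemma l1d_split: "finite I \<Longrightarrow> i \<in> I \<Longrightarrow> l1d I x y = \<bar>x i - y i\<bar> + l1d I (x(i := c)) (y(i := c))"
  unfolding l1d_def by (subst (1 2) sum.remove[of I i]) (auto intro!: sum.cong)

text \<open>A coordinate is removed by shrinking \<open>A i\<close> to a singleton, which changes
  neither the index set nor the type of the points. The constant weight describes bounded Lipschitz
  functions.\<close>

definition bx :: "(nat \<Rightarrow> real set) \<Rightarrow> nat set \<Rightarrow> real \<Rightarrow> (nat \<Rightarrow> real) lspace"
  where "bx A I \<beta> = \<lparr>pts = Pi UNIV A, wt = (\<lambda>_. \<beta>), ds = l1d I\<rparr>"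

lemma bx_simps [simp]: "pts (bx A I \<beta>) = Pi UNIV A" "wt (bx A I \<beta>) x = \<beta>" "ds (bx A I \<beta>) = l1d I"
  by (simp_all add: bx_def)

lemma wf_bx: "0 \<le> \<beta> \<Longrightarrow> wf_lspace (bx A I \<beta>)"
  by (simp add: wf_lspace_def)

definition tent :: "real \<Rightarrow> real"
  where "tent t = max 0 (1 - \<bar>t\<bar>)"

lemma tent_lipschitz: "\<bar>tent s - tent t\<bar> \<le> \<bar>s - t\<bar>"
  by (auto simp: tent_def)

text \<open>Tents centred at the multiples of \<open>\<beta>\<close> have Lipschitz constant
  \<open>1 / \<beta>\<close>, which matches functions bounded by \<open>\<beta>\<close>. The cost of
  cutting is therefore independent of the extent of the box.\<close>

lemma csub_coordinate_localise:
  assumes I: "finite I" "i \<in> I" and \<beta>: "0 < \<beta>"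
  shows "csub 8 (bx A I \<beta>)
    (wedge UNIV (\<lambda>k::int. bx (A(i := A i \<inter> {(of_int k - 1) * \<beta>..(of_int k + 1) * \<beta>})) I \<beta>))"
proof -
  define S where "S k = Pi UNIV (A(i := A i \<inter> {(of_int k - 1) * \<beta>..(of_int k + 1) * \<beta>}))" for k :: int
  define act where "act x = {\<lfloor>x i / \<beta>\<rfloor>, \<lfloor>x i / \<beta>\<rfloor> + 1}" for x :: "nat \<Rightarrow> real"
  have S: "x \<in> S k \<longleftrightarrow> x \<in> Pi UNIV A \<and> \<bar>x i / \<beta> - of_int k\<bar> \<le> 1" for x k
    using \<beta> by (auto simp: S_def Pi_def abs_le_iff field_simps split: if_splits)
  have "csub (8 * 1) (bx A I \<beta>) (wedge UNIV (\<lambda>k. \<lparr>pts = S k, wt = (\<lambda>_. \<beta>), ds = ds (bx A I \<beta>)\<rparr>))"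
  proof (rule csub_partition[where act = act and \<phi> = "\<lambda>k x. tent (x i / \<beta> - of_int k)"])
    fix x assume x: "x \<in> pts (bx A I \<beta>)"
    show "card (act x) \<le> 2"
      by (simp add: act_def card_insert_if)
    show "x \<in> S j" if "j \<in> act x" for j
      using that x unfolding S act_def by (auto simp: abs_le_iff) linarith+
    show "tent (x i / \<beta> - of_int j) = 0" if "j \<notin> act x" for j
    proof -
      have "1 \<le> \<bar>x i / \<beta> - of_int j\<bar>"
        using that unfolding act_def by simp linarith
      then show ?thesis by (simp add: tent_def)
    qed
    show "(\<Sum>j\<in>act x. tent (x i / \<beta> - of_int j)) = 1"
    proof -
      have "\<bar>x i / \<beta> - \<lfloor>x i / \<beta>\<rfloor>\<bar> = x i / \<beta> - \<lfloor>x i / \<beta>\<rfloor>" 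
        "\<bar>x i / \<beta> - (\<lfloor>x i / \<beta>\<rfloor> + 1)\<bar> = \<lfloor>x i / \<beta>\<rfloor> + 1 - x i / \<beta>"
        "x i / \<beta> - \<lfloor>x i / \<beta>\<rfloor> \<le> 1"
        by linarith+
      then show ?thesis
        by (simp add: act_def tent_def)
    qed
    show "\<bar>tent (x i / \<beta> - of_int j)\<bar> \<le> 1" for j
      by (simp add: tent_def)
    fix y
    have "\<beta> * \<bar>tent (x i / \<beta> - of_int j) - tent (y i / \<beta> - of_int j)\<bar>
        \<le> \<beta> * \<bar>(x i / \<beta> - of_int j) - (y i / \<beta> - of_int j)\<bar>" for j
      using \<beta> by (intro mult_left_mono tent_lipschitz) auto
    also have "\<dots> j = \<bar>x i - y i\<bar>" for j
      using \<beta> by (simp add: diff_divide_distrib[symmetric] abs_divide)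
    finally show "\<beta> * \<bar>tent (x i / \<beta> - of_int j) - tent (y i / \<beta> - of_int j)\<bar>
        \<le> 1 * ds (bx A I \<beta>) x y" for j
      using abs_le_l1d[OF I, of x y] order_trans by auto
  next
    show "S k \<subseteq> pts (bx A I \<beta>)" for k
      using S by auto
  qed (use \<beta> in \<open>auto simp: act_def wf_bx\<close>)
  then show ?thesis
    by (simp add: S_def bx_def)
qed

lemma l1d_upd [simp]: "l1d I (x(i := b)) (x(i := c)) = (if i \<in> I then \<bar>b - c\<bar> else 0)" if "finite I"
proof -
  have "l1d I (x(i := b)) (x(i := c)) = (\<Sum>j\<in>I. if j = i then \<bar>b - c\<bar> else 0)"
    unfolding l1d_def by (rule sum.cong) auto
  then show ?thesis
    using that by simp
qed

lemma l1d_upd_le: "finite I \<Longrightarrow> l1d I (x(i := c)) (y(i := c)) \<le> l1d I x y"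
  unfolding l1d_def by (intro sum_mono) auto

text \<open>A function is its restriction to the lowest layer plus the increments from there to the
  other layers. Layers at heights \<open>s < t\<close> are so far apart that the bounds of their two
  increments already control the difference; hence the increments may be prescribed
  independently.\<close>

lemma csub_remove_lacunary:
  assumes I: "finite I" "i \<in> I" and A: "finite (A i)" "A i \<noteq> {}" "\<And>t. t \<in> A i \<Longrightarrow> 0 < t"
    and \<kappa>: "1 < \<kappa>" "\<And>s t. s \<in> A i \<Longrightarrow> t \<in> A i \<Longrightarrow> s < t \<Longrightarrow> \<kappa> * s \<le> t" and \<beta>: "0 < \<beta>"
  defines "c \<equiv> Min (A i)"
  shows "csub (2 + 2 * (\<kappa> / (\<kappa> - 1))) (bx A I \<beta>)
    (wedge (A i) (\<lambda>b. bx (A(i := {c})) I (if b = c then \<beta> else min \<beta> (b - c))))"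
    (is "csub ?C ?X (wedge _ ?Y)")
proof -
  have c: "c \<in> A i" "\<And>t. t \<in> A i \<Longrightarrow> c \<le> t"
    using A by (auto simp: c_def)
  have c0: "0 < c"
    using A c by blast
  \<comment> \<open>From \<open>\<kappa> * s \<le> t\<close> follows
    \<open>t - s \<ge> t * (1 - 1 / \<kappa>) = t / M\<close>; the bounds of the two increments add
    up to at most \<open>2 * t\<close>.\<close>
  define M where "M = \<kappa> / (\<kappa> - 1)"
  have M: "0 \<le> M"
    using \<kappa>(1) by (simp add: M_def)
  have gap': "t \<le> M * (t - s)" if "s \<in> A i" "t \<in> A i" "s < t" for s t
    using \<kappa>(2)[OF that] \<kappa>(1) by (simp add: M_def field_simps)
  have gap: "(s - c) + (t - c) \<le> 2 * M * \<bar>s - t\<bar>" if "s \<in> A i" "t \<in> A i" "s \<noteq> t" for s t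
  proof -
    consider "s < t" | "t < s"
      using \<open>s \<noteq> t\<close> by linarith
    then show ?thesis
    proof cases
      case 1
      then show ?thesis
        using gap'[OF that(1,2)] c0 by simp
    next
      case 2
      then show ?thesis
        using gap'[OF that(2,1)] c0 by simp
    qed
  qed
  \<comment> \<open>The index \<open>c\<close> carries the restriction to the lowest layer, with
    weight \<open>\<beta>\<close>. Every other index \<open>b\<close> carries an increment, which is
    at most \<open>2 * L * \<beta>\<close> by the weights and \<open>L * (b - c)\<close> by the
    distance of the layers.\<close>
  define U where "U g x = g (c, x(i := c)) + (if x i = c then 0 else g (x i, x(i := c)))"
    for g :: "real \<times> (nat \<Rightarrow> real) \<Rightarrow> real" and x
  define V where "V f = (\<lambda>(b, s). if b = c then f s else f (s(i := b)) - f s)"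
    for f :: "(nat \<Rightarrow> real) \<Rightarrow> real"
  have proj: "x(i := c) \<in> Pi UNIV (A(i := {c}))" if "x \<in> Pi UNIV A" for x
    using that by (auto simp: Pi_def)
  have lift: "s(i := b) \<in> Pi UNIV A" if "s \<in> Pi UNIV (A(i := {c}))" "b \<in> A i" for s b
    using that by (auto simp: Pi_def split: if_splits)
  have lift0: "s \<in> Pi UNIV A" "s i = c" if "s \<in> Pi UNIV (A(i := {c}))" for s
    using that c(1) by (auto simp: Pi_def split: if_splits)
  show ?thesis
  proof (rule csubI[of _ _ _ U V])
    show "0 \<le> ?C"
      using M by (simp add: M_def)
    show "ker_op (pts (wedge (A i) ?Y)) (pts ?X) U"
      unfolding U_def
    proof (intro ker_opI fin_fun_add)
      fix x assume "x \<in> pts ?X"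
      then have x: "x \<in> Pi UNIV A" "x i \<in> A i"
        by (auto simp: Pi_def)
      show "fin_fun (pts (wedge (A i) ?Y)) (\<lambda>g. g (c, x(i := c)))"
        using proj[OF x(1)] c by (intro fin_fun_eval) simp
      show "fin_fun (pts (wedge (A i) ?Y)) (\<lambda>g. if x i = c then 0 else g (x i, x(i := c)))"
        using proj[OF x(1)] x(2) by (cases "x i = c") (auto intro: fin_fun_eval fin_fun_zero)
    qed
    show "ker_op (pts ?X) (pts (wedge (A i) ?Y)) V"
    proof (rule ker_opI)
      fix z assume "z \<in> pts (wedge (A i) ?Y)"
      then obtain b s where z: "z = (b, s)" "b \<in> A i" "s \<in> Pi UNIV (A(i := {c}))"
        by (cases z) auto
      then show "fin_fun (pts ?X) (\<lambda>f. V f z)"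
        using lift[OF z(3,2)] lift0(1)[OF z(3)] unfolding V_def z(1) prod.case
        by (cases "b = c") (auto intro: fin_fun_eval fin_fun_diff)
    qed
    show "U (V f) x = f x" if "x \<in> pts ?X" for f x
      by (auto simp: U_def V_def)
    show "lip_le (wedge (A i) ?Y) (?C * L) (V f)" if L: "0 \<le> L" and f: "lip_le ?X L f" for L f
      unfolding lip_le_wedge
    proof
      fix b assume b: "b \<in> A i"
      have "lip_le (?Y b) (2 * L) (\<lambda>s. V f (b, s))"
      proof (rule lip_leI)
        fix s assume "s \<in> pts (?Y b)"
        then have s: "s \<in> Pi UNIV (A(i := {c}))"
          by simp
        have "\<bar>f (s(i := b)) - f s\<bar> \<le> L * (b - c)"
          using lip_leD(2)[OF f, of "s(i := b)" "s"] lift[OF s b] lift0[OF s] c(2)[OF b] I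
            l1d_upd[OF I(1), of s i b c] by (simp add: fun_upd_idem)
        moreover have "\<bar>f s\<bar> \<le> L * \<beta>" "\<bar>f (s(i := b))\<bar> \<le> L * \<beta>"
          using lip_leD(1)[OF f] lift[OF s b] lift0[OF s] by auto
        moreover have "0 \<le> L * \<beta>" "0 \<le> L * (b - c)"
          using L \<beta> c(2)[OF b] by auto
        moreover have "L * min \<beta> (b - c) = min (L * \<beta>) (L * (b - c))"
          using L by (simp add: min_mult_distrib_left)
        ultimately show "\<bar>V f (b, s)\<bar> \<le> 2 * L * wt (?Y b) s"
          by (auto simp: V_def)
      next
        fix s t assume "s \<in> pts (?Y b)" "t \<in> pts (?Y b)"
        then have s: "s \<in> Pi UNIV (A(i := {c}))" and t: "t \<in> Pi UNIV (A(i := {c}))"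
          by simp_all
        have 1: "\<bar>f s - f t\<bar> \<le> L * l1d I s t"
          using lip_leD(2)[OF f] lift0[OF s] lift0[OF t] by simp
        have "l1d I (s(i := b)) (t(i := b)) \<le> l1d I s t"
          by (rule l1d_upd_le[OF I(1)])
        then have 2: "\<bar>f (s(i := b)) - f (t(i := b))\<bar> \<le> L * l1d I s t"
          using lip_leD(2)[OF f, of "s(i := b)" "t(i := b)"] lift[OF s b] lift[OF t b] L
          by (smt (verit) bx_simps mult_left_mono)
        have "0 \<le> L * l1d I s t"
          using L by simp
        then show "\<bar>V f (b, s) - V f (b, t)\<bar> \<le> 2 * L * ds (?Y b) s t"
          using 1 2 by (auto simp: V_def)
      qed
      moreover have "wf_lspace (?Y b)"
        using \<beta> c(2)[OF b] by (intro wf_bx) auto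
      moreover have "2 * L \<le> ?C * L"
        using M L by (intro mult_right_mono) (auto simp: M_def)
      ultimately show "lip_le (?Y b) (?C * L) (\<lambda>s. V f (b, s))"
        using lip_le_mono by blast
    qed
    show "lip_le ?X (?C * L) (U g)" if L: "0 \<le> L" and g: "lip_le (wedge (A i) ?Y) L g" for L g
    proof (rule lip_leI)
      have gb: "lip_le (?Y b) L (\<lambda>s. g (b, s))" if "b \<in> A i" for b
        using g that by (simp add: lip_le_wedge)
      have g0: "\<bar>g (b, s)\<bar> \<le> L * (if b = c then \<beta> else min \<beta> (b - c))"
        if "b \<in> A i" "s \<in> Pi UNIV (A(i := {c}))" for b s
        using lip_leD(1)[OF gb[OF that(1)], of s] that(2) by simp
      have g1: "\<bar>g (b, s)\<bar> \<le> L * \<beta>" if "b \<in> A i" "s \<in> Pi UNIV (A(i := {c}))" for b s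
        using g0[OF that] L by (smt (verit) mult_left_mono min.cobounded1)
      have g2: "\<bar>g (b, s)\<bar> \<le> L * (b - c)" if "b \<in> A i" "s \<in> Pi UNIV (A(i := {c}))" "b \<noteq> c" for b s
        using g0[OF that(1,2)] L that(3) by (smt (verit) mult_left_mono min.cobounded2)
      have g3: "\<bar>g (b, s) - g (b, t)\<bar> \<le> L * l1d I s t"
        if "b \<in> A i" "s \<in> Pi UNIV (A(i := {c}))" "t \<in> Pi UNIV (A(i := {c}))" for b s t
        using lip_leD(2)[OF gb[OF that(1)], of s t] that(2,3) by simp
      {
        fix x assume "x \<in> pts ?X"
        then have x: "x \<in> Pi UNIV A" "x i \<in> A i"
          by (auto simp: Pi_def)
        have "\<bar>U g x\<bar> \<le> 2 * (L * \<beta>)"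
          using g1[OF c(1) proj[OF x(1)]] g1[OF x(2) proj[OF x(1)]] by (auto simp: U_def)
        also have "\<dots> \<le> ?C * L * \<beta>"
          using L \<beta> M by (simp add: M_def[symmetric] distrib_right)
        finally show "\<bar>U g x\<bar> \<le> ?C * L * wt ?X x"
          by simp
      }
      fix x y assume "x \<in> pts ?X" "y \<in> pts ?X"
      then have x: "x \<in> Pi UNIV A" "x i \<in> A i" and y: "y \<in> Pi UNIV A" "y i \<in> A i"
        by (auto simp: Pi_def)
      let ?d = "l1d I (x(i := c)) (y(i := c))"
      define G where "G x = (if x i = c then 0 else g (x i, x(i := c)))" for x
      have G: "\<bar>G x\<bar> \<le> L * (x i - c)" if "x \<in> Pi UNIV A" "x i \<in> A i" for x
        using g2[OF that(2) proj[OF that(1)]] by (simp add: G_def)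
      have "\<bar>G x - G y\<bar> \<le> L * ?d + L * (2 * M * \<bar>x i - y i\<bar>)"
      proof (cases "x i = y i")
        case True
        then have "\<bar>G x - G y\<bar> \<le> L * ?d"
          using g3[OF x(2) proj[OF x(1)] proj[OF y(1)]] L by (simp add: G_def)
        then show ?thesis
          using True by simp
      next
        case False
        have "\<bar>G x - G y\<bar> \<le> L * ((x i - c) + (y i - c))"
          unfolding distrib_left using G[OF x] G[OF y] by linarith
        also have "\<dots> \<le> L * (2 * M * \<bar>x i - y i\<bar>)"
          using gap[OF x(2) y(2) False] L by (rule mult_left_mono)
        finally show ?thesis
          using L by (simp add: add_increasing)
      qed
      moreover have "\<bar>g (c, x(i := c)) - g (c, y(i := c))\<bar> \<le> L * ?d"
        by (rule g3[OF c(1) proj[OF x(1)] proj[OF y(1)]])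
      ultimately have "\<bar>U g x - U g y\<bar> \<le> 2 * (L * ?d) + L * (2 * M * \<bar>x i - y i\<bar>)"
        by (simp add: U_def G_def)
      also have "\<dots> \<le> ?C * L * (\<bar>x i - y i\<bar> + ?d)"
        using L M by (simp add: M_def[symmetric] algebra_simps)
      finally show "\<bar>U g x - U g y\<bar> \<le> ?C * L * ds ?X x y"
        by (simp add: l1d_split[OF I, of x y c])
    qed
  qed
qed

text \<open>The sup bound is demanded besides the Lipschitz bound so that interpolation along one
  coordinate does not enlarge the Lipschitz constant in the other coordinates.\<close>

definition interpolates :: "real set \<Rightarrow> ((real \<Rightarrow> real) \<Rightarrow> real \<Rightarrow> real) \<Rightarrow> bool"
  where "interpolates T P \<longleftrightarrow> (\<forall>\<tau>. fin_fun T (\<lambda>h. P h \<tau>)) \<and>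
    (\<forall>h B \<tau>. (\<forall>t\<in>T. \<bar>h t\<bar> \<le> B) \<longrightarrow> \<bar>P h \<tau>\<bar> \<le> B) \<and> (\<forall>h. \<forall>t\<in>T. P h t = h t) \<and>
    (\<forall>h L \<sigma> \<tau>. 0 \<le> L \<longrightarrow> (\<forall>s\<in>T. \<forall>t\<in>T. \<bar>h s - h t\<bar> \<le> L * \<bar>s - t\<bar>) \<longrightarrow>
      \<bar>P h \<sigma> - P h \<tau>\<bar> \<le> L * \<bar>\<sigma> - \<tau>\<bar>)"

lemma interpolatesD:
  assumes "interpolates T P"
  shows "\<And>\<tau>. fin_fun T (\<lambda>h. P h \<tau>)"
    "\<And>h B \<tau>. (\<And>t. t \<in> T \<Longrightarrow> \<bar>h t\<bar> \<le> B) \<Longrightarrow> \<bar>P h \<tau>\<bar> \<le> B"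
    "\<And>h t. t \<in> T \<Longrightarrow> P h t = h t"
    "\<And>h L \<sigma> \<tau>. 0 \<le> L \<Longrightarrow> (\<And>s t. s \<in> T \<Longrightarrow> t \<in> T \<Longrightarrow> \<bar>h s - h t\<bar> \<le> L * \<bar>s - t\<bar>) \<Longrightarrow>
      \<bar>P h \<sigma> - P h \<tau>\<bar> \<le> L * \<bar>\<sigma> - \<tau>\<bar>"
  using assms by (simp_all add: interpolates_def)

text \<open>Induction on the nodes from left to right: a new largest node \<open>b\<close> adds a
  linear piece starting at the old maximum \<open>m\<close> and a constant continuation beyond
  \<open>b\<close>.\<close>

lemma interpolates_exists:
  fixes T :: "real set"
  assumes "finite T" "T \<noteq> {}"
  shows "\<exists>P. interpolates T P"
proof -
  have "T \<noteq> {} \<longrightarrow> (\<exists>P. interpolates T P)"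
    using assms(1)
  proof (induction rule: finite_linorder_max_induct)
    case (insert b T)
    show ?case
    proof (cases "T = {}")
      case True
      show ?thesis
        using True by (auto simp: interpolates_def intro!: exI[of _ "\<lambda>h \<tau>. h b"] fin_fun_eval)
    next
      case False
      then obtain P where P: "interpolates T P"
        using insert.IH by auto
      note P1 = interpolatesD(1)[OF P] and P2 = interpolatesD(2)[OF P]
        and P3 = interpolatesD(3)[OF P] and P4 = interpolatesD(4)[OF P]
      define m where "m = Max T"
      have m: "m \<in> T" "m < b"
        using insert.hyps False by (auto simp: m_def)
      have le_m: "t \<le> m" if "t \<in> T" for t
        using insert.hyps(1) that by (simp add: m_def)
      \<comment> \<open>Relative position between \<open>m\<close> and \<open>b\<close>, frozen at
        \<open>1\<close> beyond \<open>b\<close>.\<close>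
      define \<theta> where "\<theta> \<tau> = min 1 ((\<tau> - m) / (b - m))" for \<tau>
      define Q where "Q h \<tau> = (if \<tau> \<le> m then P h \<tau> else (1 - \<theta> \<tau>) * h m + \<theta> \<tau> * h b)" for h \<tau>
      have \<theta>: "0 \<le> \<theta> \<tau>" "\<theta> \<tau> \<le> 1" if "m < \<tau>" for \<tau>
        using that m by (auto simp: \<theta>_def)
      have \<theta>_lip: "(b - m) * \<bar>\<theta> \<sigma> - \<theta> \<tau>\<bar> \<le> \<bar>\<sigma> - \<tau>\<bar>" for \<sigma> \<tau>
      proof -
        have "\<bar>\<theta> \<sigma> - \<theta> \<tau>\<bar> \<le> \<bar>(\<sigma> - m) / (b - m) - (\<tau> - m) / (b - m)\<bar>"
          unfolding \<theta>_def by (auto simp: min_def)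
        also have "\<dots> = \<bar>\<sigma> - \<tau>\<bar> / (b - m)"
          using m by (simp add: diff_divide_distrib[symmetric] abs_divide)
        finally show ?thesis
          using m by (simp add: field_simps)
      qed
      have \<theta>_m: "\<theta> m = 0"
        by (simp add: \<theta>_def)
      have "fin_fun (insert b T) (\<lambda>h. Q h \<tau>)" for \<tau>
      proof (cases "\<tau> \<le> m")
        case True
        have "fin_fun (insert b T) (\<lambda>h. P h \<tau>)"
          using fin_fun_comp[OF P1, of "insert b T" "\<lambda>f. f"] by (auto intro: fin_fun_eval)
        then show ?thesis
          using True by (simp add: Q_def)
      next
        case False
        then show ?thesis
          unfolding Q_def using m by (auto intro!: fin_fun_add fin_fun_scale fin_fun_eval)
      qed
      moreover have "\<bar>Q h \<tau>\<bar> \<le> B" if B: "\<forall>t\<in>insert b T. \<bar>h t\<bar> \<le> B" for h B \<tau>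
      proof (cases "\<tau> \<le> m")
        case True
        then show ?thesis
          using P2 B by (simp add: Q_def)
      next
        case False
        then have \<tau>: "0 \<le> \<theta> \<tau>" "0 \<le> 1 - \<theta> \<tau>"
          using \<theta>[of \<tau>] by auto
        have "\<bar>(1 - \<theta> \<tau>) * h m\<bar> \<le> (1 - \<theta> \<tau>) * B" "\<bar>\<theta> \<tau> * h b\<bar> \<le> \<theta> \<tau> * B"
          unfolding abs_mult using \<tau> B m by (auto intro!: mult_left_mono)
        then show ?thesis
          using False by (simp add: Q_def algebra_simps)
      qed
      moreover have "Q h t = h t" if "t \<in> insert b T" for h t
        using that P3 le_m m by (auto simp: Q_def \<theta>_def)
      moreover have "\<bar>Q h \<sigma> - Q h \<tau>\<bar> \<le> L * \<bar>\<sigma> - \<tau>\<bar>"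
        if L: "0 \<le> L" and h: "\<forall>s\<in>insert b T. \<forall>t\<in>insert b T. \<bar>h s - h t\<bar> \<le> L * \<bar>s - t\<bar>" for h L \<sigma> \<tau>
      proof -
        have hbm: "\<bar>h b - h m\<bar> \<le> L * (b - m)"
          using h m by fastforce
        have low: "\<bar>Q h \<sigma> - Q h \<tau>\<bar> \<le> L * \<bar>\<sigma> - \<tau>\<bar>" if "\<sigma> \<le> m" "\<tau> \<le> m" for \<sigma> \<tau>
          using that P4[OF L] h by (simp add: Q_def)
        have Qm: "Q h \<tau> = (1 - \<theta> \<tau>) * h m + \<theta> \<tau> * h b" if "m \<le> \<tau>" for \<tau>
          using that P3[OF m(1)] \<theta>_m by (cases "\<tau> = m") (auto simp: Q_def)
        have high: "\<bar>Q h \<sigma> - Q h \<tau>\<bar> \<le> L * \<bar>\<sigma> - \<tau>\<bar>" if "m \<le> \<sigma>" "m \<le> \<tau>" for \<sigma> \<tau>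
        proof -
          have "Q h \<sigma> - Q h \<tau> = (\<theta> \<sigma> - \<theta> \<tau>) * (h b - h m)"
            using that by (simp add: Qm algebra_simps)
          then have "\<bar>Q h \<sigma> - Q h \<tau>\<bar> \<le> \<bar>\<theta> \<sigma> - \<theta> \<tau>\<bar> * (L * (b - m))"
            using hbm by (simp add: abs_mult mult_left_mono)
          also have "\<dots> \<le> L * \<bar>\<sigma> - \<tau>\<bar>"
            using mult_left_mono[OF \<theta>_lip L, of \<sigma> \<tau>] by (simp add: ac_simps)
          finally show ?thesis .
        qed
        \<comment> \<open>Both descriptions of \<open>Q\<close> agree at \<open>m\<close>, so the
          estimate can be split there.\<close>
        have mixed: "\<bar>Q h \<sigma> - Q h \<tau>\<bar> \<le> L * \<bar>\<sigma> - \<tau>\<bar>" if "\<sigma> \<le> m" "m \<le> \<tau>" for \<sigma> \<tau>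
        proof -
          have "L * \<bar>\<sigma> - \<tau>\<bar> = L * \<bar>\<sigma> - m\<bar> + L * \<bar>m - \<tau>\<bar>"
            using that by (simp flip: distrib_left)
          then show ?thesis
            using low[of \<sigma> m] high[of m \<tau>] that by simp
        qed
        consider "\<sigma> \<le> m" "\<tau> \<le> m" | "m \<le> \<sigma>" "m \<le> \<tau>" | "\<sigma> \<le> m" "m \<le> \<tau>" | "\<tau> \<le> m" "m \<le> \<sigma>"
          by linarith
        then show ?thesis
          using low high mixed[of \<sigma> \<tau>] mixed[of \<tau> \<sigma>] by cases (auto simp: abs_minus_commute)
      qed
      ultimately show ?thesis
        unfolding interpolates_def by (intro impI exI[of _ Q]) blast
    qed
  qed simp
  then show ?thesis
    using assms(2) by blast
qed

text \<open>\<open>U\<close> composes with the embedding \<open>u\<close>, and \<open>V\<close>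
  interpolates in coordinate \<open>i\<close> between the nodes \<open>u t\<close>. The factor
  \<open>C\<close> arises along coordinate \<open>i\<close>; across the other coordinates
  \<open>V\<close> keeps the constant.\<close>

lemma csub_coordinate_embed:
  assumes I: "finite I" "i \<in> I" and A: "finite (A i)" "A i \<noteq> {}" and u: "u \<in> A i \<rightarrow> A'"
    and lip: "\<And>s t. s \<in> A i \<Longrightarrow> t \<in> A i \<Longrightarrow> \<bar>u s - u t\<bar> \<le> C * \<bar>s - t\<bar>"
    and lip': "\<And>s t. s \<in> A i \<Longrightarrow> t \<in> A i \<Longrightarrow> \<bar>s - t\<bar> \<le> C * \<bar>u s - u t\<bar>"
    and \<beta>: "0 \<le> \<beta>" and C: "1 \<le> C"
  shows "csub C (bx A I \<beta>) (bx (A(i := A')) I \<beta>)" (is "csub _ ?X ?Y")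
proof -
  have inj: "inj_on u (A i)"
    using lip' by (fastforce intro!: inj_onI)
  define u' where "u' = inv_into (A i) u"
  have u'u [simp]: "u' (u t) = t" if "t \<in> A i" for t
    using inj that by (simp add: u'_def)
  obtain P where "interpolates (u ` A i) P"
    using interpolates_exists[of "u ` A i"] A by auto
  note P = interpolatesD[OF this]
  define U where "U g x = g (x(i := u (x i)))" for g :: "(nat \<Rightarrow> real) \<Rightarrow> real" and x
  define H where "H f y = (\<lambda>t. f (y(i := u' t)))" for f :: "(nat \<Rightarrow> real) \<Rightarrow> real" and y
  define V where "V f y = P (H f y) (y i)" for f y
  have push: "x(i := u (x i)) \<in> Pi UNIV (A(i := A'))" if "x \<in> Pi UNIV A" for x
    using that u by (auto simp: Pi_def)
  have lift: "y(i := t) \<in> Pi UNIV A" if "y \<in> Pi UNIV (A(i := A'))" "t \<in> A i" for y t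
    using that by (auto simp: Pi_def split: if_splits)
  show ?thesis
  proof (rule csubI[of _ _ _ U V])
    show "ker_op (pts ?Y) (pts ?X) U"
      unfolding U_def using push by (auto simp: ker_op_def intro: fin_fun_eval)
    show "ker_op (pts ?X) (pts ?Y) V"
      unfolding V_def
    proof (rule ker_opI)
      fix y assume "y \<in> pts ?Y"
      have "y(i := u' t) \<in> pts ?X" if "t \<in> u ` A i" for t
        unfolding bx_simps
      proof (rule lift)
        show "y \<in> Pi UNIV (A(i := A'))" "u' t \<in> A i"
          using \<open>y \<in> pts ?Y\<close> that by auto
      qed
      then show "fin_fun (pts ?X) (\<lambda>f. P (H f y) (y i))"
        unfolding H_def by (intro fin_fun_comp[OF P(1)] fin_fun_eval)
    qed
    show "U (V f) x = f x" if "x \<in> pts ?X" for f x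
    proof -
      have "x i \<in> A i"
        using that by (auto simp: Pi_def)
      then show ?thesis
        by (simp add: U_def V_def P(3) H_def)
    qed
    show "lip_le ?X (C * L) (U g)" if L: "0 \<le> L" and g: "lip_le ?Y L g" for L g
    proof (rule lip_leI)
      fix x assume "x \<in> pts ?X"
      then have "\<bar>U g x\<bar> \<le> L * \<beta>"
        using lip_leD(1)[OF g, of "x(i := u (x i))"] push by (simp add: U_def)
      also have "\<dots> \<le> C * L * \<beta>"
        using C L \<beta> by (intro mult_right_mono) (auto simp: mult_le_cancel_right1)
      finally show "\<bar>U g x\<bar> \<le> C * L * wt ?X x"
        by simp
    next
      fix x y assume xy: "x \<in> pts ?X" "y \<in> pts ?X"
      then have A: "x i \<in> A i" "y i \<in> A i"
        by (auto simp: Pi_def)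
      have 1: "\<bar>U g x - U g y\<bar> \<le> L * l1d I (x(i := u (x i))) (y(i := u (y i)))"
        using lip_leD(2)[OF g, of "x(i := u (x i))" "y(i := u (y i))"] push xy by (simp add: U_def)
      have "l1d I (x(i := u (x i))) (y(i := u (y i))) =
          \<bar>u (x i) - u (y i)\<bar> + l1d I (x(i := 0)) (y(i := 0))"
        by (subst l1d_split[OF I, of _ _ 0]) simp
      also have "\<dots> \<le> C * \<bar>x i - y i\<bar> + C * l1d I (x(i := 0)) (y(i := 0))"
        using lip[OF A] mult_right_mono[OF C l1d_nonneg, of I "x(i := 0)" "y(i := 0)"] by simp
      also have "\<dots> = C * l1d I x y"
        by (subst l1d_split[OF I, of x y 0]) (simp add: distrib_left)
      finally have 2: "l1d I (x(i := u (x i))) (y(i := u (y i))) \<le> C * l1d I x y" .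
      show "\<bar>U g x - U g y\<bar> \<le> C * L * ds ?X x y"
        using order_trans[OF 1 mult_left_mono[OF 2 L]] by (simp add: ac_simps)
    qed
    show "lip_le ?Y (C * L) (V f)" if L: "0 \<le> L" and f: "lip_le ?X L f" for L f
    proof (rule lip_leI)
      fix y assume y: "y \<in> pts ?Y"
      have "\<bar>H f y t\<bar> \<le> L * \<beta>" if "t \<in> u ` A i" for t
        using that lip_leD(1)[OF f, of "y(i := u' t)"] lift y by (auto simp: H_def)
      then have "\<bar>V f y\<bar> \<le> L * \<beta>"
        unfolding V_def by (rule P(2))
      also have "\<dots> \<le> C * L * \<beta>"
        using C L \<beta> by (intro mult_right_mono) (auto simp: mult_le_cancel_right1)
      finally show "\<bar>V f y\<bar> \<le> C * L * wt ?Y y"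
        by simp
    next
      fix x y assume x: "x \<in> pts ?Y" and y: "y \<in> pts ?Y"
      let ?d = "l1d I (x(i := 0)) (y(i := 0))"
      have "\<bar>(H f x - H f y) t\<bar> \<le> L * ?d" if t: "t \<in> u ` A i" for t
      proof -
        have u't: "u' t \<in> A i"
          using t by auto
        have "\<bar>f (x(i := u' t)) - f (y(i := u' t))\<bar> \<le> L * l1d I (x(i := u' t)) (y(i := u' t))"
          using lip_leD(2)[OF f] lift[OF _ u't] x y by simp
        also have "l1d I (x(i := u' t)) (y(i := u' t)) = ?d"
          by (subst l1d_split[OF I, of _ _ 0]) simp
        finally show ?thesis
          by (simp only: H_def fun_diff_def)
      qed
      \<comment> \<open>Interpolation is linear, so its sup bound may be applied to the difference
        of the data on two parallel lines.\<close>
      then have "\<bar>P (H f x - H f y) (x i)\<bar> \<le> L * ?d"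
        by (rule P(2))
      then have 1: "\<bar>P (H f x) (x i) - P (H f y) (x i)\<bar> \<le> L * ?d"
        by (simp add: linear_diff[OF fin_fun_linear[OF P(1)]])
      have "\<bar>H f y s - H f y t\<bar> \<le> (C * L) * \<bar>s - t\<bar>" if st: "s \<in> u ` A i" "t \<in> u ` A i" for s t
      proof -
        obtain s' t' where s't': "s = u s'" "t = u t'" "s' \<in> A i" "t' \<in> A i"
          using st by auto
        have "\<bar>f (y(i := s')) - f (y(i := t'))\<bar> \<le> L * \<bar>s' - t'\<bar>"
          using lip_leD(2)[OF f, of "y(i := s')" "y(i := t')"] lift s't' y I by simp
        also have "\<dots> \<le> L * (C * \<bar>u s' - u t'\<bar>)"
          using lip' s't' L by (intro mult_left_mono) auto
        finally show ?thesis
          using s't' by (simp add: H_def ac_simps)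
      qed
      then have 2: "\<bar>P (H f y) (x i) - P (H f y) (y i)\<bar> \<le> (C * L) * \<bar>x i - y i\<bar>"
        using C L by (intro P(4)) auto
      have "\<bar>V f x - V f y\<bar> \<le> L * ?d + (C * L) * \<bar>x i - y i\<bar>"
        unfolding V_def using 1 2 by linarith
      also have "\<dots> \<le> (C * L) * ?d + (C * L) * \<bar>x i - y i\<bar>"
        using C L by (intro add_right_mono mult_right_mono) (auto simp: mult_le_cancel_right1)
      also have "\<dots> = C * L * l1d I x y"
        by (subst l1d_split[OF I, of x y 0]) (simp add: distrib_left)
      finally show "\<bar>V f x - V f y\<bar> \<le> C * L * ds ?Y x y"
        by simp
    qed
  qed (use C in auto)
qed

text \<open>A change of scale is made on the functions: multiplying them by \<open>c\<close>
  compares \<open>X\<close> with \<open>Y\<close> after all distances and weights of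
  \<open>Y\<close> have been multiplied by \<open>c\<close>.\<close>

lemma csub_ops_relabel:
  assumes \<pi>: "\<And>x. x \<in> pts X \<Longrightarrow> \<pi> x \<in> pts Y" "\<And>y. y \<in> pts Y \<Longrightarrow> \<pi>' y \<in> pts X"
      "\<And>x. x \<in> pts X \<Longrightarrow> \<pi>' (\<pi> x) = x"
    and c: "0 < c"
    and wt: "\<And>x. x \<in> pts X \<Longrightarrow> c * wt Y (\<pi> x) \<le> C * wt X x"
      "\<And>y. y \<in> pts Y \<Longrightarrow> wt X (\<pi>' y) \<le> C * (c * wt Y y)"
    and ds: "\<And>x x'. x \<in> pts X \<Longrightarrow> x' \<in> pts X \<Longrightarrow> c * ds Y (\<pi> x) (\<pi> x') \<le> C * ds X x x'"
      "\<And>y y'. y \<in> pts Y \<Longrightarrow> y' \<in> pts Y \<Longrightarrow> ds X (\<pi>' y) (\<pi>' y') \<le> C * (c * ds Y y y')"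
  shows "csub_ops C X Y (\<lambda>g x. c * g (\<pi> x)) (\<lambda>f y. f (\<pi>' y) / c)"
proof (rule csub_opsI)
  show "ker_op (pts Y) (pts X) (\<lambda>g x. c * g (\<pi> x))"
    using \<pi> by (auto simp: ker_op_def intro!: fin_fun_scale fin_fun_eval)
  have "fin_fun (pts X) (\<lambda>f. (1 / c) * f (\<pi>' y))" if "y \<in> pts Y" for y
    using \<pi>(2)[OF that] by (intro fin_fun_scale fin_fun_eval)
  then show "ker_op (pts X) (pts Y) (\<lambda>f y. f (\<pi>' y) / c)"
    by (simp add: ker_op_def)
  show "c * (f (\<pi>' (\<pi> x)) / c) = f x" if "x \<in> pts X" for f x
    using that c \<pi> by simp
next
  fix L :: real and g
  assume L: "0 \<le> L" and g: "lip_le Y L g"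
  show "lip_le X (C * L) (\<lambda>x. c * g (\<pi> x))"
  proof (rule lip_leI)
    fix x assume x: "x \<in> pts X"
    have "\<bar>c * g (\<pi> x)\<bar> \<le> c * (L * wt Y (\<pi> x))"
      using lip_leD(1)[OF g \<pi>(1)[OF x]] c by (simp add: abs_mult)
    also have "\<dots> \<le> L * (C * wt X x)"
      using mult_left_mono[OF wt(1)[OF x] L] by (simp add: ac_simps)
    finally show "\<bar>c * g (\<pi> x)\<bar> \<le> C * L * wt X x"
      by (simp add: ac_simps)
  next
    fix x x' assume x: "x \<in> pts X" "x' \<in> pts X"
    have "\<bar>c * g (\<pi> x) - c * g (\<pi> x')\<bar> \<le> c * (L * ds Y (\<pi> x) (\<pi> x'))"
      using lip_leD(2)[OF g \<pi>(1)[OF x(1)] \<pi>(1)[OF x(2)]] c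
      by (simp add: abs_mult flip: right_diff_distrib)
    also have "\<dots> \<le> L * (C * ds X x x')"
      using mult_left_mono[OF ds(1)[OF x] L] by (simp add: ac_simps)
    finally show "\<bar>c * g (\<pi> x) - c * g (\<pi> x')\<bar> \<le> C * L * ds X x x'"
      by (simp add: ac_simps)
  qed
next
  fix L :: real and f
  assume L: "0 \<le> L" and f: "lip_le X L f"
  show "lip_le Y (C * L) (\<lambda>y. f (\<pi>' y) / c)"
  proof (rule lip_leI)
    fix y assume y: "y \<in> pts Y"
    have "\<bar>f (\<pi>' y)\<bar> \<le> L * wt X (\<pi>' y)"
      by (rule lip_leD(1)[OF f \<pi>(2)[OF y]])
    also have "\<dots> \<le> L * (C * (c * wt Y y))"
      using mult_left_mono[OF wt(2)[OF y] L] .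
    finally show "\<bar>f (\<pi>' y) / c\<bar> \<le> C * L * wt Y y"
      using c by (simp add: abs_divide field_simps)
  next
    fix y y' assume y: "y \<in> pts Y" "y' \<in> pts Y"
    have "\<bar>f (\<pi>' y) - f (\<pi>' y')\<bar> \<le> L * ds X (\<pi>' y) (\<pi>' y')"
      by (rule lip_leD(2)[OF f \<pi>(2)[OF y(1)] \<pi>(2)[OF y(2)]])
    also have "\<dots> \<le> L * (C * (c * ds Y y y'))"
      using mult_left_mono[OF ds(2)[OF y] L] .
    finally show "\<bar>f (\<pi>' y) / c - f (\<pi>' y') / c\<bar> \<le> C * L * ds Y y y'"
      using c by (simp add: abs_divide field_simps flip: diff_divide_distrib)
  qed
qed

section \<open>The model space and finite boxes\<close>

text \<open>After division by \<open>k\<close> these are regular meshes of the unit cube, all with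
  weight \<open>1\<close>.\<close>

definition grid :: "nat \<Rightarrow> nat \<Rightarrow> (nat \<Rightarrow> real) lspace"
  where "grid d k = bx (\<lambda>i. if i \<in> {1..d} then real ` {0..k} else {0}) {1..d} (real k)"

text \<open>\<open>Suc\<close> excludes the grid of size \<open>0\<close>, whose weight would be
  \<open>0\<close>.\<close>

definition grid_size :: "nat \<Rightarrow> nat"
  where "grid_size j = Suc (fst (prod_decode j))"

text \<open>As \<open>prod_decode\<close> is a bijection onto the pairs, every grid size occurs infinitely often.\<close>

definition model :: "nat \<Rightarrow> (nat \<times> (nat \<Rightarrow> real)) lspace"
  where "model d = wedge UNIV (\<lambda>j. grid d (grid_size j))"

text \<open>The component of the index that carries the grid size is kept, and the number of the
  copy is coded into the other component.\<close>

interpretation model: self_similar "\<lambda>j. grid d (grid_size j)"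
  "\<lambda>j m. prod_encode (fst (prod_decode m), prod_encode (j, snd (prod_decode m)))"
  "\<lambda>n. fst (prod_decode (snd (prod_decode n)))"
  "\<lambda>n. prod_encode (fst (prod_decode n), snd (prod_decode (snd (prod_decode n))))"
  rewrites "wedge UNIV (\<lambda>j. grid d (grid_size j)) = model d"
  by unfold_locales (simp_all add: grid_def wf_bx grid_size_def model_def)

lemma csub_grid_model:
  assumes "1 \<le> k"
  shows "csub 1 (grid d k) (model d)"
proof -
  have "grid_size (prod_encode (k - 1, 0)) = k"
    using assms by (simp add: grid_size_def)
  then show ?thesis
    using csub_summand[of "prod_encode (k - 1, 0)" UNIV "\<lambda>j. grid d (grid_size j)"] model.wf_K
    by (simp add: model_def)
qed

definition scaled_grid :: "nat \<Rightarrow> real \<Rightarrow> real set"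
  where "scaled_grid k s = (\<lambda>t. s * real t) ` {0..k}"

text \<open>A rescaling by \<open>s\<close>; the singleton coordinates contribute nothing to the
  distance. The constant \<open>2\<close> is the discrepancy allowed between the weight
  \<open>\<beta>\<close> and the side \<open>s * k\<close>.\<close>

lemma csub_scaled_grid:
  fixes s \<beta> :: real and k :: nat
  assumes I: "finite I" "{1..d} \<subseteq> I" and s: "0 < s" and \<beta>: "\<beta> \<le> s * k" "s * k \<le> 2 * \<beta>"
    and grid: "\<And>i. i \<in> {1..d} \<Longrightarrow> A i = scaled_grid k s" and single: "\<And>i. i \<notin> {1..d} \<Longrightarrow> A i = {c i}"
  shows "csub 2 (bx A I \<beta>) (grid d k)" "csub 2 (grid d k) (bx A I \<beta>)"
proof -
  define \<pi> where "\<pi> x = (\<lambda>i. if i \<in> {1..d} then x i / s else 0)" for x :: "nat \<Rightarrow> real"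
  define \<pi>' where "\<pi>' y = (\<lambda>i. if i \<in> {1..d} then s * y i else c i)" for y :: "nat \<Rightarrow> real"
  have A: "x i \<in> scaled_grid k s" if "i \<in> {1..d}" "x \<in> Pi UNIV A" for x i
    using Pi_mem[OF that(2), of i] grid[OF that(1)] by simp
  have Ac: "x i = c i" if "i \<notin> {1..d}" "x \<in> Pi UNIV A" for x i
    using Pi_mem[OF that(2), of i] single[OF that(1)] by simp
  have \<pi>: "\<pi> x \<in> pts (grid d k)" if "x \<in> pts (bx A I \<beta>)" for x
    using A[OF _ that[unfolded bx_simps]] s unfolding grid_def bx_simps \<pi>_def
    by (fastforce simp: scaled_grid_def)
  have \<pi>': "\<pi>' y \<in> pts (bx A I \<beta>)" if "y \<in> pts (grid d k)" for y
    unfolding bx_simps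
  proof (rule Pi_I)
    fix i
    have "y i \<in> (if i \<in> {1..d} then real ` {0..k} else {0})"
      using that unfolding grid_def bx_simps by (rule Pi_mem) simp
    then show "\<pi>' y i \<in> A i"
      using grid[of i] single[of i] by (cases "i \<in> {1..d}") (auto simp: \<pi>'_def scaled_grid_def)
  qed
  have \<pi>'\<pi>: "\<pi>' (\<pi> x) = x" if "x \<in> pts (bx A I \<beta>)" for x
    using Ac[OF _ that[unfolded bx_simps]] s by (auto simp: \<pi>_def \<pi>'_def)
  have \<pi>\<pi>': "\<pi> (\<pi>' y) = y" if "y \<in> pts (grid d k)" for y
    using that s by (auto simp: \<pi>_def \<pi>'_def grid_def Pi_def fun_eq_iff split: if_splits)
  have ds: "s * l1d {1..d} (\<pi> x) (\<pi> y) = l1d I x y" if "x \<in> Pi UNIV A" "y \<in> Pi UNIV A" for x y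
  proof -
    have "l1d I x y = (\<Sum>i\<in>{1..d}. \<bar>x i - y i\<bar>)"
      unfolding l1d_def using I Ac[OF _ that(1)] Ac[OF _ that(2)] by (intro sum.mono_neutral_right) auto
    also have "\<dots> = s * l1d {1..d} (\<pi> x) (\<pi> y)"
      unfolding l1d_def sum_distrib_left using s
      by (intro sum.cong) (auto simp: \<pi>_def abs_divide simp flip: diff_divide_distrib)
    finally show ?thesis ..
  qed
  have ds': "l1d I (\<pi>' x) (\<pi>' y) = s * l1d {1..d} x y" if "x \<in> pts (grid d k)" "y \<in> pts (grid d k)" for x y
    using ds[of "\<pi>' x" "\<pi>' y"] \<pi>' \<pi>\<pi>' that by simp
  have "csub_ops 2 (bx A I \<beta>) (grid d k) (\<lambda>g x. s * g (\<pi> x)) (\<lambda>f y. f (\<pi>' y) / s)"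
  proof (rule csub_ops_relabel)
    show "s * wt (grid d k) (\<pi> x) \<le> 2 * wt (bx A I \<beta>) x" for x
      using \<beta> by (simp add: grid_def)
    show "wt (bx A I \<beta>) (\<pi>' x) \<le> 2 * (s * wt (grid d k) x)" for x
      using \<beta> by (simp add: grid_def)
    show "s * ds (grid d k) (\<pi> x) (\<pi> x') \<le> 2 * ds (bx A I \<beta>) x x'"
      if "x \<in> pts (bx A I \<beta>)" "x' \<in> pts (bx A I \<beta>)" for x x'
      using ds[of x x'] that by (simp add: grid_def)
    show "ds (bx A I \<beta>) (\<pi>' x) (\<pi>' x') \<le> 2 * (s * ds (grid d k) x x')"
      if "x \<in> pts (grid d k)" "x' \<in> pts (grid d k)" for x x'
      using ds'[OF that] s by (simp add: grid_def)
  qed (use \<pi> \<pi>' \<pi>'\<pi> s in auto)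
  then show "csub 2 (bx A I \<beta>) (grid d k)"
    by (auto simp: csub_def)
  have "csub_ops 2 (grid d k) (bx A I \<beta>) (\<lambda>g x. (1 / s) * g (\<pi>' x)) (\<lambda>f y. f (\<pi> y) / (1 / s))"
  proof (rule csub_ops_relabel)
    show "1 / s * wt (bx A I \<beta>) (\<pi>' x) \<le> 2 * wt (grid d k) x" for x
      using \<beta> s by (simp add: grid_def field_simps)
    show "wt (grid d k) (\<pi> x) \<le> 2 * (1 / s * wt (bx A I \<beta>) x)" for x
      using \<beta> s by (simp add: grid_def field_simps)
    show "1 / s * ds (bx A I \<beta>) (\<pi>' x) (\<pi>' x') \<le> 2 * ds (grid d k) x x'"
      if "x \<in> pts (grid d k)" "x' \<in> pts (grid d k)" for x x'
      using ds'[OF that] s by (simp add: grid_def)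
    show "ds (grid d k) (\<pi> x) (\<pi> x') \<le> 2 * (1 / s * ds (bx A I \<beta>) x x')"
      if "x \<in> pts (bx A I \<beta>)" "x' \<in> pts (bx A I \<beta>)" for x x'
      using ds[of x x'] that s by (simp add: grid_def field_simps)
  qed (use \<pi> \<pi>' \<pi>\<pi>' s in auto)
  then show "csub 2 (grid d k) (bx A I \<beta>)"
    by (auto simp: csub_def)
qed

text \<open>Rounding down both numbers changes their distance by less than \<open>1\<close>, which
  is at most half of it.\<close>

lemma floor_separated:
  fixes p q :: real
  assumes "2 \<le> \<bar>p - q\<bar>"
  shows "\<bar>of_int \<lfloor>p\<rfloor> - of_int \<lfloor>q\<rfloor>\<bar> \<le> 2 * \<bar>p - q\<bar>" "\<bar>p - q\<bar> \<le> 2 * \<bar>of_int \<lfloor>p\<rfloor> - of_int \<lfloor>q\<rfloor> :: real\<bar>"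
proof -
  have *: "\<bar>a - b\<bar> \<le> 2 * \<bar>p - q\<bar> \<and> \<bar>p - q\<bar> \<le> 2 * \<bar>a - b\<bar>"
    if "p - 1 < a" "a \<le> p" "q - 1 < b" "b \<le> q" for a b :: real
    using assms that by (smt (verit))
  show "\<bar>of_int \<lfloor>p\<rfloor> - of_int \<lfloor>q\<rfloor>\<bar> \<le> 2 * \<bar>p - q\<bar>" "\<bar>p - q\<bar> \<le> 2 * \<bar>of_int \<lfloor>p\<rfloor> - of_int \<lfloor>q\<rfloor> :: real\<bar>"
    using *[of "of_int \<lfloor>p\<rfloor>" "of_int \<lfloor>q\<rfloor>"] by linarith+
qed

text \<open>One coordinate after the other is cut into intervals of length
  \<open>2 * \<beta>\<close>, at the cost of a factor \<open>8\<close>, and each interval is rounded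
  to a mesh with \<open>k\<close> steps, at the cost of a factor \<open>2\<close>. The countable sum
  of the pieces is absorbed by \<open>model d\<close>, so each coordinate costs \<open>16\<close>;
  the last \<open>2\<close> is the rescaling to \<open>grid d k\<close>.\<close>

lemma csub_separated_box_model:
  fixes \<beta> :: real and k :: nat
  assumes I: "finite I" "{1..d} \<subseteq> I" and \<beta>: "0 < \<beta>" and k: "1 \<le> k" and J: "finite J" "J \<subseteq> {1..d}"
    and sep: "\<And>i x y. i \<in> J \<Longrightarrow> x \<in> A i \<Longrightarrow> y \<in> A i \<Longrightarrow> x \<noteq> y \<Longrightarrow> 4 * \<beta> / k \<le> \<bar>x - y\<bar>"
    and fin: "\<And>i. i \<in> J \<Longrightarrow> finite (A i)"
    and grid: "\<And>i. i \<in> {1..d} - J \<Longrightarrow> A i = scaled_grid k (2 * \<beta> / k)"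
    and single: "\<And>i. i \<notin> {1..d} \<Longrightarrow> A i = {c i}"
  shows "csub (16 ^ card J * 2) (bx A I \<beta>) (model d)"
  using J sep fin grid single
proof (induction J arbitrary: A rule: finite_induct)
  case empty
  have "csub 2 (bx A I \<beta>) (grid d k)"
    by (rule csub_scaled_grid(1)[OF I, of "2 * \<beta> / real k" \<beta> k A c]) (use empty k \<beta> in \<open>auto simp del: atLeastAtMost_iff\<close>)
  then show ?case
    using csub_trans[OF _ csub_grid_model[OF k]] by fastforce
next
  case (insert i J)
  define s where "s = 2 * \<beta> / k"
  have s: "0 < s" "s * k = 2 * \<beta>" "4 * \<beta> / k = 2 * s"
    using \<beta> k by (simp_all add: s_def)
  have i: "i \<in> {1..d}" "i \<in> I"
    using insert.prems I by auto
  define C where "C = 16 ^ card J * (2::real)"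
  have C: "0 \<le> C"
    by (simp add: C_def)
  have pieces: "csub (2 * C) (bx (A(i := A i \<inter> {(of_int m - 1) * \<beta>..(of_int m + 1) * \<beta>})) I \<beta>) (model d)" for m :: int
  proof -
    define T where "T = A i \<inter> {(of_int m - 1) * \<beta>..(of_int m + 1) * \<beta>}"
    show ?thesis
    proof (cases "T = {}")
      case True
      then have "pts (bx (A(i := T)) I \<beta>) = {}"
        by (auto simp: Pi_def)
      then show ?thesis
        unfolding T_def[symmetric] using C model.wf_E by (intro csub_empty) auto
    next
      case False
      \<comment> \<open>Shift the interval to \<open>[0, 2 * \<beta>]\<close> and round down to
        multiples of the mesh \<open>s\<close>. The assumed separation is two mesh widths, as
        \<open>floor_separated\<close> requires.\<close>
      define u where "u t = s * of_int \<lfloor>(t - (of_int m - 1) * \<beta>) / s\<rfloor>" for t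
      have "csub 2 (bx (A(i := T)) I \<beta>) (bx ((A(i := T))(i := scaled_grid k s)) I \<beta>)"
      proof (rule csub_coordinate_embed[OF I(1) i(2)])
        show "finite ((A(i := T)) i)" "(A(i := T)) i \<noteq> {}"
          using insert.prems False by (auto simp: T_def)
        show "u \<in> (A(i := T)) i \<rightarrow> scaled_grid k s"
        proof
          fix t assume "t \<in> (A(i := T)) i"
          then have t: "(of_int m - 1) * \<beta> \<le> t" "t \<le> (of_int m + 1) * \<beta>"
            by (auto simp: T_def)
          define p where "p = (t - (of_int m - 1) * \<beta>) / s"
          have "0 \<le> p" "p \<le> real k"
            using t s by (auto simp: p_def field_simps)
          then have "u t = s * real (nat \<lfloor>p\<rfloor>)" "nat \<lfloor>p\<rfloor> \<le> k"
            by (auto simp: u_def p_def nat_le_iff floor_le_iff)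
          then show "u t \<in> scaled_grid k s"
            by (auto simp: scaled_grid_def)
        qed
        fix x y assume xy: "x \<in> (A(i := T)) i" "y \<in> (A(i := T)) i"
        have "\<bar>u x - u y\<bar> \<le> 2 * \<bar>x - y\<bar> \<and> \<bar>x - y\<bar> \<le> 2 * \<bar>u x - u y\<bar>"
        proof (cases "x = y")
          case False
          then have sep: "2 * s \<le> \<bar>x - y\<bar>"
            using insert.prems(2)[of i x y] xy s(3) by (auto simp: T_def)
          let ?p = "(x - (of_int m - 1) * \<beta>) / s" and ?q = "(y - (of_int m - 1) * \<beta>) / s"
          have pq: "\<bar>x - y\<bar> = s * \<bar>?p - ?q\<bar>"
            using s by (simp add: abs_divide flip: diff_divide_distrib)
          have uv: "\<bar>u x - u y\<bar> = s * \<bar>of_int \<lfloor>?p\<rfloor> - of_int \<lfloor>?q\<rfloor>\<bar>"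
            using s by (simp add: u_def abs_mult flip: right_diff_distrib)
          have "2 \<le> \<bar>?p - ?q\<bar>"
            using sep s unfolding pq by simp
          from floor_separated[OF this] show ?thesis
            unfolding pq uv using s by (simp add: mult.left_commute[of 2 s])
        qed simp
        then show "\<bar>u x - u y\<bar> \<le> 2 * \<bar>x - y\<bar>" "\<bar>x - y\<bar> \<le> 2 * \<bar>u x - u y\<bar>"
          by blast+
      qed (use \<beta> in auto)
      moreover have "csub C (bx (A(i := scaled_grid k s)) I \<beta>) (model d)"
        unfolding C_def
      proof (rule insert.IH)
        show "(A(i := scaled_grid k s)) j = scaled_grid k (2 * \<beta> / real k)" if "j \<in> {1..d} - J" for j
          using that insert.prems(4)[of j] by (auto simp: s_def)
        show "4 * \<beta> / real k \<le> \<bar>x - y\<bar>" if "j \<in> J" "x \<in> (A(i := scaled_grid k s)) j"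
          "y \<in> (A(i := scaled_grid k s)) j" "x \<noteq> y" for j x y
          using that insert.prems(2)[of j x y] insert.hyps by (auto split: if_splits)
        show "(A(i := scaled_grid k s)) j = {c j}" if "j \<notin> {1..d}" for j
          using insert.prems(5)[OF that] that i by auto
        show "finite ((A(i := scaled_grid k s)) j)" if "j \<in> J" for j
          using insert.prems(3)[of j] that insert.hyps by auto
      qed (use insert.prems in auto)
      ultimately show ?thesis
        unfolding T_def[symmetric] using csub_trans by fastforce
    qed
  qed
  have "csub (2 * C) (wedge UNIV (\<lambda>m::int. bx (A(i := A i \<inter> {(of_int m - 1) * \<beta>..(of_int m + 1) * \<beta>})) I \<beta>)) (model d)"
    using C pieces by (intro model.csub_wedge_into) auto
  from csub_trans[OF csub_coordinate_localise[OF I(1) i(2) \<beta>] this]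
  show ?case
    using insert.hyps by (simp add: C_def)
qed

lemma finite_separated:
  fixes S :: "real set"
  assumes "finite S"
  shows "\<exists>\<delta>>0. \<forall>x\<in>S. \<forall>y\<in>S. x \<noteq> y \<longrightarrow> \<delta> \<le> \<bar>x - y\<bar>"
proof -
  define D where "D = (\<lambda>(x, y). \<bar>x - y\<bar>) ` {(x, y) \<in> S \<times> S. x \<noteq> y}"
  have "finite {(x, y) \<in> S \<times> S. x \<noteq> y}"
    using assms by (auto intro: finite_subset[of _ "S \<times> S"])
  \<comment> \<open>The inserted \<open>1\<close> serves as a gap when \<open>S\<close> has at most
    one point.\<close>
  then have D: "finite (insert 1 D)" "\<And>e. e \<in> insert 1 D \<Longrightarrow> 0 < e"
    by (auto simp: D_def)
  have "Min (insert 1 D) \<le> \<bar>x - y\<bar>" if "x \<in> S" "y \<in> S" "x \<noteq> y" for x y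
    by (rule Min_le[OF D(1)]) (use that in \<open>auto simp: D_def\<close>)
  moreover have "0 < Min (insert 1 D)"
    using D by (metis Min_in insert_not_empty)
  ultimately show ?thesis by blast
qed

text \<open>A mesh that is fine enough for the smallest gap of the box separates its points. The
  required \<open>k\<close> depends on the box, but the constant does not depend on
  \<open>k\<close>.\<close>

lemma csub_slow_box_model:
  assumes I: "finite I" "{1..d} \<subseteq> I" and \<beta>: "0 < \<beta>"
    and fin: "\<And>i. i \<in> {1..d} \<Longrightarrow> finite (A i)" and single: "\<And>i. i \<notin> {1..d} \<Longrightarrow> A i = {c i}"
  shows "csub (16 ^ d * 2) (bx A I \<beta>) (model d)"
proof -
  obtain \<delta> where \<delta>: "0 < \<delta>" "\<And>x y. x \<in> (\<Union>i\<in>{1..d}. A i) \<Longrightarrow> y \<in> (\<Union>i\<in>{1..d}. A i) \<Longrightarrow> x \<noteq> y \<Longrightarrow> \<delta> \<le> \<bar>x - y\<bar>"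
    using finite_separated[of "\<Union>i\<in>{1..d}. A i"] fin by (metis finite_UN finite_atLeastAtMost)
  obtain k0 :: nat where k0: "4 * \<beta> / \<delta> < k0"
    using reals_Archimedean2 by blast
  define k where "k = max k0 1"
  have k: "1 \<le> k" "4 * \<beta> / k \<le> \<delta>"
  proof -
    have "4 * \<beta> < \<delta> * k0"
      using k0 \<delta>(1) by (simp add: field_simps)
    also have "\<dots> \<le> \<delta> * k"
      using \<delta>(1) by (simp add: k_def)
    finally show "4 * \<beta> / k \<le> \<delta>"
      by (simp add: k_def field_simps)
  qed (simp add: k_def)
  have "csub (16 ^ card {1..d} * 2) (bx A I \<beta>) (model d)"
  proof (rule csub_separated_box_model[OF I \<beta> k(1)])
    show "4 * \<beta> / real k \<le> \<bar>x - y\<bar>" if "i \<in> {1..d}" "x \<in> A i" "y \<in> A i" "x \<noteq> y" for i x y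
      using \<delta>(2)[of x y] k(2) that by fastforce
  qed (use fin single in auto)
  then show ?thesis by simp
qed

section \<open>Boxes with lacunary coordinates\<close>

definition lacunary :: "real \<Rightarrow> real set \<Rightarrow> bool"
  where "lacunary \<kappa> S \<longleftrightarrow> (\<forall>s\<in>S. 0 < s) \<and> (\<forall>s\<in>S. \<forall>t\<in>S. s < t \<longrightarrow> \<kappa> * s \<le> t)"

lemma lacunary_subset: "lacunary \<kappa> S \<Longrightarrow> T \<subseteq> S \<Longrightarrow> lacunary \<kappa> T"
  by (auto simp: lacunary_def)

text \<open>Each removal of a lacunary coordinate leaves a finite sum of boxes with new weights, so
  the induction runs over all positive \<open>\<beta>\<close> at once. Only after the last removal
  are the remaining coordinates cut, at the scale of the weight then reached.\<close>

lemma csub_finite_box_model: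
  assumes I: "finite I" "{1..d} \<subseteq> I" and \<kappa>: "1 < \<kappa>" and J: "finite J" "J \<subseteq> I - {1..d}" and \<beta>: "0 < \<beta>"
    and fin: "\<And>i. i \<in> J \<union> {1..d} \<Longrightarrow> finite (A i)" and ne: "\<And>i. i \<in> J \<Longrightarrow> A i \<noteq> {}"
    and lac: "\<And>i. i \<in> J \<Longrightarrow> lacunary \<kappa> (A i)"
    and single: "\<And>i. i \<notin> J \<union> {1..d} \<Longrightarrow> \<exists>c. A i = {c}"
  shows "csub ((2 + 2 * (\<kappa> / (\<kappa> - 1))) ^ card J * (16 ^ d * 2)) (bx A I \<beta>) (model d)"
  using J \<beta> fin ne lac single
proof (induction J arbitrary: A \<beta> rule: finite_induct)
  case empty
  then obtain c where "\<And>i. i \<notin> {1..d} \<Longrightarrow> A i = {c i}"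
    by (simp del: atLeastAtMost_iff) metis
  then have "csub (16 ^ d * 2) (bx A I \<beta>) (model d)"
    using empty by (intro csub_slow_box_model[OF I]) auto
  then show ?case by simp
next
  case (insert i J)
  define C where "C = (2 + 2 * (\<kappa> / (\<kappa> - 1))) ^ card J * (16 ^ d * 2)"
  have C0: "0 \<le> 2 + 2 * (\<kappa> / (\<kappa> - 1))"
    using \<kappa> by (intro add_nonneg_nonneg mult_nonneg_nonneg divide_nonneg_nonneg) auto
  then have C: "0 \<le> C"
    by (simp add: C_def)
  have i: "i \<in> I" "i \<notin> {1..d}" "finite (A i)" "A i \<noteq> {}"
    using insert.prems by auto
  have lac: "0 < s" "t \<in> A i \<Longrightarrow> s < t \<Longrightarrow> \<kappa> * s \<le> t" if "s \<in> A i" for s t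
    using insert.prems(5)[of i] that by (auto simp: lacunary_def)
  define m where "m = Min (A i)"
  have "csub C (bx (A(i := {m})) I (if b = m then \<beta> else min \<beta> (b - m))) (model d)" if b: "b \<in> A i" for b
    unfolding C_def
  proof (rule insert.IH)
    have "m \<le> b"
      using b i(3) by (simp add: m_def)
    then show "0 < (if b = m then \<beta> else min \<beta> (b - m))"
      using insert.prems(2) by auto
    show "\<exists>c. (A(i := {m})) j = {c}" if "j \<notin> J \<union> {1..d}" for j
      using insert.prems(6)[of j] that by auto
    show "finite ((A(i := {m})) j)" if "j \<in> J \<union> {1..d}" for j
      using insert.prems(3)[of j] that by auto
    show "(A(i := {m})) j \<noteq> {}" "lacunary \<kappa> ((A(i := {m})) j)" if "j \<in> J" for j
      using insert.prems(4,5)[of j] insert.hyps that by auto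
  qed (use insert.prems in auto)
  then have "csub C (wedge (A i) (\<lambda>b. bx (A(i := {m})) I (if b = m then \<beta> else min \<beta> (b - m)))) (model d)"
    using C i(3) by (intro model.csub_wedge_into) (auto intro: countable_finite)
  moreover have "csub (2 + 2 * (\<kappa> / (\<kappa> - 1))) (bx A I \<beta>)
      (wedge (A i) (\<lambda>b. bx (A(i := {m})) I (if b = m then \<beta> else min \<beta> (b - m))))"
    unfolding m_def by (rule csub_remove_lacunary) (use I i lac \<kappa> insert.prems(2) in auto)
  ultimately have "csub ((2 + 2 * (\<kappa> / (\<kappa> - 1))) * C) (bx A I \<beta>) (model d)"
    by (rule csub_trans[rotated])
  then show ?case
    using insert.hyps by (simp add: C_def ac_simps)
qed

section \<open>Dyadic annuli and diagonal boxes\<close>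

definition ramp :: "nat \<Rightarrow> real \<Rightarrow> real"
  where "ramp j r = max 0 (min 1 ((r - 2 ^ j) / 2 ^ j))"

lemma ramp_bounds: "0 \<le> ramp j r" "ramp j r \<le> 1"
  by (auto simp: ramp_def)

lemma ramp_lipschitz: "2 ^ j * \<bar>ramp j r - ramp j s\<bar> \<le> \<bar>r - s\<bar>"
proof -
  have *: "\<bar>max 0 (min 1 p) - max 0 (min 1 q)\<bar> \<le> \<bar>p - q\<bar>" for p q :: real
    by (auto simp: max_def min_def)
  have "\<bar>ramp j r - ramp j s\<bar> \<le> \<bar>(r - 2 ^ j) / 2 ^ j - (s - 2 ^ j) / 2 ^ j\<bar>"
    using * unfolding ramp_def .
  also have "\<dots> = \<bar>r - s\<bar> / 2 ^ j"
    by (simp add: abs_divide flip: diff_divide_distrib)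
  finally show ?thesis
    by (simp add: field_simps)
qed

lemma ramp_eq_1: "2 ^ Suc j \<le> r \<Longrightarrow> ramp j r = 1"
  by (simp add: ramp_def field_simps)

lemma ramp_eq_0: "r \<le> 2 ^ j \<Longrightarrow> ramp j r = 0"
  by (simp add: ramp_def min.coboundedI2 divide_le_0_iff max_absorb1)

text \<open>Differences of consecutive ramps, which telescope to a partition of unity:
  \<open>bump j\<close> lives between \<open>2 ^ (j - 1)\<close> and \<open>2 ^ (j + 1)\<close>, and
  \<open>bump 0\<close> covers everything below \<open>2\<close>.\<close>

definition bump :: "nat \<Rightarrow> real \<Rightarrow> real"
  where "bump j r = (case j of 0 \<Rightarrow> 1 - ramp 0 r | Suc i \<Rightarrow> ramp i r - ramp (Suc i) r)"

lemma bump_le_1: "\<bar>bump j r\<bar> \<le> 1"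
proof (cases j)
  case (Suc i)
  then show ?thesis
    using ramp_bounds[of i r] ramp_bounds[of j r] unfolding bump_def by auto
qed (use ramp_bounds[of 0 r] in \<open>auto simp: bump_def\<close>)

text \<open>Measured in units of \<open>2 ^ j\<close>, the inner ramp rises over half a unit and
  contributes \<open>2\<close>, the outer one contributes \<open>1\<close>.\<close>

lemma bump_lipschitz: "2 ^ j * \<bar>bump j r - bump j s\<bar> \<le> 3 * \<bar>r - s\<bar>"
proof (cases j)
  case (Suc i)
  have "2 ^ j * \<bar>bump j r - bump j s\<bar> \<le> 2 ^ j * (\<bar>ramp i r - ramp i s\<bar> + \<bar>ramp j r - ramp j s\<bar>)"
    unfolding bump_def Suc by (intro mult_left_mono) auto
  also have "\<dots> = 2 * (2 ^ i * \<bar>ramp i r - ramp i s\<bar>) + 2 ^ j * \<bar>ramp j r - ramp j s\<bar>"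
    by (simp add: Suc algebra_simps)
  also have "\<dots> \<le> 2 * \<bar>r - s\<bar> + \<bar>r - s\<bar>"
    by (intro add_mono mult_left_mono ramp_lipschitz) simp
  finally show ?thesis by simp
next
  case 0
  have "\<bar>bump j r - bump j s\<bar> = \<bar>ramp 0 r - ramp 0 s\<bar>"
    unfolding 0 bump_def nat.case by linarith
  also have "\<dots> \<le> \<bar>r - s\<bar>"
    using ramp_lipschitz[of 0 r s] by simp
  also have "\<dots> \<le> 3 * \<bar>r - s\<bar>"
    by simp
  finally show ?thesis
    by (simp add: 0)
qed

text \<open>At a radius of level \<open>m\<close> the ramps below \<open>m\<close> are complete and
  those above \<open>m\<close> have not begun; only the ramp \<open>m\<close> is in between.\<close>

lemma bump_dyadic:
  assumes "2 ^ m \<le> r" "r < 2 ^ Suc m"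
  shows "j \<notin> {m, Suc m} \<Longrightarrow> bump j r = 0" "bump m r + bump (Suc m) r = 1"
proof -
  have 1: "ramp i r = 1" if "i < m" for i
  proof (rule ramp_eq_1)
    have "(2::real) ^ Suc i \<le> 2 ^ m"
      using that by (intro power_increasing) auto
    then show "2 ^ Suc i \<le> r"
      using assms by linarith
  qed
  have 0: "ramp i r = 0" if "m < i" for i
  proof (rule ramp_eq_0)
    have "(2::real) ^ Suc m \<le> 2 ^ i"
      using that by (intro power_increasing) auto
    then show "r \<le> 2 ^ i"
      using assms by linarith
  qed
  show "bump j r = 0" if "j \<notin> {m, Suc m}"
  proof (cases j)
    case 0
    then show ?thesis
      using that 1[of 0] by (simp add: bump_def)
  next
    case (Suc i)
    then have "i + 1 < m \<or> m < i"
      using that by auto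
    then show ?thesis
      using 0[of i] 0[of "Suc i"] 1[of i] 1[of "Suc i"] Suc by (auto simp: bump_def)
  qed
  have "bump m r = 1 - ramp m r"
    using 1 by (cases m) (auto simp: bump_def)
  then show "bump m r + bump (Suc m) r = 1"
    using 0[of "Suc m"] by (simp add: bump_def)
qed

lemma dyadic_level:
  assumes "1 \<le> (r::real)"
  shows "\<exists>m. 2 ^ m \<le> r \<and> r < 2 ^ Suc m"
proof -
  define n where "n = (LEAST n. r < 2 ^ n)"
  have "\<exists>n. r < 2 ^ n"
    by (rule real_arch_pow) simp
  then have n: "r < 2 ^ n"
    unfolding n_def by (rule LeastI_ex)
  then obtain m where m: "n = Suc m"
    using assms by (cases n) auto
  have "\<not> r < 2 ^ m"
    using not_less_Least[of m "\<lambda>n. r < 2 ^ n"] m by (simp add: n_def)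
  then show ?thesis
    using n m by (intro exI[of _ m]) auto
qed

text \<open>For \<open>c = 0\<close> the point \<open>p\<close> itself acts as base point. For
  \<open>c = 1\<close> a new base point is attached at distance \<open>1\<close> from
  \<open>p\<close>; all weights are then at least \<open>1\<close> and have a dyadic level.\<close>

definition based :: "(nat \<Rightarrow> real set) \<Rightarrow> nat set \<Rightarrow> real \<Rightarrow> (nat \<Rightarrow> real) \<Rightarrow> (nat \<Rightarrow> real) lspace"
  where "based A I c p = \<lparr>pts = Pi UNIV A, wt = (\<lambda>x. c + l1d I p x), ds = l1d I\<rparr>"

lemma based_simps [simp]: "pts (based A I c p) = Pi UNIV A" "wt (based A I c p) x = c + l1d I p x"
    "ds (based A I c p) = l1d I"
  by (simp_all add: based_def)

text \<open>\<open>bump j\<close> lives on an annulus, but the piece is the whole box around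
  \<open>p\<close>: its points have weight at most \<open>K * 2 ^ j\<close>, and unlike an annulus
  it is again a product of sets.\<close>

lemma csub_dyadic_annuli:
  assumes I: "finite I" and single: "\<And>i. i \<notin> I \<Longrightarrow> A i = {p i}"
  shows "csub (8 * (3 + 2 * card I)) (based A I 1 p)
    (wedge UNIV (\<lambda>j. bx (\<lambda>i. A i \<inter> {t. \<bar>t - p i\<bar> \<le> 2 * 2 ^ j}) I (2 ^ j)))"
proof -
  define S where "S j = Pi UNIV (\<lambda>i. A i \<inter> {t. \<bar>t - p i\<bar> \<le> 2 * 2 ^ j})" for j
  define \<rho> where "\<rho> x = 1 + l1d I p x" for x
  have \<rho>: "1 \<le> \<rho> x" for x
    by (simp add: \<rho>_def)
  obtain lev where lev: "\<And>r::real. 1 \<le> r \<Longrightarrow> 2 ^ lev r \<le> r \<and> r < 2 ^ Suc (lev r)"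
    using dyadic_level by metis
  define act where "act x = {lev (\<rho> x), Suc (lev (\<rho> x))}" for x
  \<comment> \<open>\<open>3\<close> comes from \<open>bump_lipschitz\<close>, and the points of the
    box have weight at most \<open>(1 + 2 * card I) * 2 ^ j\<close>.\<close>
  define K where "K = 3 + 2 * real (card I)"
  have "csub (8 * K) (based A I 1 p)
      (wedge UNIV (\<lambda>j. \<lparr>pts = S j, wt = (\<lambda>_. 2 ^ j), ds = ds (based A I 1 p)\<rparr>))"
  proof (rule csub_partition[where act = act and \<phi> = "\<lambda>j x. bump j (\<rho> x)"])
    fix x assume x: "x \<in> pts (based A I 1 p)"
    note lx = lev[OF \<rho>, of x]
    show "finite (act x)" "card (act x) \<le> 2"
      by (simp_all add: act_def)
    have act: "\<rho> x < 2 * 2 ^ j" if "j \<in> act x" for j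
    proof -
      have "(2::real) ^ lev (\<rho> x) \<le> 2 ^ j"
        using that by (intro power_increasing) (auto simp: act_def)
      then show ?thesis
        using lx unfolding power_Suc by linarith
    qed
    show "x \<in> S j" if "j \<in> act x" for j
      unfolding S_def
    proof (rule Pi_I)
      fix i
      have "\<bar>x i - p i\<bar> \<le> l1d I p x"
      proof (cases "i \<in> I")
        case True
        then show ?thesis
          using abs_le_l1d[OF I True, of p x] by linarith
      next
        case False
        then show ?thesis
          using single[OF False] Pi_mem[of x UNIV A i] x by simp
      qed
      then have "\<bar>x i - p i\<bar> \<le> 2 * 2 ^ j"
        using act[OF that] by (simp add: \<rho>_def)
      then show "x i \<in> A i \<inter> {t. \<bar>t - p i\<bar> \<le> 2 * 2 ^ j}"
        using x by auto
    qed
    show "bump j (\<rho> x) = 0" if "j \<notin> act x" for j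
      using bump_dyadic(1)[of "lev (\<rho> x)" "\<rho> x" j] lx that by (simp add: act_def)
    show "(\<Sum>j\<in>act x. bump j (\<rho> x)) = 1"
      using bump_dyadic(2)[of "lev (\<rho> x)" "\<rho> x"] lx by (simp add: act_def)
    show "2 ^ j \<le> K * wt (based A I 1 p) x" if "j \<in> act x" for j
    proof -
      have "j \<le> Suc (lev (\<rho> x))"
        using that by (auto simp: act_def)
      then have "(2::real) ^ j \<le> 2 ^ Suc (lev (\<rho> x))"
        by (intro power_increasing) auto
      also have "\<dots> \<le> 2 * \<rho> x"
        using lx by simp
      also have "\<dots> \<le> K * \<rho> x"
        using \<rho>[of x] by (intro mult_right_mono) (auto simp: K_def)
      finally show ?thesis
        by (simp add: \<rho>_def)
    qed
    fix y
    show "2 ^ j * \<bar>bump j (\<rho> x) - bump j (\<rho> y)\<bar> \<le> K * ds (based A I 1 p) x y" for j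
    proof -
      have "2 ^ j * \<bar>bump j (\<rho> x) - bump j (\<rho> y)\<bar> \<le> 3 * \<bar>\<rho> x - \<rho> y\<bar>"
        by (rule bump_lipschitz)
      also have "\<bar>\<rho> x - \<rho> y\<bar> \<le> l1d I x y"
        using l1d_triangle[of I p x y] l1d_triangle[of I p y x] l1d_commute[of I x y]
        by (simp add: \<rho>_def)
      also have "3 * l1d I x y \<le> K * l1d I x y"
        by (intro mult_right_mono) (auto simp: K_def)
      finally show ?thesis by simp
    qed
  next
    fix x :: "nat \<Rightarrow> real" and j assume "x \<in> S j"
    then have "\<bar>p i - x i\<bar> \<le> 2 * 2 ^ j" for i
      by (auto simp: S_def Pi_def abs_minus_commute)
    then have "l1d I p x \<le> real (card I) * (2 * 2 ^ j)"
      unfolding l1d_def by (intro sum_bounded_above)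
    moreover have "(1::real) \<le> 2 ^ j"
      by simp
    ultimately have "1 + l1d I p x \<le> 3 * 2 ^ j + 2 * real (card I) * 2 ^ j"
      by linarith
    then show "wt (based A I 1 p) x \<le> K * 2 ^ j"
      by (simp add: K_def distrib_right)
  qed (auto simp: bump_le_1 K_def S_def wf_lspace_def)
  then show ?thesis
    by (simp add: S_def bx_def K_def)
qed

lemma csub_based_model:
  assumes I: "finite I" "{1..d} \<subseteq> I" and \<kappa>: "1 < \<kappa>" and p: "p \<in> Pi UNIV A"
    and fin: "\<And>i r. i \<in> I \<Longrightarrow> finite (A i \<inter> {t. \<bar>t - p i\<bar> \<le> r})"
    and lac: "\<And>i. i \<in> I - {1..d} \<Longrightarrow> lacunary \<kappa> (A i)" and single: "\<And>i. i \<notin> I \<Longrightarrow> A i = {p i}"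
  shows "\<exists>C. csub C (based A I 1 p) (model d)"
proof -
  define C where "C = (2 + 2 * (\<kappa> / (\<kappa> - 1))) ^ card (I - {1..d}) * (16 ^ d * 2)"
  have "csub C (bx (\<lambda>i. A i \<inter> {t. \<bar>t - p i\<bar> \<le> 2 * 2 ^ j}) I (2 ^ j)) (model d)" for j :: nat
    unfolding C_def
  proof (rule csub_finite_box_model[OF I \<kappa>])
    show "A i \<inter> {t. \<bar>t - p i\<bar> \<le> 2 * 2 ^ j} \<noteq> {}" for i
      using p by (auto simp: Pi_def intro!: exI[of _ "p i"])
    show "lacunary \<kappa> (A i \<inter> {t. \<bar>t - p i\<bar> \<le> 2 * 2 ^ j})" if "i \<in> I - {1..d}" for i
      by (rule lacunary_subset[OF lac[OF that]]) auto
    show "\<exists>c. A i \<inter> {t. \<bar>t - p i\<bar> \<le> 2 * 2 ^ j} = {c}" if "i \<notin> I - {1..d} \<union> {1..d}" for i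
      using single[of i] that by (intro exI[of _ "p i"]) auto
    show "finite (A i \<inter> {t. \<bar>t - p i\<bar> \<le> 2 * 2 ^ j})" if "i \<in> I - {1..d} \<union> {1..d}" for i
      using fin that I(2) by auto
  qed (use I in auto)
  moreover from this have "0 \<le> C"
    by (auto simp: csub_def)
  ultimately have "csub C (wedge UNIV (\<lambda>j::nat. bx (\<lambda>i. A i \<inter> {t. \<bar>t - p i\<bar> \<le> 2 * 2 ^ j}) I (2 ^ j))) (model d)"
    by (intro model.csub_wedge_into) auto
  from csub_trans[OF csub_dyadic_annuli[OF I(1) single] this] show ?thesis
    by blast
qed

section \<open>Projections onto a sequence of boxes along the diagonal\<close>

definition clamp :: "real \<Rightarrow> real \<Rightarrow> real \<Rightarrow> real"
  where "clamp a b t = max a (min b t)"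

text \<open>While a point moves from \<open>s\<close> to \<open>t\<close>, its clamped images move
  one at a time, so their movements add up to at most the whole movement.\<close>

lemma sum_clamp_le:
  assumes ab: "\<And>j. a j \<le> b j" "\<And>j. b j \<le> a (Suc j)" and F: "finite F"
  shows "(\<Sum>j\<in>F. \<bar>clamp (a j) (b j) s - clamp (a j) (b j) t\<bar>) \<le> \<bar>s - t\<bar>"
proof -
  have *: "(\<Sum>j\<in>F. \<bar>clamp (a j) (b j) s - clamp (a j) (b j) t\<bar>) \<le> t - s" if st: "s \<le> t" for s t
  proof -
    obtain n where n: "F \<subseteq> {..<n}"
      using F finite_nat_iff_bounded by blast
    \<comment> \<open>The invariant compares the first \<open>n\<close> intervals, which lie below
      \<open>a n\<close>, with the part of the movement that takes place below
      \<open>a n\<close>.\<close>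
    have "(\<Sum>j<n. \<bar>clamp (a j) (b j) s - clamp (a j) (b j) t\<bar>) \<le> min t (a n) - min s (a n)"
    proof (induction n)
      case (Suc n)
      then show ?case
        using st ab(1)[of n] ab(2)[of n] by (auto simp: clamp_def min_def max_def split: if_splits)
    qed (use st in auto)
    also have "\<dots> \<le> t - s"
      using st by auto
    finally show ?thesis
      using sum_mono2[OF _ n, of "\<lambda>j. \<bar>clamp (a j) (b j) s - clamp (a j) (b j) t\<bar>"] by force
  qed
  show ?thesis
    using *[of s t] *[of t s] by (cases "s \<le> t") (auto simp: abs_minus_commute)
qed

text \<open>
  Removing a point of weight \<open>0\<close> turns the functions vanishing there into arbitrary ones, as
  the identity \<open>U (V f) = f\<close> in \<^const>\<open>csub_ops\<close> is required for all functions.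
\<close>

definition punctured :: "'a lspace \<Rightarrow> 'a \<Rightarrow> 'a lspace"
  where "punctured X p = \<lparr>pts = pts X - {p}, wt = wt X, ds = ds X\<rparr>"

lemma punctured_simps [simp]: "pts (punctured X p) = pts X - {p}" "wt (punctured X p) = wt X"
    "ds (punctured X p) = ds X"
  by (simp_all add: punctured_def)

lemma lip_le_punctured_based:
  assumes "lip_le (punctured (based A I 0 p) p) L g" "0 \<le> L"
  shows "lip_le (based A I 0 p) L (g(p := 0))"
proof (rule lip_leI)
  have g: "\<bar>g x\<bar> \<le> L * l1d I p x" if "x \<in> Pi UNIV A" "x \<noteq> p" for x
    using lip_leD(1)[OF assms(1), of x] that by simp
  show "\<bar>(g(p := 0)) x\<bar> \<le> L * wt (based A I 0 p) x" if "x \<in> pts (based A I 0 p)" for x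
    using g that by simp
  fix x y assume xy: "x \<in> pts (based A I 0 p)" "y \<in> pts (based A I 0 p)"
  then show "\<bar>(g(p := 0)) x - (g(p := 0)) y\<bar> \<le> L * ds (based A I 0 p) x y"
    using g[of x] g[of y] lip_leD(2)[OF assms(1), of x y] by (auto simp: l1d_commute[of I x p])
qed

lemma ker_op_extend_zero: "ker_op (S - {p}) S (\<lambda>g. g(p := 0))"
proof (rule ker_opI)
  fix x assume "x \<in> S"
  then show "fin_fun (S - {p}) (\<lambda>g. (g(p := 0)) x)"
    by (cases "x = p") (simp_all add: fin_fun_zero fin_fun_eval)
qed

text \<open>As \<open>V f\<close> vanishes at \<open>p\<close>, nothing is lost when
  \<open>p\<close> is deleted and the value \<open>0\<close> is restored before \<open>U\<close> is
  applied.\<close>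

lemma csub_punctured_based:
  assumes "csub_ops C X (based A I 0 p) U V" "0 \<le> C" "\<And>f. V f p = 0"
  shows "csub C X (punctured (based A I 0 p) p)"
proof (rule csubI[of _ _ _ "\<lambda>g. U (g(p := 0))" V])
  note ops = csub_opsD[OF assms(1)]
  have "ker_op (pts (punctured (based A I 0 p) p)) (pts (based A I 0 p)) (\<lambda>g. g(p := 0))"
    using ker_op_extend_zero by simp
  from ker_op_comp[OF ops(1) this]
  show "ker_op (pts (punctured (based A I 0 p) p)) (pts X) (\<lambda>g. U (g(p := 0)))" .
  show "ker_op (pts X) (pts (punctured (based A I 0 p) p)) V"
    using ops(2) by (auto simp: ker_op_def)
  show "lip_le X (C * L) (U (g(p := 0)))" if "0 \<le> L" "lip_le (punctured (based A I 0 p) p) L g" for L g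
    using that by (intro ops(3) lip_le_punctured_based)
  show "lip_le (punctured (based A I 0 p) p) (C * L) (V f)" if "0 \<le> L" "lip_le X L f" for L f
    using ops(4)[OF that] by (simp add: lip_le_def)
  show "U ((V f)(p := 0)) x = f x" if "x \<in> pts X" for f x
    using ops(5)[OF that] assms(3)[of f] by (metis fun_upd_triv)
qed (rule assms(2))

text \<open>
  The intervals \<open>{l j i..u j i}\<close> with fixed \<open>i\<close> do not overlap, so the clampings of a coordinate to all of
  them together are \<open>1\<close>-Lipschitz. The evaluations at \<open>y\<close> in the \<open>j\<close>-th box and at the point \<open>lo j\<close> below
  it have the same image in all other boxes, hence their difference is projected to the \<open>j\<close>-th summand.
\<close>

lemma csub_diagonal:
  fixes l u :: "nat \<Rightarrow> nat \<Rightarrow> real" and e r :: "nat \<Rightarrow> real"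
  assumes I: "finite I" "i0 \<in> I" and p: "p \<in> Pi UNIV A"
    and lu: "\<And>j i. l j i \<in> A i" "\<And>j i. u j i \<in> A i" "\<And>j i. l j i \<le> u j i" "\<And>j i. u j i \<le> l (Suc j) i"
    and e: "\<And>j. e j \<in> A i0" "\<And>j. e j < l j i0" "\<And>j. u j i0 \<le> e (Suc j)"
    and r: "\<And>j. r j \<le> K * (l j i0 - e j)" "\<And>j. (l j i0 - e j) + (\<Sum>i\<in>I. u j i - l j i) \<le> K * r j"
    and fin: "\<And>t. finite {j. e j < t}" and K: "1 \<le> K" and r0: "\<And>j. 0 \<le> r j"
  shows "csub (2 * K) (wedge UNIV (\<lambda>j. bx (\<lambda>i. A i \<inter> {l j i..u j i}) I (r j)))
    (punctured (based A I 0 p) p)"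
proof -
  let ?X = "\<lambda>j. bx (\<lambda>i. A i \<inter> {l j i..u j i}) I (r j)" and ?Y = "based A I 0 p"
  have u_mono: "u i k \<le> u j k" if "i \<le> j" for i j k
    using lift_Suc_mono_le[of "\<lambda>j. u j k" i j] lu(3,4) that order_trans by blast
  have ul: "u i k \<le> l j k" "u i i0 \<le> e j" if ij: "i < j" for i j k
  proof -
    obtain j' where j': "j = Suc j'" "i \<le> j'"
      using ij by (cases j) auto
    show "u i k \<le> l j k" "u i i0 \<le> e j"
      unfolding j'(1) using order_trans[OF u_mono[OF j'(2)] lu(4)] order_trans[OF u_mono[OF j'(2)] e(3)] .
  qed
  define cl where "cl j x = (\<lambda>i. clamp (l j i) (u j i) (x i))" for j and x :: "nat \<Rightarrow> real"
  define h where "h j = l j i0 - e j" for j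
  have h: "0 < h j" for j
    using e(2)[of j] by (simp add: h_def)
  \<comment> \<open>A cut-off in coordinate \<open>i0\<close> that rises from \<open>0\<close> at
    \<open>e j\<close> to \<open>1\<close> at \<open>l j i0\<close>. It switches off all boxes too
    far out, so that the sum over \<open>j\<close> is finite at each point.\<close>
  define \<eta> where "\<eta> j x = (clamp (e j) (l j i0) (x i0) - e j) / h j" for j and x :: "nat \<Rightarrow> real"
  have \<eta>: "0 \<le> \<eta> j x" "\<eta> j x \<le> 1" for j x
    using h[of j] e(2)[of j] by (auto simp: \<eta>_def clamp_def h_def)
  have \<eta>_0: "\<eta> j x = 0" if "x i0 \<le> e j" for j x
    using that e(2)[of j] by (simp add: \<eta>_def clamp_def)
  have \<eta>_1: "\<eta> j x = 1" if "l j i0 \<le> x i0" for j x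
    using that e(2)[of j] by (simp add: \<eta>_def clamp_def h_def)
  define F where "F x = {j. e j < x i0}" for x :: "nat \<Rightarrow> real"
  have F: "finite (F x)" for x
    unfolding F_def by (rule fin)
  define W where "W f x = (\<Sum>j\<in>F x. \<eta> j x * f (j, cl j x))" for f :: "nat \<times> (nat \<Rightarrow> real) \<Rightarrow> real" and x
  have W: "W f x = (\<Sum>j\<in>G. \<eta> j x * f (j, cl j x))" if "finite G" "F x \<subseteq> G" for G f x
    unfolding W_def using that \<eta>_0 by (intro sum.mono_neutral_left) (auto simp: F_def)
  \<comment> \<open>Lowering the coordinate \<open>i0\<close> of the bottom corner to
    \<open>e j\<close> switches off the box \<open>j\<close> and changes nothing for the other
    boxes.\<close>
  define lo where "lo j = (l j)(i0 := e j)" for j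
  define U where "U g = (\<lambda>(j, y). g y - g (lo j))" for g :: "(nat \<Rightarrow> real) \<Rightarrow> real"
  \<comment> \<open>Subtracting the value at \<open>p\<close> makes \<open>V f\<close> vanish at the
    base point; this constant cancels in the differences formed by \<open>U\<close>.\<close>
  define V where "V f x = W f x - W f p" for f x
  have cl: "cl j x \<in> Pi UNIV (\<lambda>i. A i \<inter> {l j i..u j i})" if "x \<in> Pi UNIV A" for j x
    unfolding cl_def using that lu by (auto simp: clamp_def Pi_def min_def max_def)
  have lo: "lo j \<in> Pi UNIV A" for j
    unfolding lo_def using lu e by auto
  have W_lip: "\<bar>W f x - W f y\<bar> \<le> 2 * K * L * l1d I x y"
    if L: "0 \<le> L" and f: "lip_le (wedge UNIV ?X) L f" and x: "x \<in> Pi UNIV A" and y: "y \<in> Pi UNIV A" for f L x y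
  proof -
    define G where "G = F x \<union> F y"
    have G: "finite G" "F x \<subseteq> G" "F y \<subseteq> G"
      using F by (auto simp: G_def)
    have fj: "lip_le (?X j) L (\<lambda>x. f (j, x))" for j
      using f by (simp add: lip_le_wedge)
    have f1: "\<bar>f (j, cl j x)\<bar> \<le> L * r j" for j
      using lip_leD(1)[OF fj, of "cl j x" j] cl[OF x] by simp
    have f2: "\<bar>f (j, cl j x) - f (j, cl j y)\<bar> \<le> L * l1d I (cl j x) (cl j y)" for j
      using lip_leD(2)[OF fj, of "cl j x" j "cl j y"] cl[OF x] cl[OF y] by simp
    let ?c = "\<lambda>j. \<bar>clamp (e j) (l j i0) (x i0) - clamp (e j) (l j i0) (y i0)\<bar>"
    have "\<bar>\<eta> j x * f (j, cl j x) - \<eta> j y * f (j, cl j y)\<bar> \<le> L * (K * ?c j) + L * l1d I (cl j x) (cl j y)" for j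
    proof -
      have "\<bar>\<eta> j x - \<eta> j y\<bar> = ?c j / h j"
        using h[of j] by (simp add: \<eta>_def abs_divide flip: diff_divide_distrib)
      then have "\<bar>(\<eta> j x - \<eta> j y) * f (j, cl j x)\<bar> \<le> (?c j / h j) * (L * r j)"
        unfolding abs_mult using f1 h[of j] by (intro mult_mono) auto
      also have "\<dots> \<le> (?c j / h j) * (L * (K * h j))"
        using r(1)[of j] h[of j] L by (intro mult_left_mono) (auto simp: h_def)
      also have "\<dots> = L * (K * ?c j)"
        using h[of j] by simp
      finally have 1: "\<bar>(\<eta> j x - \<eta> j y) * f (j, cl j x)\<bar> \<le> L * (K * ?c j)" .
      have "\<bar>\<eta> j y * (f (j, cl j x) - f (j, cl j y))\<bar> \<le> 1 * (L * l1d I (cl j x) (cl j y))"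
        unfolding abs_mult using f2 \<eta>[of j y] by (intro mult_mono) auto
      with 1 show ?thesis
        by (simp add: algebra_simps)
    qed
    then have "(\<Sum>j\<in>G. \<bar>\<eta> j x * f (j, cl j x) - \<eta> j y * f (j, cl j y)\<bar>)
        \<le> (\<Sum>j\<in>G. L * (K * ?c j) + L * l1d I (cl j x) (cl j y))"
      by (intro sum_mono)
    also have "\<dots> = L * (K * (\<Sum>j\<in>G. ?c j)) + L * (\<Sum>j\<in>G. l1d I (cl j x) (cl j y))"
      by (simp add: sum.distrib sum_distrib_left)
    \<comment> \<open>The cut-offs and the clampings each move by at most the distance of
      \<open>x\<close> and \<open>y\<close> in total, by \<open>sum_clamp_le\<close>. So the bound
      does not grow with the number of boxes in \<open>G\<close>.\<close>
    also have "\<dots> \<le> L * (K * l1d I x y) + L * l1d I x y"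
    proof (intro add_mono mult_left_mono)
      have "e j \<le> l j i0" "l j i0 \<le> e (Suc j)" for j
        using e(2,3)[of j] lu(3)[of j i0] by linarith+
      then have "(\<Sum>j\<in>G. ?c j) \<le> \<bar>x i0 - y i0\<bar>"
        using G(1) by (intro sum_clamp_le)
      also have "\<dots> \<le> l1d I x y"
        by (rule abs_le_l1d[OF I])
      finally show "(\<Sum>j\<in>G. ?c j) \<le> l1d I x y" .
      have "(\<Sum>j\<in>G. l1d I (cl j x) (cl j y)) = (\<Sum>i\<in>I. \<Sum>j\<in>G. \<bar>cl j x i - cl j y i\<bar>)"
        unfolding l1d_def by (rule sum.swap)
      also have "\<dots> \<le> l1d I x y"
        unfolding l1d_def cl_def using lu(3,4) G(1) by (intro sum_mono sum_clamp_le)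
      finally show "(\<Sum>j\<in>G. l1d I (cl j x) (cl j y)) \<le> l1d I x y" .
    qed (use L K in auto)
    also have "\<dots> \<le> 2 * K * L * l1d I x y"
      using mult_right_mono[OF K mult_nonneg_nonneg[OF L l1d_nonneg[of I x y]]] by (simp add: algebra_simps)
    finally show ?thesis
      unfolding W[OF G(1,2)] W[OF G(1,3)] sum_subtractf[symmetric] by (intro order_trans[OF sum_abs])
  qed
  have "csub_ops (2 * K) (wedge UNIV ?X) ?Y U V"
  proof (rule csub_opsI)
    show "ker_op (pts ?Y) (pts (wedge UNIV ?X)) U"
    proof (rule ker_opI)
      fix z assume "z \<in> pts (wedge UNIV ?X)"
      then obtain j y where z: "z = (j, y)" "y \<in> pts (?X j)"
        by (cases z) auto
      then have "y \<in> Pi UNIV A"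
        by (auto simp: Pi_def)
      with z show "fin_fun (pts ?Y) (\<lambda>g. U g z)"
        using lo by (auto simp: U_def intro!: fin_fun_diff fin_fun_eval)
    qed
    show "ker_op (pts (wedge UNIV ?X)) (pts ?Y) V"
      unfolding V_def W_def using cl p by (intro ker_opI fin_fun_diff fin_fun_sum fin_fun_scale fin_fun_eval) auto
    show "lip_le ?Y (2 * K * L) (V f)" if "0 \<le> L" "lip_le (wedge UNIV ?X) L f" for L f
    proof (rule lip_leI)
      show "\<bar>V f x\<bar> \<le> 2 * K * L * wt ?Y x" if "x \<in> pts ?Y" for x
        using W_lip[OF \<open>0 \<le> L\<close> \<open>lip_le (wedge UNIV ?X) L f\<close> _ p, of x] that l1d_commute[of I x p]
        by (simp add: V_def)
      show "\<bar>V f x - V f y\<bar> \<le> 2 * K * L * ds ?Y x y" if "x \<in> pts ?Y" "y \<in> pts ?Y" for x y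
        using W_lip[OF \<open>0 \<le> L\<close> \<open>lip_le (wedge UNIV ?X) L f\<close>] that by (simp add: V_def)
    qed
    show "lip_le (wedge UNIV ?X) (2 * K * L) (U g)" if L: "0 \<le> L" and g: "lip_le ?Y L g" for L g
      unfolding lip_le_wedge
    proof
      fix j
      show "lip_le (?X j) (2 * K * L) (\<lambda>x. U g (j, x))"
      proof (rule lip_leI)
        fix y assume "y \<in> pts (?X j)"
        then have y: "y \<in> Pi UNIV A" "\<And>i. l j i \<le> y i" "\<And>i. y i \<le> u j i"
          by (auto simp: Pi_def)
        have "\<bar>g y - g (lo j)\<bar> \<le> L * l1d I y (lo j)"
          using lip_leD(2)[OF g, of y "lo j"] y lo by simp
        also have "l1d I y (lo j) \<le> (l j i0 - e j) + (\<Sum>i\<in>I. u j i - l j i)"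
        proof -
          have "l1d I y (lo j) \<le> l1d I y (l j) + l1d I (l j) (lo j)"
            by (rule l1d_triangle)
          also have "l1d I y (l j) \<le> (\<Sum>i\<in>I. u j i - l j i)"
            unfolding l1d_def using y(2,3) by (intro sum_mono) (simp add: abs_le_iff)
          also have "l1d I (l j) (lo j) = l j i0 - e j"
            using l1d_upd[OF I(1), of "l j" i0 "l j i0" "e j"] I(2) e(2)[of j] by (simp add: lo_def)
          finally show ?thesis by simp
        qed
        also have "\<dots> \<le> K * r j"
          by (rule r(2))
        finally have "\<bar>g y - g (lo j)\<bar> \<le> L * (K * r j)"
          using L by (simp add: mult_left_mono)
        also have "\<dots> \<le> 2 * K * L * r j"
          using L K r0[of j] by simp
        finally show "\<bar>U g (j, y)\<bar> \<le> 2 * K * L * wt (?X j) y"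
          by (simp add: U_def)
      next
        fix x y assume "x \<in> pts (?X j)" "y \<in> pts (?X j)"
        then have "\<bar>g x - g y\<bar> \<le> L * l1d I x y"
          using lip_leD(2)[OF g, of x y] by (simp add: Pi_def)
        also have "\<dots> \<le> 2 * K * L * l1d I x y"
          using mult_right_mono[of 1 "2 * K" "L * l1d I x y"] K L by (simp add: mult.assoc)
        finally show "\<bar>U g (j, x) - U g (j, y)\<bar> \<le> 2 * K * L * ds (?X j) x y"
          by (simp add: U_def)
      qed
    qed
    show "U (V f) z = f z" if z': "z \<in> pts (wedge UNIV ?X)" for f z
    proof -
      obtain j y where z: "z = (j, y)" "y \<in> pts (?X j)"
        using z' by (cases z) auto
      then have y: "\<And>i. l j i \<le> y i" "\<And>i. y i \<le> u j i"
        by (auto simp: Pi_def)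
      define G where "G = F y \<union> F (lo j) \<union> {j}"
      have G: "finite G" "F y \<subseteq> G" "F (lo j) \<subseteq> G" "j \<in> G"
        using F by (auto simp: G_def)
      \<comment> \<open>For a box below \<open>j\<close> both points lie above its top corner, where
        the cut-off is \<open>1\<close> and clamping gives that corner. For a box above
        \<open>j\<close> both lie where the cut-off is \<open>0\<close>.\<close>
      have other: "\<eta> i y * f (i, cl i y) = \<eta> i (lo j) * f (i, cl i (lo j))" if "i \<noteq> j" for i
      proof (cases "i < j")
        case True
        have y_ge: "u i k \<le> y k" for k
          using ul(1)[OF True, of k] y(1)[of k] by linarith
        have lo_ge: "u i k \<le> lo j k" for k
          using ul(1)[OF True, of k] ul(2)[OF True] by (simp add: lo_def)
        have "cl i y = cl i (lo j)"
          unfolding cl_def clamp_def using y_ge lo_ge by (simp add: min_absorb1)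
        moreover have "\<eta> i y = 1" "\<eta> i (lo j) = 1"
          using y_ge[of i0] lo_ge[of i0] lu(3)[of i i0] by (auto intro!: \<eta>_1)
        ultimately show ?thesis by simp
      next
        case False
        then have "u j i0 \<le> e i"
          using ul(2) that by simp
        then have "\<eta> i y = 0" "\<eta> i (lo j) = 0"
          using y(2)[of i0] e(2)[of j] lu(3)[of j i0] by (auto intro!: \<eta>_0 simp: lo_def)
        then show ?thesis by simp
      qed
      have "cl j y = y" "\<eta> j y = 1" "\<eta> j (lo j) = 0"
        using y by (auto simp: cl_def clamp_def max_absorb2 min_absorb2 lo_def intro!: \<eta>_1 \<eta>_0)
      then have "W f y - W f (lo j) = f (j, y)"
        unfolding W[OF G(1,2)] W[OF G(1,3)] sum.remove[OF G(1,4)]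
        using other by (simp add: sum_subtractf[symmetric])
      then show ?thesis
        by (simp add: z U_def V_def)
    qed
  qed
  then show ?thesis
    by (rule csub_punctured_based) (use K in \<open>auto simp: V_def\<close>)
qed

section \<open>Slow and lacunary products\<close>

lemma csub_refl: "csub 1 X X"
  by (rule csubI[of _ _ _ "\<lambda>f. f" "\<lambda>f. f"]) (auto intro: ker_op_id)

lemma csub_coordinates_embed:
  assumes I: "finite I" and J: "finite J" "J \<subseteq> I"
    and A: "\<And>i. i \<in> J \<Longrightarrow> finite (A i)" "\<And>i. i \<in> J \<Longrightarrow> A i \<noteq> {}" and u: "\<And>i. i \<in> J \<Longrightarrow> u i \<in> A i \<rightarrow> B i"
    and lip: "\<And>i s t. i \<in> J \<Longrightarrow> s \<in> A i \<Longrightarrow> t \<in> A i \<Longrightarrow> \<bar>u i s - u i t\<bar> \<le> C * \<bar>s - t\<bar>"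
    and lip': "\<And>i s t. i \<in> J \<Longrightarrow> s \<in> A i \<Longrightarrow> t \<in> A i \<Longrightarrow> \<bar>s - t\<bar> \<le> C * \<bar>u i s - u i t\<bar>"
    and \<beta>: "0 \<le> \<beta>" and C: "1 \<le> C"
  shows "csub (C ^ card J) (bx A I \<beta>) (bx (\<lambda>i. if i \<in> J then B i else A i) I \<beta>)"
  using J A u lip lip'
proof (induction J rule: finite_induct)
  case empty
  then show ?case by (simp add: csub_refl)
next
  case (insert i J)
  have i: "i \<in> I"
    using insert.prems by auto
  let ?A = "\<lambda>i. if i \<in> J then B i else A i"
  have "csub (C ^ card J) (bx A I \<beta>) (bx ?A I \<beta>)"
    using insert.prems by (intro insert.IH) auto
  moreover have "csub C (bx ?A I \<beta>) (bx (?A(i := B i)) I \<beta>)"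
    by (rule csub_coordinate_embed[OF I i, where u = "u i"])
      (use insert.prems insert.hyps \<beta> C in auto)
  moreover have "?A(i := B i) = (\<lambda>k. if k \<in> insert i J then B k else A k)"
    by (auto simp: fun_eq_iff)
  ultimately show ?case
    using csub_trans insert.hyps by (fastforce simp: mult.commute)
qed

text \<open>It suffices to find nodes in the sets \<open>B i\<close> that are spaced like the exact
  mesh \<open>r / k\<close> up to a factor \<open>2\<close>. Each coordinate costs \<open>2\<close>,
  and so does the rescaling of the grid.\<close>

lemma csub_grid_box:
  fixes c :: "nat \<Rightarrow> nat \<Rightarrow> real"
  assumes I: "finite I" "{1..d} \<subseteq> I" and k: "1 \<le> k" and r: "0 < r"
    and c: "\<And>i t. i \<in> {1..d} \<Longrightarrow> t \<le> k \<Longrightarrow> c i t \<in> B i"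
    and lip: "\<And>i s t. i \<in> {1..d} \<Longrightarrow> s \<le> k \<Longrightarrow> t \<le> k \<Longrightarrow> \<bar>c i s - c i t\<bar> \<le> 2 * (r / k * \<bar>real s - real t\<bar>)"
      "\<And>i s t. i \<in> {1..d} \<Longrightarrow> s \<le> k \<Longrightarrow> t \<le> k \<Longrightarrow> r / k * \<bar>real s - real t\<bar> \<le> 2 * \<bar>c i s - c i t\<bar>"
    and single: "\<And>i. i \<notin> {1..d} \<Longrightarrow> B i = {b i}"
  shows "csub (2 * 2 ^ d) (grid d k) (bx B I r)"
proof -
  define s where "s = r / k"
  have s: "0 < s" "s * k = r"
    using k r by (simp_all add: s_def)
  define A where "A i = (if i \<in> {1..d} then scaled_grid k s else {b i})" for i
  \<comment> \<open>The floor recovers the index \<open>n\<close> from the exact node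
    \<open>s * n\<close>.\<close>
  define u where "u i t = c i (nat \<lfloor>t / s\<rfloor>)" for i t
  have u: "u i (s * real n) = c i n" for i n
    using s by (simp add: u_def)
  have "csub 2 (grid d k) (bx A I r)"
    by (rule csub_scaled_grid(2)[OF I s(1), of r k A b]) (use s r in \<open>auto simp: A_def\<close>)
  moreover have "csub (2 ^ card {1..d}) (bx A I r) (bx (\<lambda>i. if i \<in> {1..d} then B i else A i) I r)"
  proof (rule csub_coordinates_embed[OF I(1) _ I(2), where u = u])
    fix i assume i: "i \<in> {1..d}"
    then have A: "A i = scaled_grid k s"
      by (simp add: A_def)
    show "finite (A i)" "A i \<noteq> {}"
      unfolding A by (auto simp: scaled_grid_def)
    show "u i \<in> A i \<rightarrow> B i"
      unfolding A using c[OF i] by (auto simp: scaled_grid_def u)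
    fix x y assume "x \<in> A i" "y \<in> A i"
    then obtain m n where mn: "x = s * real m" "y = s * real n" "m \<le> k" "n \<le> k"
      unfolding A scaled_grid_def by (metis (no_types, lifting) atLeastAtMost_iff imageE)
    have xy: "\<bar>x - y\<bar> = s * \<bar>real m - real n\<bar>"
      using s by (simp add: mn abs_mult flip: right_diff_distrib)
    show "\<bar>u i x - u i y\<bar> \<le> 2 * \<bar>x - y\<bar>" "\<bar>x - y\<bar> \<le> 2 * \<bar>u i x - u i y\<bar>"
      unfolding xy unfolding mn u using lip[OF i mn(3,4)] by (simp_all add: s_def)
  qed (use r in auto)
  moreover have "(\<lambda>i. if i \<in> {1..d} then B i else A i) = B"
    using single by (auto simp: A_def fun_eq_iff simp del: atLeastAtMost_iff)
  ultimately show ?thesis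
    using csub_trans by fastforce
qed

text \<open>This is what ratios tending to \<open>1\<close> yield for an unbounded sequence. Stated
  for sets, it fits the integers as well.\<close>

definition slow :: "real set \<Rightarrow> bool"
  where "slow S \<longleftrightarrow> (\<forall>\<epsilon>>0. \<exists>R0. \<forall>R\<ge>R0. \<exists>x\<in>S. R \<le> x \<and> x \<le> (1 + \<epsilon>) * R)"

text \<open>Beyond \<open>R j\<close> the sets \<open>A i\<close> are relatively so dense that they
  follow a mesh of \<open>k j\<close> steps with errors of at most half a step. One such approximate
  grid is placed at each of the scales \<open>R j\<close>.\<close>

lemma csub_model_slow:
  assumes I: "finite I" "{1..d} \<subseteq> I" and d: "1 \<le> d" and p: "p \<in> Pi UNIV A"
    and slow: "\<And>i. i \<in> {1..d} \<Longrightarrow> slow (A i)"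
  shows "\<exists>C. csub C (model d) (punctured (based A I 0 p) p)"
proof -
  define k where "k = grid_size"
  have k: "1 \<le> k j" for j
    by (simp add: k_def grid_size_def)
  \<comment> \<open>The nodes to be approximated lie below \<open>3 * R j\<close>, so a relative
    error of \<open>1 / (6 * k j)\<close> is at most half of the mesh
    \<open>R j / k j\<close>.\<close>
  have "\<exists>R0. \<forall>i\<in>{1..d}. \<forall>R\<ge>R0. \<exists>x\<in>A i. R \<le> x \<and> x \<le> (1 + 1 / (6 * k j)) * R" for j
  proof -
    have "\<forall>i\<in>{1..d}. \<exists>R0. \<forall>R\<ge>R0. \<exists>x\<in>A i. R \<le> x \<and> x \<le> (1 + 1 / (6 * k j)) * R"
      using slow k[of j] unfolding slow_def by (auto simp del: atLeastAtMost_iff)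
    then obtain R0 where R0: "\<And>i R. i \<in> {1..d} \<Longrightarrow> R0 i \<le> R \<Longrightarrow> \<exists>x\<in>A i. R \<le> x \<and> x \<le> (1 + 1 / (6 * k j)) * R"
      by metis
    have "R0 i \<le> Max (R0 ` {1..d})" if "i \<in> {1..d}" for i
      using that by (intro Max_ge) auto
    then show ?thesis
      using R0 by (intro exI[of _ "Max (R0 ` {1..d})"]) force
  qed
  then obtain R0 where R0: "\<And>j i R. i \<in> {1..d} \<Longrightarrow> R0 j \<le> R \<Longrightarrow> \<exists>x\<in>A i. R \<le> x \<and> x \<le> (1 + 1 / (6 * k j)) * R"
    by metis
  \<comment> \<open>The sum makes \<open>R j\<close> exceed \<open>R0 j\<close> without destroying
    monotonicity. The power of \<open>4\<close> separates the scales: box \<open>j\<close> ends at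
    \<open>7 / 2 * R j\<close> at the latest, and everything belonging to box \<open>Suc j\<close>
    starts at or above \<open>4 * R j\<close>.\<close>
  define R where "R j = (1 + (\<Sum>m\<le>j. \<bar>R0 m\<bar>)) * 4 ^ j" for j
  have R_ge: "4 ^ j \<le> R j" for j
    by (simp add: R_def sum_nonneg)
  have R_pos: "0 < R j" for j
    using R_ge[of j] zero_less_power[of "4::real" j] by linarith
  have R0_le: "R0 j \<le> R j" for j
  proof -
    have "R0 j \<le> 1 + (\<Sum>m\<le>j. \<bar>R0 m\<bar>)"
      using member_le_sum[of j "{..j}" "\<lambda>m. \<bar>R0 m\<bar>"] by simp
    also have "\<dots> \<le> R j"
      using mult_left_mono[of 1 "4 ^ j" "1 + (\<Sum>m\<le>j. \<bar>R0 m\<bar>)"] by (simp add: R_def sum_nonneg)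
    finally show ?thesis .
  qed
  have R_Suc: "4 * R j \<le> R (Suc j)" for j
    by (simp add: R_def algebra_simps)
  have "\<exists>near. \<forall>i\<in>{1..d}. \<forall>j. \<forall>x\<ge>R j. near i j x \<in> A i \<and> x \<le> near i j x \<and> near i j x \<le> (1 + 1 / (6 * k j)) * x"
  proof -
    have "\<forall>i j x. \<exists>y. i \<in> {1..d} \<longrightarrow> R j \<le> x \<longrightarrow> y \<in> A i \<and> x \<le> y \<and> y \<le> (1 + 1 / (6 * k j)) * x"
      using R0 R0_le order_trans by meson
    then show ?thesis by metis
  qed
  then obtain near where near: "\<And>i j x. i \<in> {1..d} \<Longrightarrow> R j \<le> x \<Longrightarrow> near i j x \<in> A i"
      "\<And>i j x. i \<in> {1..d} \<Longrightarrow> R j \<le> x \<Longrightarrow> x \<le> near i j x"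
      "\<And>i j x. i \<in> {1..d} \<Longrightarrow> R j \<le> x \<Longrightarrow> near i j x \<le> (1 + 1 / (6 * k j)) * x"
    by metis
  \<comment> \<open>The exact nodes run from \<open>2 * R j\<close> to \<open>3 * R j\<close>; the
    range just above \<open>R j\<close> is left for the start of the cut-off.\<close>
  define pos where "pos j t = R j * (2 + real t / k j)" for j t
  have pos: "2 * R j \<le> pos j t" "R j \<le> pos j t" for j t
    using R_pos[of j] by (simp_all add: pos_def algebra_simps)
  have pos_le: "pos j t \<le> 3 * R j" if "t \<le> k j" for j t
  proof -
    have "pos j t \<le> R j * 3"
      unfolding pos_def using R_pos[of j] k[of j] that by (intro mult_left_mono) auto
    then show ?thesis by simp
  qed
  define c where "c j i t = near i j (pos j t)" for j i t
  have c: "c j i t \<in> A i" "pos j t \<le> c j i t" "c j i t \<le> pos j t + R j / (2 * k j)"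
    if "i \<in> {1..d}" "t \<le> k j" for i j t
  proof -
    show "c j i t \<in> A i" "pos j t \<le> c j i t"
      unfolding c_def using near(1,2)[OF that(1) pos(2)] by auto
    have "c j i t \<le> pos j t + pos j t / (6 * k j)"
      unfolding c_def using near(3)[OF that(1) pos(2), of j t] by (simp add: algebra_simps)
    also have "pos j t / (6 * k j) \<le> (3 * R j) / (6 * k j)"
      by (intro divide_right_mono pos_le that) simp
    finally show "c j i t \<le> pos j t + R j / (2 * k j)"
      by simp
  qed
  have pos_diff: "pos j s - pos j t = R j / k j * (real s - real t)" for j s t
    using k[of j] by (simp add: pos_def field_simps)
  have c_le: "c j i s \<le> c j i t" if "i \<in> {1..d}" "s \<le> t" "t \<le> k j" for i j s t
  proof (cases "s = t")
    case False
    then have "1 \<le> real t - real s"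
      using that(2) by linarith
    then have "R j / k j * 1 \<le> pos j t - pos j s"
      unfolding pos_diff using R_pos[of j] by (intro mult_left_mono) auto
    moreover have "R j / (2 * k j) \<le> R j / k j"
      using R_pos[of j] k[of j] by (simp add: field_simps)
    ultimately show ?thesis
      using c(3)[of i s j] c(2)[of i t j] that by simp
  qed simp
  have c_top: "c j i (k j) \<le> 7 / 2 * R j" if "i \<in> {1..d}" for i j
  proof -
    have "R j / (2 * k j) \<le> R j / 2"
      using R_pos[of j] k[of j] by (simp add: field_simps)
    then show ?thesis
      using c(3)[OF that, of "k j" j] pos_le[of "k j" j] by simp
  qed
  \<comment> \<open>The coordinates that are not slow stay at their value in
    \<open>p\<close>.\<close>
  define l where "l j i = (if i \<in> {1..d} then c j i 0 else p i)" for j i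
  define u where "u j i = (if i \<in> {1..d} then c j i (k j) else p i)" for j i
  \<comment> \<open>The cut-off starts at or below \<open>3 / 2 * R j\<close> and the box at or
    above \<open>2 * R j\<close>, so the cut-off has room \<open>R j / 2\<close>, comparable to the
    weight \<open>R j\<close>.\<close>
  define e where "e j = near 1 j (R j)" for j
  have one: "1 \<in> {1..d}"
    using d by simp
  have e: "e j \<in> A 1" "R j \<le> e j" "e j \<le> 3 / 2 * R j" for j
  proof -
    show "e j \<in> A 1" "R j \<le> e j"
      unfolding e_def using near(1,2)[OF one order.refl] by auto
    have "e j \<le> R j + R j / (6 * k j)"
      unfolding e_def using near(3)[OF one order.refl, of j] by (simp add: algebra_simps)
    also have "R j / (6 * k j) \<le> R j / 2"
      using R_pos[of j] k[of j] by (intro divide_left_mono) auto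
    finally show "e j \<le> 3 / 2 * R j"
      by simp
  qed
  have l_ge: "2 * R j \<le> l j i" if "i \<in> {1..d}" for i j
    using c(2)[OF that, of 0 j] pos(1)[of j 0] that by (simp add: l_def)
  have u_le: "u j i \<le> 7 / 2 * R j" if "i \<in> {1..d}" for i j
    using c_top[OF that] that by (simp add: u_def)
  \<comment> \<open>It has to dominate \<open>2\<close>, from the room for the cut-off, and
    \<open>5 / 2 + 3 / 2 * d\<close>, from the distance of a box point to the point below the box,
    in units of \<open>R j\<close>.\<close>
  define K where "K = 2 * (1 + real d) + 2"
  have "csub (2 * K) (wedge UNIV (\<lambda>j. bx (\<lambda>i. A i \<inter> {l j i..u j i}) I (R j))) (punctured (based A I 0 p) p)"
  proof (rule csub_diagonal[OF I(1) _ p, where ?i0.0 = 1 and e = e])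
    show "1 \<in> I"
      using I one by auto
    show "l j i \<in> A i" "u j i \<in> A i" for i j
      using c(1) p by (auto simp: l_def u_def simp del: atLeastAtMost_iff)
    show "l j i \<le> u j i" for i j
      using c_le by (simp add: l_def u_def)
    show "u j i \<le> l (Suc j) i" for i j
    proof (cases "i \<in> {1..d}")
      case True
      then show ?thesis
        using l_ge[OF True, of "Suc j"] u_le[OF True, of j] R_Suc[of j] R_pos[of j] by linarith
    qed (auto simp: l_def u_def)
    show "e j \<in> A 1" for j
      by (rule e)
    show "e j < l j 1" for j
      using e(3)[of j] l_ge[OF one, of j] R_pos[of j] by linarith
    show "u j 1 \<le> e (Suc j)" for j
      using e(2)[of "Suc j"] u_le[OF one, of j] R_Suc[of j] R_pos[of j] by linarith
    show "R j \<le> K * (l j 1 - e j)" for j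
    proof -
      have "R j \<le> 2 * (l j 1 - e j)"
        using e(3)[of j] l_ge[OF one, of j] by (simp add: algebra_simps)
      also have "\<dots> \<le> K * (l j 1 - e j)"
        using e(3)[of j] l_ge[OF one, of j] R_pos[of j] by (intro mult_right_mono) (auto simp: K_def)
      finally show ?thesis .
    qed
    show "l j 1 - e j + (\<Sum>i\<in>I. u j i - l j i) \<le> K * R j" for j
    proof -
      have "(\<Sum>i\<in>I. u j i - l j i) = (\<Sum>i\<in>{1..d}. u j i - l j i)"
        using I by (intro sum.mono_neutral_right) (auto simp: l_def u_def simp del: atLeastAtMost_iff)
      also have "\<dots> \<le> of_nat (card {1..d}) * (3 / 2 * R j)"
      proof (rule sum_bounded_above)
        show "u j i - l j i \<le> 3 / 2 * R j" if "i \<in> {1..d}" for i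
          using l_ge[OF that, of j] u_le[OF that, of j] by (simp add: algebra_simps)
      qed
      finally have "(\<Sum>i\<in>I. u j i - l j i) \<le> real d * (3 / 2 * R j)"
        by simp
      moreover have "l j 1 - e j \<le> 5 / 2 * R j"
        using e(2)[of j] u_le[OF one, of j] c_le[OF one, of 0 "k j" j] one by (simp add: l_def u_def)
      moreover have "real d * (3 / 2 * R j) \<le> real d * (2 * R j)"
        using R_pos[of j] by (intro mult_left_mono) auto
      moreover have "K * R j = real d * (2 * R j) + 4 * R j"
        by (simp add: K_def algebra_simps)
      ultimately show ?thesis
        using R_pos[of j] by linarith
    qed
    show "finite {j. e j < t}" for t
    proof -
      obtain n :: nat where n: "t < n"
        using reals_Archimedean2 by blast
      have "j < n" if "e j < t" for j
      proof -
        have "real j < 4 ^ j"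
          using of_nat_less_two_power[of j, where ?'a = real] power_mono[of "2::real" 4 j] by linarith
        then show ?thesis
          using R_ge[of j] e(2)[of j] that n by linarith
      qed
      then have "{j. e j < t} \<subseteq> {..<n}"
        by auto
      then show ?thesis
        by (rule finite_subset) simp
    qed
    show "0 \<le> R j" for j
      using R_pos[of j] by simp
  qed (simp add: K_def)
  moreover have "csub (2 * 2 ^ d) (model d) (wedge UNIV (\<lambda>j. bx (\<lambda>i. A i \<inter> {l j i..u j i}) I (R j)))"
    unfolding model_def k_def[symmetric]
  proof (rule csub_wedge_mono)
    fix j
    show "csub (2 * 2 ^ d) (grid d (k j)) (bx (\<lambda>i. A i \<inter> {l j i..u j i}) I (R j))"
    proof (rule csub_grid_box[OF I k R_pos, where c = "c j" and b = p])
      fix i assume i: "i \<in> {1..d}"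
      show "c j i t \<in> A i \<inter> {l j i..u j i}" if "t \<le> k j" for t
        using c(1)[OF i that] c_le[OF i _ that, of 0] c_le[OF i that] i by (simp add: l_def u_def)
      fix s t assume st: "s \<le> k j" "t \<le> k j"
      have "\<bar>c j i s - c j i t\<bar> \<le> 2 * (R j / k j * \<bar>real s - real t\<bar>) \<and>
          R j / k j * \<bar>real s - real t\<bar> \<le> 2 * \<bar>c j i s - c j i t\<bar>"
      proof (cases "s = t")
        case False
        have "\<bar>pos j s - pos j t\<bar> = R j / k j * \<bar>real s - real t\<bar>"
          using R_pos[of j] by (simp add: pos_diff abs_mult)
        moreover have "R j / k j * 1 \<le> R j / k j * \<bar>real s - real t\<bar>"
          using False R_pos[of j] by (intro mult_left_mono) auto
        moreover have "R j / (2 * k j) = (R j / k j) / 2"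
          by simp
        \<comment> \<open>Distinct exact nodes are at distance \<open>D\<close>, at least one mesh
          width \<open>H\<close>. Upward errors of at most \<open>H / 2\<close> change this by at
          most \<open>D / 2\<close>.\<close>
        moreover have "\<bar>x - y\<bar> \<le> 2 * D \<and> D \<le> 2 * \<bar>x - y\<bar>"
          if "\<bar>P - Q\<bar> = D" "H * 1 \<le> D" "h = H / 2" "P \<le> x" "x \<le> P + h" "Q \<le> y" "y \<le> Q + h"
          for P Q D H h x y :: real
          using that by (smt (verit) field_sum_of_halves)
        ultimately show ?thesis
          using c(2,3)[OF i st(1)] c(2,3)[OF i st(2)] by blast
      qed simp
      then show "\<bar>c j i s - c j i t\<bar> \<le> 2 * (R j / k j * \<bar>real s - real t\<bar>)"
          "R j / k j * \<bar>real s - real t\<bar> \<le> 2 * \<bar>c j i s - c j i t\<bar>"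
        by blast+
    next
      show "A i \<inter> {l j i..u j i} = {p i}" if "i \<notin> {1..d}" for i
        using that p by (auto simp: l_def u_def Pi_def)
    qed
  qed simp
  ultimately show ?thesis
    using csub_trans by blast
qed

text \<open>For \<open>d = 0\<close> every grid is a single point, and a single unbounded coordinate
  supplies these points: the box is the point \<open>v (Suc j)\<close> and its cut-off starts at
  \<open>v j\<close>.\<close>

lemma csub_model_0:
  assumes I: "finite I" "i0 \<in> I" and p: "p \<in> Pi UNIV A"
    and v: "\<And>j. v j \<in> A i0" "\<And>j. v j < v (Suc j)" "filterlim v at_top sequentially"
  shows "\<exists>C. csub C (model 0) (punctured (based A I 0 p) p)"
proof -
  define l where "l j i = (if i = i0 then v (Suc j) else p i)" for j i
  have "csub (2 * 1) (wedge UNIV (\<lambda>j. bx (\<lambda>i. A i \<inter> {l j i..l j i}) I (v (Suc j) - v j))) (punctured (based A I 0 p) p)"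
  proof (rule csub_diagonal[OF I p, where e = v])
    show "finite {j. v j < t}" for t
    proof -
      obtain n where "\<And>j. n \<le> j \<Longrightarrow> t \<le> v j"
        using v(3) by (auto simp: filterlim_at_top eventually_sequentially)
      then have "{j. v j < t} \<subseteq> {..<n}"
        by (auto simp: not_less[symmetric])
      then show ?thesis
        by (rule finite_subset) simp
    qed
  qed (use v(1,2) p in \<open>auto simp: l_def less_imp_le\<close>)
  moreover have "csub (2 * 2 ^ 0) (model 0) (wedge UNIV (\<lambda>j. bx (\<lambda>i. A i \<inter> {l j i..l j i}) I (v (Suc j) - v j)))"
    unfolding model_def
  proof (rule csub_wedge_mono)
    fix j
    show "csub (2 * 2 ^ 0) (grid 0 (grid_size j)) (bx (\<lambda>i. A i \<inter> {l j i..l j i}) I (v (Suc j) - v j))"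
    proof (rule csub_grid_box[where b = "l j"])
      show "A i \<inter> {l j i..l j i} = {l j i}" for i
        using v(1) p by (auto simp: l_def)
    qed (use I v(2)[of j] in \<open>auto simp: grid_size_def\<close>)
  qed simp
  ultimately show ?thesis
    using csub_trans by blast
qed

text \<open>Attaching the new base point at distance \<open>1\<close> makes the dyadic decomposition
  applicable, which works with weights at least \<open>1\<close>. Subtracting \<open>g p\<close>
  projects back onto functions vanishing at \<open>p\<close>.\<close>

lemma csub_punctured_shift:
  assumes p: "p \<in> Pi UNIV A"
  shows "csub 1 (punctured (based A I 0 p) p) (based A I 1 p)" (is "csub 1 ?X ?Y")
proof (rule csubI[of _ _ _ "\<lambda>g x. g x - g p" "\<lambda>f. f(p := 0)"])
  show "ker_op (pts ?Y) (pts ?X) (\<lambda>g x. g x - g p)"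
    using p by (auto simp: ker_op_def intro!: fin_fun_diff fin_fun_eval)
  show "ker_op (pts ?X) (pts ?Y) (\<lambda>f. f(p := 0))"
    using ker_op_extend_zero by simp
  show "lip_le ?X (1 * L) (\<lambda>x. g x - g p)" if "lip_le ?Y L g" for L g
  proof (rule lip_leI)
    show "\<bar>g x - g p\<bar> \<le> 1 * L * wt ?X x" if "x \<in> pts ?X" for x
      using lip_leD(2)[OF \<open>lip_le ?Y L g\<close>, of x p] that p by (simp add: l1d_commute[of I p])
    show "\<bar>g x - g p - (g y - g p)\<bar> \<le> 1 * L * ds ?X x y" if "x \<in> pts ?X" "y \<in> pts ?X" for x y
      using lip_leD(2)[OF \<open>lip_le ?Y L g\<close>, of x y] that by simp
  qed
  show "lip_le ?Y (1 * L) (f(p := 0))" if L: "0 \<le> L" and "lip_le ?X L f" for L f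
  proof -
    have f: "lip_le (based A I 0 p) L (f(p := 0))"
      using lip_le_punctured_based that by blast
    show ?thesis
    proof (rule lip_leI)
      show "\<bar>(f(p := 0)) x\<bar> \<le> 1 * L * wt ?Y x" if "x \<in> pts ?Y" for x
        using lip_leD(1)[OF f, of x] that L unfolding based_simps distrib_left by simp
      show "\<bar>(f(p := 0)) x - (f(p := 0)) y\<bar> \<le> 1 * L * ds ?Y x y" if "x \<in> pts ?Y" "y \<in> pts ?Y" for x y
        using lip_leD(2)[OF f, of x y] that unfolding based_simps by simp
    qed
  qed
qed auto

text \<open>The common core of both sides of the theorem: \<open>N\<close> and the integer lattice
  are products of slow and lacunary sets.\<close>

lemma ciso_punctured_model:
  assumes I: "finite I" "{1..d} \<subseteq> I" "I \<noteq> {}" and \<kappa>: "1 < \<kappa>" and p: "p \<in> Pi UNIV A"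
    and fin: "\<And>i r. i \<in> I \<Longrightarrow> finite (A i \<inter> {t. \<bar>t - p i\<bar> \<le> r})"
    and lac: "\<And>i. i \<in> I - {1..d} \<Longrightarrow> lacunary \<kappa> (A i)" and single: "\<And>i. i \<notin> I \<Longrightarrow> A i = {p i}"
    and slow: "\<And>i. i \<in> {1..d} \<Longrightarrow> slow (A i)"
    and unbounded: "\<And>i. i \<in> I - {1..d} \<Longrightarrow>
      \<exists>v. (\<forall>j. v j \<in> A i \<and> v j < v (Suc j)) \<and> filterlim v at_top sequentially"
  shows "ciso (punctured (based A I 0 p) p) (model d)"
proof -
  let ?Y = "punctured (based A I 0 p) p"
  have "\<exists>C. csub C (model d) ?Y"
  proof (cases "d = 0")
    case True
    obtain i where "i \<in> I"
      using I by blast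
    then show ?thesis
      using csub_model_0[OF I(1) _ p, of i] unbounded[of i] True by auto
  next
    case False
    then show ?thesis
      using csub_model_slow[OF I(1,2) _ p slow] by simp
  qed
  moreover have "\<exists>C. csub C ?Y (model d)"
    using csub_based_model[OF I(1,2) \<kappa> p fin lac single] csub_trans[OF csub_punctured_shift[OF p]] by blast
  moreover have "wf_lspace ?Y"
    by (simp add: wf_lspace_def)
  ultimately show ?thesis
    using model.ciso_model by blast
qed

section \<open>Lipschitz-free spaces\<close>

definition lspace_of :: "'a metric \<Rightarrow> 'a \<Rightarrow> 'a lspace"
  where "lspace_of M p = \<lparr>pts = mspace M - {p}, wt = mdist M p, ds = mdist M\<rparr>"

lemma lspace_of_simps [simp]: "pts (lspace_of M p) = mspace M - {p}" "wt (lspace_of M p) = mdist M p"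
    "ds (lspace_of M p) = mdist M"
  by (simp_all add: lspace_of_def)

lemma lip_le_lspace_of_iff:
  assumes p: "p \<in> mspace M" and f: "f p = 0" and L: "0 \<le> L"
  shows "lip_le (lspace_of M p) L f \<longleftrightarrow> (\<forall>x\<in>mspace M. \<forall>y\<in>mspace M. \<bar>f x - f y\<bar> \<le> L * mdist M x y)"
proof
  assume *: "lip_le (lspace_of M p) L f"
  have f1: "\<bar>f x\<bar> \<le> L * mdist M p x" if "x \<in> mspace M" for x
    using lip_leD(1)[OF *, of x] that f L by (cases "x = p") auto
  show "\<forall>x\<in>mspace M. \<forall>y\<in>mspace M. \<bar>f x - f y\<bar> \<le> L * mdist M x y"
  proof (intro ballI)
    fix x y assume xy: "x \<in> mspace M" "y \<in> mspace M"
    show "\<bar>f x - f y\<bar> \<le> L * mdist M x y"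
    proof (cases "x = p \<or> y = p")
      case True
      then show ?thesis
        using f1[OF xy(1)] f1[OF xy(2)] f by (auto simp: mdist_commute)
    next
      case False
      then show ?thesis
        using lip_leD(2)[OF *, of x y] xy by simp
    qed
  qed
next
  assume *: "\<forall>x\<in>mspace M. \<forall>y\<in>mspace M. \<bar>f x - f y\<bar> \<le> L * mdist M x y"
  show "lip_le (lspace_of M p) L f"
  proof (rule lip_leI)
    show "\<bar>f x\<bar> \<le> L * wt (lspace_of M p) x" if "x \<in> pts (lspace_of M p)" for x
      using *[rule_format, of p x] that p f by simp
  qed (use * in auto)
qed

lemma Lip0_vecs_iff:
  assumes p: "p \<in> mspace M"
  shows "f \<in> vecs (Lip0 M p) \<longleftrightarrow>
    (\<forall>x. x \<notin> pts (lspace_of M p) \<longrightarrow> f x = 0) \<and> (\<exists>L\<ge>0. lip_le (lspace_of M p) L f)"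
proof -
  have "Lipschitz_continuous_map M euclidean_metric f \<longleftrightarrow> (\<exists>L\<ge>0. lip_le (lspace_of M p) L f)" if "f p = 0"
  proof -
    have "Lipschitz_continuous_map M euclidean_metric f \<longleftrightarrow>
        (\<exists>L>0. \<forall>x\<in>mspace M. \<forall>y\<in>mspace M. \<bar>f x - f y\<bar> \<le> L * mdist M x y)"
      by (simp add: Lipschitz_continuous_map_pos dist_real_def)
    also have "\<dots> \<longleftrightarrow> (\<exists>L\<ge>0. \<forall>x\<in>mspace M. \<forall>y\<in>mspace M. \<bar>f x - f y\<bar> \<le> L * mdist M x y)"
    proof
      assume "\<exists>L\<ge>0. \<forall>x\<in>mspace M. \<forall>y\<in>mspace M. \<bar>f x - f y\<bar> \<le> L * mdist M x y"
      then obtain L where L: "0 \<le> L" "\<And>x y. x \<in> mspace M \<Longrightarrow> y \<in> mspace M \<Longrightarrow> \<bar>f x - f y\<bar> \<le> L * mdist M x y"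
        by blast
      have "\<bar>f x - f y\<bar> \<le> (L + 1) * mdist M x y" if "x \<in> mspace M" "y \<in> mspace M" for x y
        using L(2)[OF that] by (simp add: distrib_right add_increasing2)
      then show "\<exists>L>0. \<forall>x\<in>mspace M. \<forall>y\<in>mspace M. \<bar>f x - f y\<bar> \<le> L * mdist M x y"
        using L(1) by (intro exI[of _ "L + 1"]) auto
    qed (use less_imp_le in blast)
    finally show ?thesis
      using lip_le_lspace_of_iff[of p M f] p that by auto
  qed
  then show ?thesis
    using p by (auto simp: Lip0_def)
qed

section \<open>Norms, dual and free space over one pointed metric space\<close>

context
  fixes M :: "'a metric" and p :: 'a
  assumes p: "p \<in> mspace M"
begin

lemma Lip0_outside: "f \<in> vecs (Lip0 M p) \<Longrightarrow> x \<notin> pts (lspace_of M p) \<Longrightarrow> f x = 0"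
  using Lip0_vecs_iff[OF p] by blast

lemma Lip0_vecsI: "(\<And>x. x \<notin> pts (lspace_of M p) \<Longrightarrow> f x = 0) \<Longrightarrow> 0 \<le> L \<Longrightarrow> lip_le (lspace_of M p) L f \<Longrightarrow> f \<in> vecs (Lip0 M p)"
  using Lip0_vecs_iff[OF p] by blast

lemma nrm_Lip0_eq: "f p = 0 \<Longrightarrow> nrm (Lip0 M p) f = Inf {L. 0 \<le> L \<and> lip_le (lspace_of M p) L f}"
  by (simp add: Lip0_def lip_le_lspace_of_iff[OF p] cong: conj_cong)

lemma nrm_Lip0_le: "f p = 0 \<Longrightarrow> 0 \<le> L \<Longrightarrow> lip_le (lspace_of M p) L f \<Longrightarrow> nrm (Lip0 M p) f \<le> L"
  by (auto simp: nrm_Lip0_eq intro!: cInf_lower bdd_belowI[of _ 0])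

text \<open>The defining inequalities are closed conditions on the constant, so the infimum is
  itself admissible. Inequalities with right-hand factor \<open>0\<close> are treated apart because
  the others are divided by that factor.\<close>

lemma
  assumes f: "f \<in> vecs (Lip0 M p)"
  shows nrm_Lip0_nonneg: "0 \<le> nrm (Lip0 M p) f" and lip_le_nrm_Lip0: "lip_le (lspace_of M p) (nrm (Lip0 M p) f) f"
proof -
  define S where "S = {L. 0 \<le> L \<and> lip_le (lspace_of M p) L f}"
  have S: "S \<noteq> {}" "\<And>L. L \<in> S \<Longrightarrow> 0 \<le> L"
    using f Lip0_vecs_iff[OF p] by (auto simp: S_def)
  have eq: "nrm (Lip0 M p) f = Inf S"
    using Lip0_outside[OF f, of p] by (simp add: nrm_Lip0_eq S_def)
  show "0 \<le> nrm (Lip0 M p) f"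
    unfolding eq using S by (intro cInf_greatest)
  have le: "a \<le> Inf S * b" if "\<And>L. L \<in> S \<Longrightarrow> a \<le> L * b" "0 \<le> b" for a b :: real
  proof (cases "b = 0")
    case True
    then show ?thesis
      using that(1) S(1) by auto
  next
    case False
    then have "a / b \<le> Inf S"
      using that by (intro cInf_greatest S(1)) (simp add: divide_le_eq)
    then show ?thesis
      using False that(2) by (simp add: divide_le_eq)
  qed
  show "lip_le (lspace_of M p) (nrm (Lip0 M p) f) f"
    unfolding eq by (intro lip_leI le) (auto simp: S_def lip_le_def)
qed

lemma subspace_Lip0: "subspace (vecs (Lip0 M p))"
proof (rule subspaceI)
  show "0 \<in> vecs (Lip0 M p)"
    by (rule Lip0_vecsI[of _ 0]) (auto simp: lip_le_def)
  fix f g assume f: "f \<in> vecs (Lip0 M p)" and g: "g \<in> vecs (Lip0 M p)"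
  show "f + g \<in> vecs (Lip0 M p)"
    by (rule Lip0_vecsI[OF _ _ lip_le_add[OF lip_le_nrm_Lip0[OF f] lip_le_nrm_Lip0[OF g]]])
      (use Lip0_outside[OF f] Lip0_outside[OF g] nrm_Lip0_nonneg[OF f] nrm_Lip0_nonneg[OF g] in auto)
next
  fix f c assume f: "f \<in> vecs (Lip0 M p)"
  show "c *\<^sub>R f \<in> vecs (Lip0 M p)"
  proof (rule Lip0_vecsI)
    show "lip_le (lspace_of M p) (\<bar>c\<bar> * nrm (Lip0 M p) f) (c *\<^sub>R f)"
      using lip_le_nrm_Lip0[OF f]
      by (auto simp: lip_le_def scaleR_fun_def abs_mult mult.assoc mult_left_mono simp flip: right_diff_distrib)
  qed (use Lip0_outside[OF f] nrm_Lip0_nonneg[OF f] in \<open>auto simp: scaleR_fun_def\<close>)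
qed

lemma nrm_Lip0_scale: "f \<in> vecs (Lip0 M p) \<Longrightarrow> nrm (Lip0 M p) (c *\<^sub>R f) \<le> \<bar>c\<bar> * nrm (Lip0 M p) f"
  using lip_le_nrm_Lip0[of f] nrm_Lip0_nonneg[of f] Lip0_outside[of f p]
  by (intro nrm_Lip0_le)
    (auto simp: lip_le_def scaleR_fun_def abs_mult mult.assoc mult_left_mono simp flip: right_diff_distrib)

lemma dual_vecs_iff:
  "\<phi> \<in> vecs (dual (Lip0 M p)) \<longleftrightarrow>
    (\<forall>f\<in>vecs (Lip0 M p). \<forall>g\<in>vecs (Lip0 M p). \<phi> (f + g) = \<phi> f + \<phi> g) \<and>
    (\<forall>c. \<forall>f\<in>vecs (Lip0 M p). \<phi> (c *\<^sub>R f) = c * \<phi> f) \<and>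
    (\<exists>C\<ge>0. \<forall>f\<in>vecs (Lip0 M p). \<bar>\<phi> f\<bar> \<le> C * nrm (Lip0 M p) f) \<and> (\<forall>f. f \<notin> vecs (Lip0 M p) \<longrightarrow> \<phi> f = 0)"
proof -
  have "(\<exists>C. \<forall>f\<in>vecs (Lip0 M p). \<bar>\<phi> f\<bar> \<le> C * nrm (Lip0 M p) f) \<longleftrightarrow>
    (\<exists>C\<ge>0. \<forall>f\<in>vecs (Lip0 M p). \<bar>\<phi> f\<bar> \<le> C * nrm (Lip0 M p) f)"
  proof
    assume "\<exists>C. \<forall>f\<in>vecs (Lip0 M p). \<bar>\<phi> f\<bar> \<le> C * nrm (Lip0 M p) f"
    then obtain C where C: "\<And>f. f \<in> vecs (Lip0 M p) \<Longrightarrow> \<bar>\<phi> f\<bar> \<le> C * nrm (Lip0 M p) f"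
      by blast
    have "\<bar>\<phi> f\<bar> \<le> \<bar>C\<bar> * nrm (Lip0 M p) f" if "f \<in> vecs (Lip0 M p)" for f
      using C[OF that] mult_right_mono[OF abs_ge_self[of C] nrm_Lip0_nonneg[OF that]] by linarith
    then show "\<exists>C\<ge>0. \<forall>f\<in>vecs (Lip0 M p). \<bar>\<phi> f\<bar> \<le> C * nrm (Lip0 M p) f"
      by (intro exI[of _ "\<bar>C\<bar>"]) auto
  qed blast
  then show ?thesis
    by (auto simp: dual_def bounded_linear_op_def)
qed

lemma dual_nrm_bound:
  assumes \<phi>: "\<phi> \<in> vecs (dual (Lip0 M p))" and f: "f \<in> vecs (Lip0 M p)"
  shows "\<bar>\<phi> f\<bar> \<le> nrm (dual (Lip0 M p)) \<phi> * nrm (Lip0 M p) f"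
proof -
  obtain C where C: "0 \<le> C" "\<And>f. f \<in> vecs (Lip0 M p) \<Longrightarrow> \<bar>\<phi> f\<bar> \<le> C * nrm (Lip0 M p) f"
    using \<phi> dual_vecs_iff by blast
  have "\<bar>\<phi> u\<bar> \<le> C" if "u \<in> vecs (Lip0 M p)" "nrm (Lip0 M p) u \<le> 1" for u
    using C(2)[OF that(1)] mult_left_mono[OF that(2) C(1)] by simp
  then have "bdd_above {\<bar>\<phi> u\<bar> |u. u \<in> vecs (Lip0 M p) \<and> nrm (Lip0 M p) u \<le> 1}"
    by (intro bdd_aboveI[of _ C]) auto
  then have unit: "\<bar>\<phi> u\<bar> \<le> nrm (dual (Lip0 M p)) \<phi>" if "u \<in> vecs (Lip0 M p)" "nrm (Lip0 M p) u \<le> 1" for u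
    using that by (auto simp: dual_def intro!: cSup_upper)
  define n where "n = nrm (Lip0 M p) f"
  show ?thesis
  \<comment> \<open>A function of norm \<open>0\<close> cannot be normalised, but boundedness forces
    \<open>\<phi> f = 0\<close> for it.\<close>
  proof (cases "n = 0")
    case True
    then show ?thesis
      using C(2)[OF f] by (simp add: n_def)
  next
    case False
    then have n: "0 < n"
      using nrm_Lip0_nonneg[OF f] by (simp add: n_def)
    have u: "(1 / n) *\<^sub>R f \<in> vecs (Lip0 M p)"
      using subspace_Lip0 f by (rule subspace_scale)
    have "nrm (Lip0 M p) ((1 / n) *\<^sub>R f) \<le> 1"
      using nrm_Lip0_scale[OF f, of "1 / n"] n by (simp add: n_def)
    from unit[OF u this] have "\<bar>(1 / n) * \<phi> f\<bar> \<le> nrm (dual (Lip0 M p)) \<phi>"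
      using \<phi> f dual_vecs_iff by metis
    then show ?thesis
      using n by (simp add: abs_mult field_simps n_def)
  qed
qed

lemma dual_nrm_le:
  assumes "0 \<le> C" "\<And>f. f \<in> vecs (Lip0 M p) \<Longrightarrow> \<bar>\<phi> f\<bar> \<le> C * nrm (Lip0 M p) f"
  shows "nrm (dual (Lip0 M p)) \<phi> \<le> C"
proof -
  \<comment> \<open>The zero function shows that the supremum defining the dual norm is over a
    nonempty set.\<close>
  have "0 \<in> vecs (Lip0 M p)" "nrm (Lip0 M p) 0 \<le> 1"
    using subspace_0[OF subspace_Lip0] nrm_Lip0_le[of 0 0] by (auto simp: lip_le_def)
  moreover have "\<bar>\<phi> f\<bar> \<le> C" if "f \<in> vecs (Lip0 M p)" "nrm (Lip0 M p) f \<le> 1" for f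
    using assms(2)[OF that(1)] mult_left_mono[OF that(2) assms(1)] by simp
  ultimately show ?thesis
    unfolding dual_def by (auto intro!: cSup_least)
qed

lemma dual_nrm_nonneg: "\<phi> \<in> vecs (dual (Lip0 M p)) \<Longrightarrow> 0 \<le> nrm (dual (Lip0 M p)) \<phi>"
proof -
  assume \<phi>: "\<phi> \<in> vecs (dual (Lip0 M p))"
  then obtain C where C: "0 \<le> C" "\<And>f. f \<in> vecs (Lip0 M p) \<Longrightarrow> \<bar>\<phi> f\<bar> \<le> C * nrm (Lip0 M p) f"
    using dual_vecs_iff by blast
  have "\<bar>\<phi> u\<bar> \<le> C" if "u \<in> vecs (Lip0 M p)" "nrm (Lip0 M p) u \<le> 1" for u
    using C(2)[OF that(1)] mult_left_mono[OF that(2) C(1)] by simp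
  then have "bdd_above {\<bar>\<phi> u\<bar> |u. u \<in> vecs (Lip0 M p) \<and> nrm (Lip0 M p) u \<le> 1}"
    by (intro bdd_aboveI[of _ C]) auto
  moreover have "0 \<in> vecs (Lip0 M p)" "nrm (Lip0 M p) 0 \<le> 1"
    using subspace_0[OF subspace_Lip0] nrm_Lip0_le[of 0 0] by (auto simp: lip_le_def)
  ultimately have "\<bar>\<phi> 0\<bar> \<le> nrm (dual (Lip0 M p)) \<phi>"
    unfolding dual_def by (auto intro!: cSup_upper)
  then show ?thesis by linarith
qed

lemma subspace_dual: "subspace (vecs (dual (Lip0 M p)))"
proof (rule subspaceI)
  show "0 \<in> vecs (dual (Lip0 M p))"
    using nrm_Lip0_nonneg by (auto simp: dual_vecs_iff)
  fix \<phi> \<psi> assume \<phi>: "\<phi> \<in> vecs (dual (Lip0 M p))" and \<psi>: "\<psi> \<in> vecs (dual (Lip0 M p))"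
  have "\<bar>(\<phi> + \<psi>) f\<bar> \<le> (nrm (dual (Lip0 M p)) \<phi> + nrm (dual (Lip0 M p)) \<psi>) * nrm (Lip0 M p) f"
    if "f \<in> vecs (Lip0 M p)" for f
    using dual_nrm_bound[OF \<phi> that] dual_nrm_bound[OF \<psi> that] by (simp add: distrib_right)
  then have "\<exists>C\<ge>0. \<forall>f\<in>vecs (Lip0 M p). \<bar>(\<phi> + \<psi>) f\<bar> \<le> C * nrm (Lip0 M p) f"
    using dual_nrm_nonneg[OF \<phi>] dual_nrm_nonneg[OF \<psi>] by (meson add_nonneg_nonneg)
  then show "\<phi> + \<psi> \<in> vecs (dual (Lip0 M p))"
    using \<phi> \<psi> by (auto simp: dual_vecs_iff algebra_simps)
next
  fix \<phi> c assume \<phi>: "\<phi> \<in> vecs (dual (Lip0 M p))"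
  have "\<bar>(c *\<^sub>R \<phi>) f\<bar> \<le> (\<bar>c\<bar> * nrm (dual (Lip0 M p)) \<phi>) * nrm (Lip0 M p) f"
    if "f \<in> vecs (Lip0 M p)" for f
    using mult_left_mono[OF dual_nrm_bound[OF \<phi> that], of "\<bar>c\<bar>"]
    by (simp add: scaleR_fun_def abs_mult mult.assoc)
  then have "\<exists>C\<ge>0. \<forall>f\<in>vecs (Lip0 M p). \<bar>(c *\<^sub>R \<phi>) f\<bar> \<le> C * nrm (Lip0 M p) f"
    using dual_nrm_nonneg[OF \<phi>] by (meson abs_ge_zero mult_nonneg_nonneg)
  then show "c *\<^sub>R \<phi> \<in> vecs (dual (Lip0 M p))"
    using \<phi> by (auto simp: dual_vecs_iff scaleR_fun_def algebra_simps)
qed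

lemma dual_nrm_triangle:
  assumes "\<phi> \<in> vecs (dual (Lip0 M p))" "\<psi> \<in> vecs (dual (Lip0 M p))"
  shows "nrm (dual (Lip0 M p)) (\<phi> + \<psi>) \<le> nrm (dual (Lip0 M p)) \<phi> + nrm (dual (Lip0 M p)) \<psi>"
proof (rule dual_nrm_le)
  show "\<bar>(\<phi> + \<psi>) f\<bar> \<le> (nrm (dual (Lip0 M p)) \<phi> + nrm (dual (Lip0 M p)) \<psi>) * nrm (Lip0 M p) f"
    if "f \<in> vecs (Lip0 M p)" for f
    using dual_nrm_bound[OF assms(1) that] dual_nrm_bound[OF assms(2) that] by (simp add: distrib_right)
qed (use dual_nrm_nonneg assms in auto)

lemma dual_nrm_scale:
  assumes "\<phi> \<in> vecs (dual (Lip0 M p))"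
  shows "nrm (dual (Lip0 M p)) (c *\<^sub>R \<phi>) \<le> \<bar>c\<bar> * nrm (dual (Lip0 M p)) \<phi>"
proof (rule dual_nrm_le)
  show "\<bar>(c *\<^sub>R \<phi>) f\<bar> \<le> (\<bar>c\<bar> * nrm (dual (Lip0 M p)) \<phi>) * nrm (Lip0 M p) f"
    if "f \<in> vecs (Lip0 M p)" for f
    using mult_left_mono[OF dual_nrm_bound[OF assms that], of "\<bar>c\<bar>"]
    by (simp add: scaleR_fun_def abs_mult mult.assoc)
qed (use dual_nrm_nonneg assms in auto)

lemma evaluation_dual:
  assumes "x \<in> mspace M"
  shows "evaluation M p x \<in> vecs (dual (Lip0 M p))"
proof -
  have "\<bar>f x\<bar> \<le> mdist M p x * nrm (Lip0 M p) f" if f: "f \<in> vecs (Lip0 M p)" for f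
  proof (cases "x = p")
    case True
    then show ?thesis
      using Lip0_outside[OF f, of p] nrm_Lip0_nonneg[OF f] by simp
  next
    case False
    then show ?thesis
      using lip_leD(1)[OF lip_le_nrm_Lip0[OF f], of x] assms by (simp add: mult.commute)
  qed
  then have "\<exists>C\<ge>0. \<forall>f\<in>vecs (Lip0 M p). \<bar>f x\<bar> \<le> C * nrm (Lip0 M p) f"
    by (intro exI[of _ "mdist M p x"]) auto
  then show ?thesis
    using subspace_add[OF subspace_Lip0] subspace_scale[OF subspace_Lip0]
    by (simp add: dual_vecs_iff evaluation_def scaleR_fun_def)
qed

lemma span_evaluation_dual: "\<psi> \<in> span (evaluation M p ` mspace M) \<Longrightarrow> \<psi> \<in> vecs (dual (Lip0 M p))"
  by (rule subsetD[OF span_minimal[OF _ subspace_dual]]) (auto intro: evaluation_dual)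

lemma free_vecs_iff:
  "\<phi> \<in> vecs (lipschitz_free M p) \<longleftrightarrow> \<phi> \<in> vecs (dual (Lip0 M p)) \<and>
    (\<forall>e>0. \<exists>\<psi>\<in>span (evaluation M p ` mspace M). nrm (dual (Lip0 M p)) (\<phi> - \<psi>) < e)"
  by (simp add: lipschitz_free_def)

lemma nrm_free [simp]: "nrm (lipschitz_free M p) = nrm (dual (Lip0 M p))"
  by (simp add: lipschitz_free_def)

lemma free_dual: "\<phi> \<in> vecs (lipschitz_free M p) \<Longrightarrow> \<phi> \<in> vecs (dual (Lip0 M p))"
  by (simp add: free_vecs_iff)

lemma subspace_free: "subspace (vecs (lipschitz_free M p))"
proof (rule subspaceI)
  show "0 \<in> vecs (lipschitz_free M p)"
    unfolding free_vecs_iff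
  proof (intro conjI allI impI bexI[of _ 0])
    show "nrm (dual (Lip0 M p)) (0 - 0) < e" if "0 < e" for e
      using dual_nrm_le[of 0 0] that by simp
  qed (auto simp: span_zero subspace_0[OF subspace_dual])
  fix \<phi>1 \<phi>2 assume \<phi>: "\<phi>1 \<in> vecs (lipschitz_free M p)" "\<phi>2 \<in> vecs (lipschitz_free M p)"
  show "\<phi>1 + \<phi>2 \<in> vecs (lipschitz_free M p)"
    unfolding free_vecs_iff
  proof (intro conjI allI impI)
    show "\<phi>1 + \<phi>2 \<in> vecs (dual (Lip0 M p))"
      using \<phi>[THEN free_dual] by (rule subspace_add[OF subspace_dual])
    fix e :: real assume e: "0 < e"
    obtain \<psi>1 where \<psi>1: "\<psi>1 \<in> span (evaluation M p ` mspace M)" "nrm (dual (Lip0 M p)) (\<phi>1 - \<psi>1) < e / 2"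
      using \<phi>(1) e unfolding free_vecs_iff by (meson half_gt_zero)
    obtain \<psi>2 where \<psi>2: "\<psi>2 \<in> span (evaluation M p ` mspace M)" "nrm (dual (Lip0 M p)) (\<phi>2 - \<psi>2) < e / 2"
      using \<phi>(2) e unfolding free_vecs_iff by (meson half_gt_zero)
    have "nrm (dual (Lip0 M p)) ((\<phi>1 - \<psi>1) + (\<phi>2 - \<psi>2)) < e"
      using dual_nrm_triangle[of "\<phi>1 - \<psi>1" "\<phi>2 - \<psi>2"] \<psi>1 \<psi>2 \<phi>[THEN free_dual] span_evaluation_dual
        subspace_diff[OF subspace_dual] by fastforce
    moreover have "(\<phi>1 - \<psi>1) + (\<phi>2 - \<psi>2) = (\<phi>1 + \<phi>2) - (\<psi>1 + \<psi>2)"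
      by (simp add: algebra_simps)
    ultimately show "\<exists>\<psi>\<in>span (evaluation M p ` mspace M). nrm (dual (Lip0 M p)) (\<phi>1 + \<phi>2 - \<psi>) < e"
      using span_add[OF \<psi>1(1) \<psi>2(1)] by metis
  qed
next
  fix \<phi> c assume \<phi>: "\<phi> \<in> vecs (lipschitz_free M p)"
  show "c *\<^sub>R \<phi> \<in> vecs (lipschitz_free M p)"
    unfolding free_vecs_iff
  proof (intro conjI allI impI)
    show "c *\<^sub>R \<phi> \<in> vecs (dual (Lip0 M p))"
      using free_dual[OF \<phi>] by (rule subspace_scale[OF subspace_dual])
    fix e :: real assume e: "0 < e"
    then have "0 < e / (\<bar>c\<bar> + 1)"
      by simp
    then obtain \<psi> where \<psi>: "\<psi> \<in> span (evaluation M p ` mspace M)" "nrm (dual (Lip0 M p)) (\<phi> - \<psi>) < e / (\<bar>c\<bar> + 1)"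
      using \<phi> unfolding free_vecs_iff by meson
    have d: "\<phi> - \<psi> \<in> vecs (dual (Lip0 M p))"
      using free_dual[OF \<phi>] span_evaluation_dual[OF \<psi>(1)] by (rule subspace_diff[OF subspace_dual])
    have "nrm (dual (Lip0 M p)) (c *\<^sub>R (\<phi> - \<psi>)) \<le> \<bar>c\<bar> * nrm (dual (Lip0 M p)) (\<phi> - \<psi>)"
      by (rule dual_nrm_scale[OF d])
    also have "\<dots> \<le> (\<bar>c\<bar> + 1) * nrm (dual (Lip0 M p)) (\<phi> - \<psi>)"
      using dual_nrm_nonneg[OF d] by (intro mult_right_mono) auto
    also have "\<dots> < e"
      using \<psi>(2) by (simp add: pos_less_divide_eq mult.commute add_pos_nonneg)
    finally show "\<exists>\<psi>\<in>span (evaluation M p ` mspace M). nrm (dual (Lip0 M p)) (c *\<^sub>R \<phi> - \<psi>) < e"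
      using span_scale[OF \<psi>(1), of c] by (metis scaleR_diff_right)
  qed
qed

text \<open>Passes from \<open>fin_fun\<close>, where evaluations act on all functions, to the
  evaluations of the free space, which are \<open>0\<close> off the space of Lipschitz
  functions.\<close>

lemma span_evaluation_fin_fun:
  assumes "fin_fun (pts (lspace_of M p)) \<phi>"
  shows "(\<lambda>f. if f \<in> vecs (Lip0 M p) then \<phi> f else 0) \<in> span (evaluation M p ` mspace M)"
  using assms
proof (induction rule: fin_fun_induct)
  case zero
  then show ?case
    using span_zero[of "evaluation M p ` mspace M"] by (simp add: zero_fun_def)
next
  case (add \<phi> \<psi>)
  have "(\<lambda>f. if f \<in> vecs (Lip0 M p) then \<phi> f + \<psi> f else 0) =
    (\<lambda>f. if f \<in> vecs (Lip0 M p) then \<phi> f else 0) + (\<lambda>f. if f \<in> vecs (Lip0 M p) then \<psi> f else 0)"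
    by auto
  then show ?case
    using span_add[OF add] by simp
next
  case (eval c x)
  have "(\<lambda>f. if f \<in> vecs (Lip0 M p) then c * f x else 0) = c *\<^sub>R evaluation M p x"
    by (auto simp: evaluation_def scaleR_fun_def)
  then show ?case
    using span_scale[OF span_base[of "evaluation M p x" "evaluation M p ` mspace M"], of c] eval by simp
qed

end

section \<open>Adjoint maps between free spaces\<close>

definition adjoint :: "'b metric \<Rightarrow> 'b \<Rightarrow> (('b \<Rightarrow> real) \<Rightarrow> 'a \<Rightarrow> real) \<Rightarrow> (('a \<Rightarrow> real) \<Rightarrow> real) \<Rightarrow> ('b \<Rightarrow> real) \<Rightarrow> real"
  where "adjoint M' p' T \<phi> = (\<lambda>f. if f \<in> vecs (Lip0 M' p') then \<phi> (T f) else 0)"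

lemma linear_adjoint: "linear (adjoint M' p' T)"
  by (auto simp: linear_iff adjoint_def scaleR_fun_def)

text \<open>By the finite kernel the adjoint maps the span of the evaluations into the span of the
  evaluations, and by its norm bound it maps the closures into each other.\<close>

lemma adjoint_bounded_linear_op:
  assumes p: "p \<in> mspace M" and p': "p' \<in> mspace M'"
    and ker: "ker_op (pts (lspace_of M' p')) (pts (lspace_of M p)) T"
    and zero: "\<And>f x. x \<notin> pts (lspace_of M p) \<Longrightarrow> T f x = 0"
    and C: "0 \<le> C" and lip: "\<And>L f. 0 \<le> L \<Longrightarrow> lip_le (lspace_of M' p') L f \<Longrightarrow> lip_le (lspace_of M p) (C * L) (T f)"
  shows "bounded_linear_op (lipschitz_free M p) (lipschitz_free M' p') (adjoint M' p' T)"
proof -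
  let ?A = "adjoint M' p' T"
  have T: "T f \<in> vecs (Lip0 M p)" "nrm (Lip0 M p) (T f) \<le> C * nrm (Lip0 M' p') f" if f: "f \<in> vecs (Lip0 M' p')" for f
  proof -
    have "lip_le (lspace_of M p) (C * nrm (Lip0 M' p') f) (T f)"
      by (intro lip nrm_Lip0_nonneg[OF p'] lip_le_nrm_Lip0[OF p'] f)
    then show "T f \<in> vecs (Lip0 M p)" "nrm (Lip0 M p) (T f) \<le> C * nrm (Lip0 M' p') f"
      using zero C nrm_Lip0_nonneg[OF p' f]
      by (auto intro!: Lip0_vecsI[OF p, where L = "C * nrm (Lip0 M' p') f"] nrm_Lip0_le[OF p])
  qed
  have lin: "linear T"
    unfolding linear_iff
  proof (intro conjI allI ext)
    fix f g :: "'b \<Rightarrow> real" and c x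
    have fx: "linear (\<lambda>f. T f x)" if "x \<in> pts (lspace_of M p)"
      by (rule fin_fun_linear[OF ker_opD[OF ker that]])
    show "T (f + g) x = (T f + T g) x" "T (c *\<^sub>R f) x = (c *\<^sub>R T f) x"
      using linear_add[OF fx] linear_scale[OF fx] zero
      by (cases "x \<in> pts (lspace_of M p)"; simp add: scaleR_fun_def)+
  qed
  have A: "?A \<phi> \<in> vecs (dual (Lip0 M' p'))"
    "nrm (dual (Lip0 M' p')) (?A \<phi>) \<le> C * nrm (dual (Lip0 M p)) \<phi>"
    if \<phi>: "\<phi> \<in> vecs (dual (Lip0 M p))" for \<phi>
  proof -
    have bd: "\<bar>?A \<phi> f\<bar> \<le> (C * nrm (dual (Lip0 M p)) \<phi>) * nrm (Lip0 M' p') f" if f: "f \<in> vecs (Lip0 M' p')" for f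
    proof -
      have "\<bar>?A \<phi> f\<bar> \<le> nrm (dual (Lip0 M p)) \<phi> * nrm (Lip0 M p) (T f)"
        using dual_nrm_bound[OF p \<phi> T(1)[OF f]] f by (simp add: adjoint_def)
      also have "\<dots> \<le> nrm (dual (Lip0 M p)) \<phi> * (C * nrm (Lip0 M' p') f)"
        by (intro mult_left_mono T f dual_nrm_nonneg[OF p \<phi>])
      finally show ?thesis
        by (simp add: ac_simps)
    qed
    have nn: "0 \<le> C * nrm (dual (Lip0 M p)) \<phi>"
      using C dual_nrm_nonneg[OF p \<phi>] by simp
    show "nrm (dual (Lip0 M' p')) (?A \<phi>) \<le> C * nrm (dual (Lip0 M p)) \<phi>"
      by (rule dual_nrm_le[OF p' nn bd])
    have "\<exists>C\<ge>0. \<forall>f\<in>vecs (Lip0 M' p'). \<bar>?A \<phi> f\<bar> \<le> C * nrm (Lip0 M' p') f"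
      using nn bd by blast
    then show "?A \<phi> \<in> vecs (dual (Lip0 M' p'))"
      using \<phi> T(1) subspace_add[OF subspace_Lip0[OF p']] subspace_scale[OF subspace_Lip0[OF p']]
      by (simp add: dual_vecs_iff[OF p] dual_vecs_iff[OF p'] adjoint_def linear_add[OF lin] linear_scale[OF lin])
  qed
  have "?A (evaluation M p x) \<in> span (evaluation M' p' ` mspace M')" if x: "x \<in> mspace M" for x
  proof -
    have "?A (evaluation M p x) = (\<lambda>f. if f \<in> vecs (Lip0 M' p') then T f x else 0)"
      using T(1) by (auto simp: adjoint_def evaluation_def)
    moreover have "(\<lambda>f. if f \<in> vecs (Lip0 M' p') then T f x else 0) \<in> span (evaluation M' p' ` mspace M')"
    proof (cases "x = p")
      case True
      then have "T f x = 0" for f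
        using zero[of x] by simp
      then have "(\<lambda>f. if f \<in> vecs (Lip0 M' p') then T f x else 0) = 0"
        by (simp add: fun_eq_iff)
      then show ?thesis
        using span_zero[of "evaluation M' p' ` mspace M'"] by simp
    next
      case False
      then show ?thesis
        using span_evaluation_fin_fun[OF p' ker_opD[OF ker]] x by simp
    qed
    ultimately show ?thesis by simp
  qed
  then have "?A ` span (evaluation M p ` mspace M) \<subseteq> span (evaluation M' p' ` mspace M')"
    by (simp add: linear_span_image[OF linear_adjoint, symmetric] span_minimal image_subset_iff)
  then have span: "?A \<psi> \<in> span (evaluation M' p' ` mspace M')" if "\<psi> \<in> span (evaluation M p ` mspace M)" for \<psi>
    using that by blast
  have "?A \<phi> \<in> vecs (lipschitz_free M' p')" if \<phi>: "\<phi> \<in> vecs (lipschitz_free M p)" for \<phi>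
    unfolding free_vecs_iff[OF p']
  proof (intro conjI allI impI A free_dual[OF p \<phi>])
    fix e :: real assume e: "0 < e"
    \<comment> \<open>\<open>C + 1\<close> in place of \<open>C\<close>, since \<open>C\<close> may
      be \<open>0\<close>.\<close>
    then have "0 < e / (C + 1)"
      using C by simp
    then obtain \<psi> where \<psi>: "\<psi> \<in> span (evaluation M p ` mspace M)" "nrm (dual (Lip0 M p)) (\<phi> - \<psi>) < e / (C + 1)"
      using \<phi> unfolding free_vecs_iff[OF p] by meson
    have d: "\<phi> - \<psi> \<in> vecs (dual (Lip0 M p))"
      using free_dual[OF p \<phi>] span_evaluation_dual[OF p \<psi>(1)] by (rule subspace_diff[OF subspace_dual[OF p]])
    have "nrm (dual (Lip0 M' p')) (?A (\<phi> - \<psi>)) \<le> C * nrm (dual (Lip0 M p)) (\<phi> - \<psi>)"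
      by (rule A(2)[OF d])
    also have "\<dots> \<le> (C + 1) * nrm (dual (Lip0 M p)) (\<phi> - \<psi>)"
      using dual_nrm_nonneg[OF p d] by (intro mult_right_mono) auto
    also have "\<dots> < e"
      using \<psi>(2) C by (simp add: pos_less_divide_eq mult.commute)
    finally show "\<exists>\<psi>\<in>span (evaluation M' p' ` mspace M'). nrm (dual (Lip0 M' p')) (?A \<phi> - \<psi>) < e"
      using span[OF \<psi>(1)] by (auto simp: linear_diff[OF linear_adjoint] intro!: bexI[of _ "?A \<psi>"])
  qed
  then show ?thesis
    using A(2)[OF free_dual[OF p]] nrm_free[OF p] nrm_free[OF p']
    by (auto simp: bounded_linear_op_def linear_add[OF linear_adjoint] linear_scale[OF linear_adjoint]
        intro!: exI[of _ C])
qed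

text \<open>\<open>inv_into\<close> agrees with \<open>S\<close> on the vectors of \<open>Y\<close>
  only. Closure of these under sums and multiples is what transfers linearity from
  \<open>S\<close>.\<close>

lemma linearly_isomorphicI:
  assumes T: "bounded_linear_op X Y T" and S: "bounded_linear_op Y X S"
    and ST: "\<And>u. u \<in> vecs X \<Longrightarrow> S (T u) = u" and TS: "\<And>v. v \<in> vecs Y \<Longrightarrow> T (S v) = v"
    and Y: "subspace (vecs Y)"
  shows "X \<sim>\<^sub>B Y"
proof -
  have maps: "T \<in> vecs X \<rightarrow> vecs Y" "S \<in> vecs Y \<rightarrow> vecs X"
    using T S by (simp_all add: bounded_linear_op_def)
  have bij: "bij_betw T (vecs X) (vecs Y)"
    by (rule bij_betw_byWitness[where f' = S]) (use ST TS maps in auto)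
  have "inv_into (vecs X) T v = S v" if "v \<in> vecs Y" for v
    using bij maps TS[OF that] that by (metis PiE bij_betw_inv_into_left)
  then have "bounded_linear_op Y X (inv_into (vecs X) T)"
    using S subspace_add[OF Y] subspace_scale[OF Y] by (simp add: bounded_linear_op_def Pi_def)
  with T bij show ?thesis
    unfolding linearly_isomorphic_def by blast
qed

lemma ciso_imp_free_isomorphic:
  assumes p: "p \<in> mspace M" and p': "p' \<in> mspace M'" and iso: "ciso (lspace_of M p) (lspace_of M' p')"
  shows "lipschitz_free M p \<sim>\<^sub>B lipschitz_free M' p'"
proof -
  let ?X = "lspace_of M p" and ?Y = "lspace_of M' p'"
  obtain C U V where C: "0 \<le> C" and UV: "csub_ops C ?X ?Y U V" and VU: "csub_ops C ?Y ?X V U"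
    using iso unfolding ciso_def by auto
  \<comment> \<open>Vanishing off the points is part of membership in \<open>Lip0\<close>.\<close>
  define U' where "U' f = (\<lambda>x. if x \<in> pts ?X then U f x else 0)" for f
  define V' where "V' f = (\<lambda>x. if x \<in> pts ?Y then V f x else 0)" for f
  have ker: "ker_op (pts ?Y) (pts ?X) U'" "ker_op (pts ?X) (pts ?Y) V'"
    using csub_opsD(1)[OF UV] csub_opsD(1)[OF VU] by (simp_all add: ker_op_def U'_def V'_def)
  have lipU: "lip_le ?X (C * L) (U' f)" if "0 \<le> L" "lip_le ?Y L f" for L f
    by (rule lip_le_cong[OF csub_opsD(3)[OF UV that]]) (simp add: U'_def)
  have lipV: "lip_le ?Y (C * L) (V' f)" if "0 \<le> L" "lip_le ?X L f" for L f
    by (rule lip_le_cong[OF csub_opsD(3)[OF VU that]]) (simp add: V'_def)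
  have U'V': "U' (V' f) = f" if f: "f \<in> vecs (Lip0 M p)" for f
  proof
    fix x
    show "U' (V' f) x = f x"
    proof (cases "x \<in> pts ?X")
      case True
      have "U (V' f) x = U (V f) x"
        by (rule ker_op_cong[OF csub_opsD(1)[OF UV] _ True]) (simp add: V'_def)
      then show ?thesis
        using csub_opsD(5)[OF UV True] True by (simp add: U'_def)
    next
      case False
      then show ?thesis
        using Lip0_outside[OF p f False] False unfolding U'_def by auto
    qed
  qed
  have V'U': "V' (U' f) = f" if f: "f \<in> vecs (Lip0 M' p')" for f
  proof
    fix x
    show "V' (U' f) x = f x"
    proof (cases "x \<in> pts ?Y")
      case True
      have "V (U' f) x = V (U f) x"
        by (rule ker_op_cong[OF csub_opsD(1)[OF VU] _ True]) (simp add: U'_def)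
      then show ?thesis
        using csub_opsD(5)[OF VU True] True by (simp add: V'_def)
    next
      case False
      then show ?thesis
        using Lip0_outside[OF p' f False] False unfolding V'_def by auto
    qed
  qed
  have U'_vecs: "U' f \<in> vecs (Lip0 M p)" if f: "f \<in> vecs (Lip0 M' p')" for f
    using lipU[OF nrm_Lip0_nonneg[OF p' f] lip_le_nrm_Lip0[OF p' f]] C nrm_Lip0_nonneg[OF p' f]
    by (intro Lip0_vecsI[OF p, where L = "C * nrm (Lip0 M' p') f"]) (auto simp: U'_def)
  have V'_vecs: "V' f \<in> vecs (Lip0 M' p')" if f: "f \<in> vecs (Lip0 M p)" for f
    using lipV[OF nrm_Lip0_nonneg[OF p f] lip_le_nrm_Lip0[OF p f]] C nrm_Lip0_nonneg[OF p f]
    by (intro Lip0_vecsI[OF p', where L = "C * nrm (Lip0 M p) f"]) (auto simp: V'_def)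
  show ?thesis
  proof (rule linearly_isomorphicI)
    show "bounded_linear_op (lipschitz_free M p) (lipschitz_free M' p') (adjoint M' p' U')"
      by (rule adjoint_bounded_linear_op[OF p p' ker(1) _ C lipU]) (auto simp: U'_def)
    show "bounded_linear_op (lipschitz_free M' p') (lipschitz_free M p) (adjoint M p V')"
      by (rule adjoint_bounded_linear_op[OF p' p ker(2) _ C lipV]) (auto simp: V'_def)
    show "adjoint M p V' (adjoint M' p' U' \<phi>) = \<phi>" if "\<phi> \<in> vecs (lipschitz_free M p)" for \<phi>
      using free_dual[OF p that] U'V' V'_vecs by (auto simp: adjoint_def dual_vecs_iff[OF p])
    show "adjoint M' p' U' (adjoint M p V' \<phi>) = \<phi>" if "\<phi> \<in> vecs (lipschitz_free M' p')" for \<phi>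
      using free_dual[OF p' that] V'U' U'_vecs by (auto simp: adjoint_def dual_vecs_iff[OF p'])
    show "subspace (vecs (lipschitz_free M' p'))"
      by (rule subspace_free[OF p'])
  qed
qed

section \<open>The space of absolutely summable sequences\<close>

text \<open>Countably many points at distance \<open>1\<close> from a base point and
  \<open>2\<close> from each other, with the base point left out. The free space of such a star is
  \<open>\<ell>\<^sub>1\<close>, and its Lipschitz functions are the bounded sequences.\<close>

definition star :: "nat lspace"
  where "star = \<lparr>pts = UNIV, wt = (\<lambda>_. 1), ds = (\<lambda>_ _. 2)\<rparr>"

lemma pts_star [simp]: "pts star = UNIV"
  by (simp add: star_def)

lemma lip_le_star: "lip_le star L g \<longleftrightarrow> (\<forall>n. \<bar>g n\<bar> \<le> L)"
proof
  assume "\<forall>n. \<bar>g n\<bar> \<le> L"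
  then have g: "\<bar>g n\<bar> \<le> L" for n
    by blast
  have "\<bar>g m - g n\<bar> \<le> L * 2" for m n
    using g[of m] g[of n] by linarith
  then show "lip_le star L g"
    using g by (simp add: lip_le_def star_def)
qed (simp add: lip_le_def star_def)

text \<open>\<open>grid 0 k\<close> is one point of weight \<open>k\<close>; dividing the function
  value by \<open>k\<close> normalises the weight.\<close>

lemma ciso_model_0_star: "ciso (model 0) star"
proof -
  define U :: "(nat \<Rightarrow> real) \<Rightarrow> nat \<times> (nat \<Rightarrow> real) \<Rightarrow> real"
    where "U g = (\<lambda>(j, x). real (grid_size j) * g j)" for g
  define V :: "(nat \<times> (nat \<Rightarrow> real) \<Rightarrow> real) \<Rightarrow> nat \<Rightarrow> real"
    where "V f j = (1 / grid_size j) * f (j, \<lambda>_. 0)" for f j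
  have size: "0 < grid_size j" for j
    by (simp add: grid_size_def)
  have grid0: "x \<in> pts (grid 0 k) \<longleftrightarrow> x = (\<lambda>_. 0)" for x k
    by (auto simp: grid_def Pi_def)
  have pts: "(j, x) \<in> pts (model 0) \<longleftrightarrow> x = (\<lambda>_. 0)" for j x
    unfolding model_def by (simp add: grid0)
  have lip: "lip_le (model 0) L f \<longleftrightarrow> (\<forall>j. \<bar>f (j, \<lambda>_. 0)\<bar> \<le> L * grid_size j)" for L f
  proof -
    have "lip_le (grid 0 k) L h \<longleftrightarrow> \<bar>h (\<lambda>_. 0)\<bar> \<le> L * real k" for k and h :: "(nat \<Rightarrow> real) \<Rightarrow> real"
      unfolding lip_le_def Ball_def grid0 by (simp add: grid_def)
    then show ?thesis
      by (simp add: model_def lip_le_wedge)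
  qed
  have "ker_op (pts star) (pts (model 0)) U"
    unfolding ker_op_def U_def by (auto intro!: fin_fun_scale fin_fun_eval)
  moreover have "ker_op (pts (model 0)) (pts star) V"
    unfolding V_def by (intro ker_opI fin_fun_scale fin_fun_eval) (simp add: pts)
  moreover have "lip_le (model 0) (1 * L) (U g)" if "lip_le star L g" for L g
    using that by (simp add: lip lip_le_star U_def abs_mult mult.commute mult_right_mono)
  moreover have "lip_le star (1 * L) (V f)" if "lip_le (model 0) L f" for L f
    using that size by (simp add: lip lip_le_star V_def abs_mult divide_le_eq)
  moreover have "U (V f) z = f z" if "z \<in> pts (model 0)" for f z
    using that size[of "fst z"] by (cases z) (simp add: U_def V_def pts)
  moreover have "V (U g) j = g j" for g j
    using size[of j] by (simp add: U_def V_def)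
  ultimately have "csub_ops 1 (model 0) star U V" "csub_ops 1 star (model 0) V U"
    by (auto intro!: csub_opsI)
  then show ?thesis
    unfolding ciso_def by (intro exI[of _ 1] exI[of _ U] exI[of _ V]) simp
qed

lemma ell1_pairing:
  fixes x h :: "nat \<Rightarrow> real"
  assumes x: "summable (\<lambda>n. \<bar>x n\<bar>)" and h: "\<And>n. \<bar>h n\<bar> \<le> B"
  shows "summable (\<lambda>n. x n * h n)" "\<bar>\<Sum>n. x n * h n\<bar> \<le> (\<Sum>n. \<bar>x n\<bar>) * B"
proof -
  have le: "norm (x n * h n) \<le> \<bar>x n\<bar> * B" for n
    using mult_left_mono[OF h, of "\<bar>x n\<bar>" n] by (simp add: abs_mult)
  have s: "summable (\<lambda>n. \<bar>x n\<bar> * B)"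
    using x by (rule summable_mult2)
  have n: "summable (\<lambda>n. norm (x n * h n))"
    by (rule summable_comparison_test[OF _ s]) (use le in auto)
  show "summable (\<lambda>n. x n * h n)"
    by (rule summable_norm_cancel[OF n])
  have "\<bar>\<Sum>n. x n * h n\<bar> \<le> (\<Sum>n. norm (x n * h n))"
    using summable_norm[OF n] by simp
  also have "\<dots> \<le> (\<Sum>n. \<bar>x n\<bar> * B)"
    by (rule suminf_le[OF le n s])
  also have "\<dots> = (\<Sum>n. \<bar>x n\<bar>) * B"
    using x by (rule suminf_mult2[symmetric])
  finally show "\<bar>\<Sum>n. x n * h n\<bar> \<le> (\<Sum>n. \<bar>x n\<bar>) * B" .
qed

text \<open>A finite combination of evaluations has as coefficients its values at the unit
  sequences, and only finitely many of them differ from \<open>0\<close>.\<close>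

lemma fin_fun_sums:
  fixes \<phi> :: "(nat \<Rightarrow> real) \<Rightarrow> real"
  assumes "fin_fun UNIV \<phi>"
  shows "(\<lambda>n. \<phi> (\<lambda>m. of_bool (m = n)) * g n) sums \<phi> g"
  using assms
proof (induction rule: fin_fun_induct)
  case zero
  then show ?case by simp
next
  case (add \<phi> \<psi>)
  then show ?case
    using sums_add by (fastforce simp: distrib_right)
next
  case (eval c m)
  have "(\<lambda>n. c * of_bool (m = n) * g n) = (\<lambda>n. if n = m then c * g n else 0)"
    by auto
  then show ?case
    using sums_single[of m "\<lambda>n. c * g n"] by simp
qed

text \<open>\<open>T\<close> reads off the coefficients of a functional at the images of the unit
  sequences, and \<open>S\<close> sums the series of coordinate functionals with given
  coefficients.\<close>

lemma ciso_star_imp_free_isomorphic_ell1: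
  assumes p: "p \<in> mspace M" and iso: "ciso (lspace_of M p) star"
  shows "lipschitz_free M p \<sim>\<^sub>B ell1"
proof -
  let ?X = "lspace_of M p"
  let ?L = "Lip0 M p"
  obtain C U V where C: "0 \<le> C" and UV: "csub_ops C ?X star U V" and VU: "csub_ops C star ?X V U"
    using iso unfolding ciso_def by auto
  define U' where "U' g = (\<lambda>x. if x \<in> pts ?X then U g x else 0)" for g
  define e where "e n = (\<lambda>m::nat. of_bool (m = n) :: real)" for n
  have V_bound: "\<bar>V f n\<bar> \<le> C * nrm ?L f" if f: "f \<in> vecs ?L" for f n
    using csub_opsD(4)[OF UV nrm_Lip0_nonneg[OF p f] lip_le_nrm_Lip0[OF p f]] by (simp add: lip_le_star)
  have V_fin: "fin_fun (pts ?X) (\<lambda>f. V f n)" for n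
    using ker_opD[OF csub_opsD(2)[OF UV]] by simp
  note V_lin = fin_fun_linear[OF V_fin]
  have U'_lip: "lip_le ?X (C * L) (U' g)" if "\<And>n. \<bar>g n\<bar> \<le> L" for L g
  proof -
    have "0 \<le> L"
      using that[of 0] by linarith
    then show ?thesis
      using csub_opsD(3)[OF UV, of L g] that by (auto simp: lip_le_star U'_def intro: lip_le_cong)
  qed
  have U'_vecs: "U' g \<in> vecs ?L" and U'_nrm: "nrm ?L (U' g) \<le> C * L" if g: "\<And>n. \<bar>g n\<bar> \<le> L" for L g
  proof -
    have L: "0 \<le> C * L"
      using g[of 0] C by simp
    show "U' g \<in> vecs ?L"
      by (rule Lip0_vecsI[OF p _ L U'_lip[OF g]]) (auto simp: U'_def)
    show "nrm ?L (U' g) \<le> C * L"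
      by (rule nrm_Lip0_le[OF p _ L U'_lip[OF g]]) (auto simp: U'_def)
  qed
  have VU': "V (U' g) n = g n" for g n
  proof -
    have "V (U' g) n = V (U g) n"
      by (rule ker_op_cong[OF csub_opsD(2)[OF UV]]) (auto simp: U'_def)
    then show ?thesis
      using csub_opsD(5)[OF VU] by simp
  qed
  have U'_lin: "linear U'"
  proof -
    have "linear (\<lambda>g. U g x)" if "x \<in> pts ?X" for x
      by (rule fin_fun_linear[OF ker_opD[OF csub_opsD(1)[OF UV] that]])
    then show ?thesis
      by (auto simp: linear_iff U'_def fun_eq_iff plus_fun_def scaleR_fun_def)
  qed
  have e1: "\<bar>e n m\<bar> \<le> 1" for n m
    by (simp add: e_def)
  define T where "T \<phi> = (\<lambda>n. \<phi> (U' (e n)))" for \<phi> :: "('a \<Rightarrow> real) \<Rightarrow> real"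
  define S where "S x = (\<lambda>f. if f \<in> vecs ?L then \<Sum>n. x n * V f n else 0)" for x
  have T_lin: "linear T"
    by (simp add: linear_iff T_def scaleR_fun_def fun_eq_iff)
  have T_sum: "(\<Sum>n<N. \<bar>T \<phi> n\<bar>) \<le> C * nrm (dual ?L) \<phi>" if \<phi>: "\<phi> \<in> vecs (dual ?L)" for \<phi> N
  proof -
    \<comment> \<open>Testing with the signs of the first \<open>N\<close> coefficients turns the
      partial sum of their absolute values into one value of \<open>\<phi>\<close>, while the test
      sequences stay bounded by \<open>1\<close>.\<close>
    define g where "g N m = (if m < N then sgn (T \<phi> m) else 0)" for N m :: nat
    have g1: "\<bar>g N m\<bar> \<le> 1" for N m
      by (simp add: g_def abs_sgn_eq)
    have "\<phi> (U' (g N)) = (\<Sum>n<N. \<bar>T \<phi> n\<bar>)"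
    proof (induction N)
      case 0
      have "g 0 = 0"
        by (simp add: g_def fun_eq_iff)
      then have "U' (g 0) = 0"
        using linear_0[OF U'_lin] by metis
      moreover have "\<phi> (0 *\<^sub>R 0) = 0 * \<phi> 0"
        using \<phi> subspace_0[OF subspace_Lip0[OF p]] unfolding dual_vecs_iff[OF p] by blast
      ultimately have "\<phi> (U' (g 0)) = 0"
        by (metis mult_zero_left scaleR_zero_left)
      then show ?case
        by simp
    next
      case (Suc N)
      have "g (Suc N) = g N + sgn (T \<phi> N) *\<^sub>R e N"
        by (auto simp: g_def e_def scaleR_fun_def fun_eq_iff less_Suc_eq)
      then have "U' (g (Suc N)) = U' (g N) + sgn (T \<phi> N) *\<^sub>R U' (e N)"
        by (simp add: linear_add[OF U'_lin] linear_scale[OF U'_lin])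
      moreover have "\<phi> (U' (g N) + sgn (T \<phi> N) *\<^sub>R U' (e N)) = \<phi> (U' (g N)) + sgn (T \<phi> N) * T \<phi> N"
        using \<phi> U'_vecs[OF g1] U'_vecs[OF e1] subspace_scale[OF subspace_Lip0[OF p]]
        by (simp add: dual_vecs_iff[OF p] T_def)
      ultimately have "\<phi> (U' (g (Suc N))) = \<phi> (U' (g N)) + sgn (T \<phi> N) * T \<phi> N"
        by (simp only:)
      then show ?case
        using Suc by (simp add: abs_sgn mult.commute)
    qed
    moreover have "\<phi> (U' (g N)) \<le> nrm (dual ?L) \<phi> * nrm ?L (U' (g N))"
      using dual_nrm_bound[OF p \<phi> U'_vecs[OF g1]] by (rule abs_le_D1)
    moreover have "nrm (dual ?L) \<phi> * nrm ?L (U' (g N)) \<le> nrm (dual ?L) \<phi> * (C * 1)"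
      by (intro mult_left_mono U'_nrm g1 dual_nrm_nonneg[OF p \<phi>])
    ultimately show ?thesis
      by (simp add: mult.commute)
  qed
  have T_summable: "summable (\<lambda>n. \<bar>T \<phi> n\<bar>)" and T_bound: "(\<Sum>n. \<bar>T \<phi> n\<bar>) \<le> C * nrm (dual ?L) \<phi>"
    if \<phi>: "\<phi> \<in> vecs (dual ?L)" for \<phi>
  proof -
    show "summable (\<lambda>n. \<bar>T \<phi> n\<bar>)"
      by (rule summableI_nonneg_bounded[OF _ T_sum[OF \<phi>]]) simp
    then show "(\<Sum>n. \<bar>T \<phi> n\<bar>) \<le> C * nrm (dual ?L) \<phi>"
      by (rule suminf_le_const[OF _ T_sum[OF \<phi>]])
  qed
  have S_bound: "\<bar>S x f\<bar> \<le> ((\<Sum>n. \<bar>x n\<bar>) * C) * nrm ?L f"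
    if "summable (\<lambda>n. \<bar>x n\<bar>)" "f \<in> vecs ?L" for x f
    using ell1_pairing(2)[OF that(1) V_bound[OF that(2)]] that(2) by (simp add: S_def mult.assoc)
  have S_summable: "summable (\<lambda>n. x n * V f n)" if "summable (\<lambda>n. \<bar>x n\<bar>)" "f \<in> vecs ?L" for x f
    by (rule ell1_pairing(1)[OF that(1) V_bound[OF that(2)]])
  have S_nn: "0 \<le> (\<Sum>n. \<bar>x n\<bar>) * C" if "summable (\<lambda>n. \<bar>x n\<bar>)" for x :: "nat \<Rightarrow> real"
    using C suminf_nonneg[OF that] by simp
  have S_dual: "S x \<in> vecs (dual ?L)" if x: "summable (\<lambda>n. \<bar>x n\<bar>)" for x
  proof -
    have "\<exists>B\<ge>0. \<forall>f\<in>vecs ?L. \<bar>S x f\<bar> \<le> B * nrm ?L f"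
      using S_bound[OF x] S_nn[OF x] by blast
    moreover have "S x (f + g) = S x f + S x g" if "f \<in> vecs ?L" "g \<in> vecs ?L" for f g
      using that subspace_add[OF subspace_Lip0[OF p] that] suminf_add[OF S_summable[OF x that(1)] S_summable[OF x that(2)]]
      by (simp add: S_def linear_add[OF V_lin] distrib_left)
    moreover have "S x (c *\<^sub>R f) = c * S x f" if "f \<in> vecs ?L" for f c
      using that subspace_scale[OF subspace_Lip0[OF p] that] suminf_mult[OF S_summable[OF x that], of c]
      by (simp add: S_def linear_scale[OF V_lin] mult.left_commute)
    moreover have "S x f = 0" if "f \<notin> vecs ?L" for f
      using that by (simp add: S_def)
    ultimately show ?thesis
      unfolding dual_vecs_iff[OF p] by blast
  qed
  have S_free: "S x \<in> vecs (lipschitz_free M p)" if x: "summable (\<lambda>n. \<bar>x n\<bar>)" for x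
    unfolding free_vecs_iff[OF p]
  proof (intro conjI allI impI S_dual x)
    fix \<epsilon> :: real assume \<epsilon>: "0 < \<epsilon>"
    then have "0 < \<epsilon> / (C + 1)"
      using C by simp
    \<comment> \<open>The truncated series is a combination of evaluations, and the error is
      governed by the tail of \<open>x\<close>.\<close>
    then obtain N where N: "norm (\<Sum>i. \<bar>x (i + N)\<bar>) < \<epsilon> / (C + 1)"
      using suminf_exist_split[OF _ x] by blast
    define ev where "ev n = (\<lambda>f. if f \<in> vecs ?L then V f n else 0)" for n
    define \<psi> where "\<psi> = (\<Sum>n<N. x n *\<^sub>R ev n)"
    have "\<psi> \<in> span (evaluation M p ` mspace M)"
      unfolding \<psi>_def ev_def by (intro span_sum span_scale span_evaluation_fin_fun[OF p V_fin])
    have xN: "summable (\<lambda>n. \<bar>x (n + N)\<bar>)"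
      using x by (simp add: summable_iff_shift[of "\<lambda>n. \<bar>x n\<bar>"])
    have \<psi>_apply: "\<psi> f = (\<Sum>n<N. x n * V f n)" if "f \<in> vecs ?L" for f
    proof -
      have "(\<Sum>n<K. x n *\<^sub>R ev n) f = (\<Sum>n<K. x n * V f n)" for K
        by (induction K) (use that in \<open>simp_all add: ev_def scaleR_fun_def\<close>)
      then show ?thesis
        by (simp add: \<psi>_def)
    qed
    have "nrm (dual ?L) (S x - \<psi>) \<le> (\<Sum>n. \<bar>x (n + N)\<bar>) * C"
    proof (rule dual_nrm_le[OF p S_nn[OF xN]])
      fix f assume f: "f \<in> vecs ?L"
      have "(S x - \<psi>) f = (\<Sum>n. x (n + N) * V f (n + N))"
        using suminf_split_initial_segment[OF S_summable[OF x f], of N] f by (simp add: S_def \<psi>_apply)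
      then show "\<bar>(S x - \<psi>) f\<bar> \<le> ((\<Sum>n. \<bar>x (n + N)\<bar>) * C) * nrm ?L f"
        using ell1_pairing(2)[OF xN, of "\<lambda>n. V f (n + N)"] V_bound[OF f] by (simp add: mult.assoc)
    qed
    also have "\<dots> \<le> (\<Sum>n. \<bar>x (n + N)\<bar>) * (C + 1)"
      by (intro mult_left_mono suminf_nonneg xN) auto
    also have "\<dots> < \<epsilon>"
      using N C suminf_nonneg[OF xN] by (simp add: pos_less_divide_eq)
    finally show "\<exists>\<psi>\<in>span (evaluation M p ` mspace M). nrm (dual ?L) (S x - \<psi>) < \<epsilon>"
      using \<open>\<psi> \<in> span (evaluation M p ` mspace M)\<close> by blast
  qed
  have ST_span: "S (T \<psi>) f = \<psi> f" if \<psi>: "\<psi> \<in> span (evaluation M p ` mspace M)" and f: "f \<in> vecs ?L" for \<psi> f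
  proof -
    have "(\<lambda>n. T \<psi> n * V f n) sums \<psi> f"
      using \<psi>
    proof (induction rule: span_induct_alt)
      case base
      then show ?case by (simp add: T_def)
    next
      case (step c \<eta> \<psi>)
      then obtain x where x: "x \<in> mspace M" "\<eta> = evaluation M p x"
        by auto
      have "(\<lambda>n. T \<eta> n * V f n) sums \<eta> f"
      proof (cases "x = p")
        case True
        then have "T \<eta> n = 0" "\<eta> f = 0" for n
          using Lip0_outside[OF p f, of p] x(2) by (simp_all add: T_def U'_def evaluation_def)
        then show ?thesis by simp
      next
        case False
        then have xX: "x \<in> pts ?X"
          using x by simp
        have "T \<eta> n = U (e n) x" for n
          using U'_vecs[OF e1] xX x(2) by (simp add: T_def evaluation_def U'_def)
        moreover have "(\<lambda>n. U (e n) x * V f n) sums U (V f) x"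
          using fin_fun_sums[of "\<lambda>g. U g x" "V f"] ker_opD[OF csub_opsD(1)[OF UV] xX] by (simp add: e_def)
        ultimately show ?thesis
          using csub_opsD(5)[OF UV xX] x(2) f by (simp add: evaluation_def)
      qed
      from sums_add[OF sums_mult[OF this, of c] step(2)] show ?case
        by (simp add: T_def scaleR_fun_def distrib_right mult.assoc)
    qed
    then show ?thesis
      using f by (simp add: S_def sums_iff)
  qed
  have ST: "S (T \<phi>) = \<phi>" if \<phi>: "\<phi> \<in> vecs (lipschitz_free M p)" for \<phi>
  proof
    fix f
    have \<phi>d: "\<phi> \<in> vecs (dual ?L)"
      by (rule free_dual[OF p \<phi>])
    show "S (T \<phi>) f = \<phi> f"
    proof (cases "f \<in> vecs ?L")
      case f: True
      \<comment> \<open>The identity is exact on the span of the evaluations. It extends to the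
        closure because both sides are bounded, with constants \<open>C * C\<close> for
        \<open>S\<close> after \<open>T\<close> and \<open>1\<close> for the identity; these form
        \<open>B\<close>.\<close>
      have "\<bar>S (T \<phi>) f - \<phi> f\<bar> \<le> 0 + \<epsilon>" if \<epsilon>: "0 < \<epsilon>" for \<epsilon>
      proof -
        define B where "B = (C * C + 1) * nrm ?L f"
        have B: "0 \<le> B"
          using nrm_Lip0_nonneg[OF p f] by (simp add: B_def)
        have "0 < \<epsilon> / (B + 1)"
          using B \<epsilon> by simp
        then obtain \<psi> where \<psi>: "\<psi> \<in> span (evaluation M p ` mspace M)" "nrm (dual ?L) (\<phi> - \<psi>) < \<epsilon> / (B + 1)"
          using \<phi> unfolding free_vecs_iff[OF p] by meson
        have \<psi>d: "\<psi> \<in> vecs (dual ?L)"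
          by (rule span_evaluation_dual[OF p \<psi>(1)])
        have d: "\<phi> - \<psi> \<in> vecs (dual ?L)"
          by (rule subspace_diff[OF subspace_dual[OF p] \<phi>d \<psi>d])
        have "S (T \<phi>) f = S (T (\<phi> - \<psi>)) f + S (T \<psi>) f"
          using suminf_add[OF S_summable[OF T_summable[OF d] f] S_summable[OF T_summable[OF \<psi>d] f]] f
          by (simp add: S_def T_def left_diff_distrib)
        then have "\<bar>S (T \<phi>) f - \<phi> f\<bar> \<le> \<bar>S (T (\<phi> - \<psi>)) f\<bar> + \<bar>(\<phi> - \<psi>) f\<bar>"
          using ST_span[OF \<psi>(1) f] by simp
        also have "\<bar>S (T (\<phi> - \<psi>)) f\<bar> \<le> ((C * nrm (dual ?L) (\<phi> - \<psi>)) * C) * nrm ?L f"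
          using T_bound[OF d] C nrm_Lip0_nonneg[OF p f]
          by (intro order_trans[OF S_bound[OF T_summable[OF d] f]] mult_right_mono) auto
        also have "\<bar>(\<phi> - \<psi>) f\<bar> \<le> nrm (dual ?L) (\<phi> - \<psi>) * nrm ?L f"
          by (rule dual_nrm_bound[OF p d f])
        also have "C * nrm (dual ?L) (\<phi> - \<psi>) * C * nrm ?L f + nrm (dual ?L) (\<phi> - \<psi>) * nrm ?L f
            = nrm (dual ?L) (\<phi> - \<psi>) * B"
          by (simp add: B_def algebra_simps)
        also have "\<dots> \<le> nrm (dual ?L) (\<phi> - \<psi>) * (B + 1)"
          using dual_nrm_nonneg[OF p d] by (intro mult_left_mono) auto
        also have "\<dots> \<le> \<epsilon>"
          using \<psi>(2) B by (simp add: pos_less_divide_eq)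
        finally show ?thesis by simp
      qed
      then have "\<bar>S (T \<phi>) f - \<phi> f\<bar> \<le> 0"
        by (rule field_le_epsilon)
      then show ?thesis by simp
    next
      case False
      then show ?thesis
        using \<phi>d by (simp add: S_def dual_vecs_iff[OF p])
    qed
  qed
  have TS: "T (S x) = x" for x
  proof
    fix n
    have "(\<lambda>m. x m * V (U' (e n)) m) = (\<lambda>m. if m = n then x m else 0)"
      by (auto simp: VU' e_def)
    then show "T (S x) n = x n"
      using U'_vecs[OF e1] sums_single[of n x] by (simp add: T_def S_def sums_iff)
  qed
  show ?thesis
  proof (rule linearly_isomorphicI)
    show "bounded_linear_op (lipschitz_free M p) ell1 T"
      using T_summable[OF free_dual[OF p]] T_bound[OF free_dual[OF p]]
      by (auto simp: bounded_linear_op_def ell1_def nrm_free[OF p] linear_add[OF T_lin] linear_scale[OF T_lin])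
    have "S (x + y) = S x + S y" if "summable (\<lambda>n. \<bar>x n\<bar>)" "summable (\<lambda>n. \<bar>y n\<bar>)" for x y
      using suminf_add[OF S_summable[OF that(1)] S_summable[OF that(2)]]
      by (auto simp: S_def distrib_right)
    moreover have "S (c *\<^sub>R x) = c *\<^sub>R S x" if "summable (\<lambda>n. \<bar>x n\<bar>)" for c x
      using suminf_mult[OF S_summable[OF that], of _ c] by (auto simp: S_def scaleR_fun_def mult.assoc)
    moreover have "nrm (dual ?L) (S x) \<le> C * (\<Sum>n. \<bar>x n\<bar>)" if "summable (\<lambda>n. \<bar>x n\<bar>)" for x
      using dual_nrm_le[OF p S_nn[OF that] S_bound[OF that]] by (simp add: mult.commute)
    ultimately show "bounded_linear_op ell1 (lipschitz_free M p) S"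
      using S_free by (auto simp: bounded_linear_op_def ell1_def nrm_free[OF p])
    show "S (T \<phi>) = \<phi>" if "\<phi> \<in> vecs (lipschitz_free M p)" for \<phi>
      by (rule ST[OF that])
    show "T (S x) = x" for x
      by (rule TS)
    show "subspace (vecs ell1)"
    proof (rule subspaceI)
      show "x + y \<in> vecs ell1" if "x \<in> vecs ell1" "y \<in> vecs ell1" for x y
        using that summable_comparison_test[of "\<lambda>n. x n + y n" "\<lambda>n. \<bar>x n\<bar> + \<bar>y n\<bar>"]
        by (auto simp: ell1_def intro!: summable_comparison_test[of "\<lambda>n. \<bar>x n + y n\<bar>" "\<lambda>n. \<bar>x n\<bar> + \<bar>y n\<bar>"] summable_add)
      show "c *\<^sub>R x \<in> vecs ell1" if "x \<in> vecs ell1" for c x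
        using that by (auto simp: ell1_def scaleR_fun_def abs_mult intro: summable_mult)
    qed (simp add: ell1_def)
  qed
qed

section \<open>Product grids\<close>

lemma lip_le_compare:
  assumes pts: "pts X = pts Y" and wt: "\<And>x. x \<in> pts X \<Longrightarrow> wt Y x \<le> C * wt X x"
    and ds: "\<And>x y. x \<in> pts X \<Longrightarrow> y \<in> pts X \<Longrightarrow> ds Y x y \<le> C * ds X x y"
    and L: "0 \<le> L" and f: "lip_le Y L f"
  shows "lip_le X (C * L) f"
proof (rule lip_leI)
  fix x assume x: "x \<in> pts X"
  have "\<bar>f x\<bar> \<le> L * wt Y x"
    using lip_leD(1)[OF f] x pts by simp
  also have "\<dots> \<le> L * (C * wt X x)"
    using wt[OF x] L by (rule mult_left_mono)
  finally show "\<bar>f x\<bar> \<le> C * L * wt X x"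
    by (simp add: ac_simps)
next
  fix x y assume xy: "x \<in> pts X" "y \<in> pts X"
  have "\<bar>f x - f y\<bar> \<le> L * ds Y x y"
    using lip_leD(2)[OF f] xy pts by simp
  also have "\<dots> \<le> L * (C * ds X x y)"
    using ds[OF xy] L by (rule mult_left_mono)
  finally show "\<bar>f x - f y\<bar> \<le> C * L * ds X x y"
    by (simp add: ac_simps)
qed

lemma ciso_sup_based:
  assumes S: "S = Pi UNIV A" "S \<subseteq> {1..n} \<rightarrow>\<^sub>E UNIV"
  shows "ciso (lspace_of (submetric (sup_metric n) S) p) (punctured (based A {1..n} 0 p) p)"
proof -
  let ?X = "lspace_of (submetric (sup_metric n) S) p" and ?Y = "punctured (based A {1..n} 0 p) p"
  \<comment> \<open>The comparison with the sum distance costs a factor \<open>n\<close>; the added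
    \<open>1\<close> gives \<open>C \<ge> 1\<close>, used in the opposite comparison, also for
    \<open>n = 0\<close>.\<close>
  define C where "C = real n + 1"
  have pts: "pts ?X = pts ?Y"
    using S by auto
  have le: "sup_dist n x y \<le> l1d {1..n} x y" for x y
    by (auto simp: sup_dist_le_iff intro: abs_le_l1d)
  have ge: "l1d {1..n} x y \<le> C * sup_dist n x y" for x y
  proof -
    have *: "0 \<le> sup_dist n x y" "\<And>k. k \<in> {1..n} \<Longrightarrow> \<bar>x k - y k\<bar> \<le> sup_dist n x y"
      using sup_dist_le_iff by blast+
    have "l1d {1..n} x y \<le> real (card {1..n}) * sup_dist n x y"
      unfolding l1d_def by (intro sum_bounded_above *)
    also have "\<dots> \<le> C * sup_dist n x y"
      using *(1) by (intro mult_right_mono) (auto simp: C_def)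
    finally show ?thesis .
  qed
  have le': "sup_dist n x y \<le> C * l1d {1..n} x y" for x y
    using le[of x y] mult_right_mono[of 1 C "l1d {1..n} x y"] by (simp add: C_def)
  have X_Y: "lip_le ?X (C * L) f" if "0 \<le> L" "lip_le ?Y L f" for L f
    by (rule lip_le_compare[OF pts _ _ that]) (use ge in auto)
  have Y_X: "lip_le ?Y (C * L) f" if "0 \<le> L" "lip_le ?X L f" for L f
    by (rule lip_le_compare[OF pts[symmetric] _ _ that]) (use le' in auto)
  have "csub_ops C ?X ?Y (\<lambda>f. f) (\<lambda>f. f)" "csub_ops C ?Y ?X (\<lambda>f. f) (\<lambda>f. f)"
    using X_Y Y_X by (auto intro!: csub_opsI simp only: pts ker_op_id)
  then show ?thesis
    unfolding ciso_def C_def by (meson add_nonneg_nonneg of_nat_0_le_iff zero_le_one)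
qed

lemma finite_range_interval:
  fixes v :: "nat \<Rightarrow> real"
  assumes "filterlim v at_top sequentially"
  shows "finite (range v \<inter> {t. \<bar>t - c\<bar> \<le> r})"
proof -
  obtain n where n: "\<And>j. n \<le> j \<Longrightarrow> c + r + 1 \<le> v j"
    using assms by (auto simp: filterlim_at_top eventually_sequentially)
  have "j < n" if "\<bar>v j - c\<bar> \<le> r" for j
    using n[of j] that by (cases "n \<le> j") auto
  then have "range v \<inter> {t. \<bar>t - c\<bar> \<le> r} \<subseteq> v ` {..<n}"
    by auto
  then show ?thesis
    by (rule finite_subset) simp
qed

text \<open>The approximation of \<open>R\<close> from above is the first term that reaches
  \<open>R\<close>: its predecessor lies below \<open>R\<close>, and the ratio of the two is below
  \<open>1 + \<epsilon>\<close>.\<close>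

lemma slow_range:
  fixes v :: "nat \<Rightarrow> real"
  assumes mono: "strict_mono v" and pos: "\<And>n. 0 < v n" and top: "filterlim v at_top sequentially"
    and ratio: "(\<lambda>n. v (Suc n) / v n) \<longlonglongrightarrow> 1"
  shows "slow (range v)"
  unfolding slow_def
proof (intro allI impI)
  fix \<epsilon> :: real assume "0 < \<epsilon>"
  then have "\<forall>\<^sub>F n in sequentially. v (Suc n) / v n < 1 + \<epsilon>"
    using ratio by (intro order_tendstoD) auto
  then obtain n0 where ratio_n0: "\<And>n. n0 \<le> n \<Longrightarrow> v (Suc n) / v n < 1 + \<epsilon>"
    by (auto simp: eventually_sequentially)
  have n0: "v (Suc n) \<le> (1 + \<epsilon>) * v n" if "n0 \<le> n" for n
  proof -
    have "v (Suc n) / v n < 1 + \<epsilon>"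
      using ratio_n0[OF that] .
    then show ?thesis
      using pos[of n] by (simp add: pos_divide_less_eq)
  qed
  show "\<exists>R0. \<forall>R\<ge>R0. \<exists>x\<in>range v. R \<le> x \<and> x \<le> (1 + \<epsilon>) * R"
  proof (intro exI[of _ "v n0 + 1"] allI impI)
    fix R assume R: "v n0 + 1 \<le> R"
    \<comment> \<open>As \<open>R\<close> exceeds \<open>v n0\<close>, the index \<open>m\<close> is
      beyond \<open>n0\<close>; so it has a predecessor to which the estimate of the ratios
      applies.\<close>
    define m where "m = (LEAST m. R \<le> v m)"
    have "\<exists>m. R \<le> v m"
      using top by (auto simp: filterlim_at_top eventually_sequentially)
    then have m: "R \<le> v m"
      unfolding m_def by (rule LeastI_ex)
    then have "v n0 < v m"
      using R by linarith
    then have "n0 < m"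
      using mono by (simp add: strict_mono_less)
    then obtain k where k: "m = Suc k" "n0 \<le> k"
      by (cases m) auto
    have "v k < R"
      using not_less_Least[of k "\<lambda>m. R \<le> v m"] k(1) by (simp add: m_def)
    then have "(1 + \<epsilon>) * v k \<le> (1 + \<epsilon>) * R"
      using \<open>0 < \<epsilon>\<close> by (intro mult_left_mono) auto
    then have "v m \<le> (1 + \<epsilon>) * R"
      using n0[OF k(2)] k(1) by simp
    then show "\<exists>x\<in>range v. R \<le> x \<and> x \<le> (1 + \<epsilon>) * R"
      using m by blast
  qed
qed

text \<open>The lower limit controls the late ratios. The finitely many early ones exceed
  \<open>1\<close> by strict monotonicity, so a minimum serves for all. The resulting geometric
  growth gives divergence to infinity.\<close>

lemma lacunary_range:
  fixes v :: "nat \<Rightarrow> real"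
  assumes mono: "strict_mono v" and pos: "0 < v 0"
    and ratio: "liminf (\<lambda>n. ereal (v (Suc n) / v n)) > 1"
  shows "\<exists>\<kappa>>1. lacunary \<kappa> (range v)" "filterlim v at_top sequentially"
proof -
  have pos: "0 < v n" for n
    using pos mono by (metis less_le_trans strict_mono_less_eq zero_le)
  obtain c where c: "1 < ereal c" "ereal c < liminf (\<lambda>n. ereal (v (Suc n) / v n))"
    using ereal_dense2[OF ratio] by blast
  obtain n0 where n0: "\<And>n. n0 \<le> n \<Longrightarrow> c < v (Suc n) / v n"
    using less_LiminfD[OF c(2)] by (auto simp: eventually_sequentially)
  define \<kappa> where "\<kappa> = Min (insert c ((\<lambda>n. v (Suc n) / v n) ` {..<n0}))"
  have \<kappa>: "1 < \<kappa>"
    unfolding \<kappa>_def using c(1) pos mono by (auto simp: strict_mono_Suc_iff)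
  have step: "\<kappa> * v n \<le> v (Suc n)" for n
  proof -
    have "\<kappa> \<le> v (Suc n) / v n"
    proof (cases "n < n0")
      case True
      then show ?thesis
        unfolding \<kappa>_def by (intro Min_le) auto
    next
      case False
      have "\<kappa> \<le> c"
        unfolding \<kappa>_def by (intro Min_le) auto
      then show ?thesis
        using n0[of n] False by simp
    qed
    then show ?thesis
      using pos[of n] by (simp add: pos_le_divide_eq)
  qed
  have "\<kappa> * v m \<le> v n" if "v m < v n" for m n
  proof -
    have "Suc m \<le> n"
      using that mono by (simp add: strict_mono_less Suc_le_eq)
    then have "v (Suc m) \<le> v n"
      using mono by (simp add: strict_mono_less_eq)
    then show ?thesis
      using step[of m] by linarith
  qed
  then have "lacunary \<kappa> (range v)"
    using pos by (auto simp: lacunary_def)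
  then show "\<exists>\<kappa>>1. lacunary \<kappa> (range v)"
    using \<kappa> by blast
  have "\<kappa> ^ n * v 0 \<le> v n" for n
  proof (induction n)
    case (Suc n)
    have "\<kappa> ^ Suc n * v 0 \<le> \<kappa> * v n"
      using Suc \<kappa> by (simp add: mult.assoc)
    then show ?case
      using step[of n] by linarith
  qed simp
  moreover have "filterlim (\<lambda>n. \<kappa> ^ n * v 0) at_top sequentially"
  proof (rule filterlim_at_top_mult_tendsto_pos[OF tendsto_const pos])
    show "filterlim (\<lambda>n. \<kappa> ^ n) at_top sequentially"
      using filterlim_realpow_sequentially_gt1[of \<kappa>] \<kappa>
      by (simp add: filterlim_at_infinity_imp_filterlim_at_top)
  qed
  ultimately show "filterlim v at_top sequentially"
    using filterlim_at_top_mono by (metis (mono_tags, lifting) always_eventually)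
qed

lemma lacunary_mono:
  assumes "lacunary \<kappa> S" "\<kappa>' \<le> \<kappa>"
  shows "lacunary \<kappa>' S"
  using assms mult_right_mono[OF assms(2)] unfolding lacunary_def by (meson less_imp_le order_trans)

lemma ciso_product_grid:
  fixes d q :: nat and a b :: "nat \<Rightarrow> nat \<Rightarrow> real"
  assumes dq: "d + q \<ge> 1"
    and a_pos: "\<And>i. i \<in> {1..d} \<Longrightarrow> 0 < a i 1"
    and a_mono: "\<And>i. i \<in> {1..d} \<Longrightarrow> strict_mono_on {1..} (a i)"
    and a_top: "\<And>i. i \<in> {1..d} \<Longrightarrow> filterlim (a i) at_top sequentially"
    and a_ratio: "\<And>i. i \<in> {1..d} \<Longrightarrow> (\<lambda>n. a i (Suc n) / a i n) \<longlonglongrightarrow> 1"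
    and b_pos: "\<And>j. j \<in> {1..q} \<Longrightarrow> 0 < b j 1"
    and b_mono: "\<And>j. j \<in> {1..q} \<Longrightarrow> strict_mono_on {1..} (b j)"
    and b_ratio: "\<And>j. j \<in> {1..q} \<Longrightarrow> liminf (\<lambda>m. ereal (b j (Suc m) / b j m)) > 1"
    and p: "p \<in> product_grid d q a b"
  shows "ciso (lspace_of (submetric (sup_metric (d + q)) (product_grid d q a b)) p) (model d)"
proof -
  define I where "I = {1..d + q}"
  \<comment> \<open>The given sequences start at index \<open>1\<close>, hence the
    \<open>Suc\<close>.\<close>
  define w where "w i n = (if i \<le> d then a i (Suc n) else b (i - d) (Suc n))" for i n
  \<comment> \<open>Points are extensional functions, so the coordinates outside \<open>I\<close>
    are fixed at \<open>undefined\<close>.\<close>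
  define A where "A i = (if i \<in> I then range (w i) else {undefined})" for i
  have j: "i - d \<in> {1..q}" if "i \<in> I - {1..d}" for i
    using that by (auto simp: I_def)
  have wb: "w i = (\<lambda>n. b (i - d) (Suc n))" if "i \<in> I - {1..d}" for i
    using that by (auto simp: I_def w_def fun_eq_iff)
  have wa: "w i = (\<lambda>n. a i (Suc n))" if "i \<in> {1..d}" for i
    using that by (auto simp: w_def fun_eq_iff)
  have smono: "strict_mono (\<lambda>n. f (Suc n))" if "strict_mono_on {1..} f" for f :: "nat \<Rightarrow> real"
    using that by (auto simp: strict_mono_on_def strict_mono_def)
  have a_w: "strict_mono (w i)" "\<And>n. 0 < w i n" "filterlim (w i) at_top sequentially"
      "(\<lambda>n. w i (Suc n) / w i n) \<longlonglongrightarrow> 1" if i: "i \<in> {1..d}" for i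
  proof -
    show m: "strict_mono (w i)"
      unfolding wa[OF i] by (rule smono[OF a_mono[OF i]])
    have "0 < w i 0"
      using a_pos[OF i] by (simp add: wa[OF i])
    then show "0 < w i n" for n
      using m by (metis less_le_trans strict_mono_less_eq zero_le)
    show "filterlim (w i) at_top sequentially"
      unfolding wa[OF i] by (rule filterlim_compose[OF a_top[OF i] filterlim_Suc])
    show "(\<lambda>n. w i (Suc n) / w i n) \<longlonglongrightarrow> 1"
      unfolding wa[OF i] using LIMSEQ_Suc[OF a_ratio[OF i]] .
  qed
  have b_w: "strict_mono (w i)" "0 < w i 0" "liminf (\<lambda>n. ereal (w i (Suc n) / w i n)) > 1"
    if i: "i \<in> I - {1..d}" for i
  proof -
    show "strict_mono (w i)"
      unfolding wb[OF i] by (rule smono[OF b_mono[OF j[OF i]]])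
    show "0 < w i 0"
      using b_pos[OF j[OF i]] by (simp add: wb[OF i])
    show "liminf (\<lambda>n. ereal (w i (Suc n) / w i n)) > 1"
      unfolding wb[OF i] using b_ratio[OF j[OF i]] liminf_shift[of "\<lambda>n. ereal (b (i - d) (Suc n) / b (i - d) n)"]
      by simp
  qed
  have "\<forall>i\<in>I - {1..d}. \<exists>\<kappa>>1. lacunary \<kappa> (range (w i))"
    using lacunary_range(1) b_w by blast
  then obtain k where k: "\<And>i. i \<in> I - {1..d} \<Longrightarrow> 1 < k i \<and> lacunary (k i) (range (w i))"
    by metis
  \<comment> \<open>One ratio for all lacunary coordinates; \<open>2\<close> is the default when
    there are none.\<close>
  define \<kappa> where "\<kappa> = Min (insert 2 (k ` (I - {1..d})))"
  have \<kappa>: "1 < \<kappa>"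
    unfolding \<kappa>_def using k by (auto simp: I_def)
  have \<kappa>_le: "\<kappa> \<le> k i" if "i \<in> I - {1..d}" for i
    unfolding \<kappa>_def using that by (intro Min_le) (auto simp: I_def)
  have S: "product_grid d q a b = Pi UNIV A"
  proof (intro set_eqI iffI)
    fix x assume x: "x \<in> product_grid d q a b"
    show "x \<in> Pi UNIV A"
    proof (rule Pi_I)
      fix i
      consider "i \<in> {1..d}" | "i \<in> I - {1..d}" | "i \<notin> I"
        by blast
      then show "x i \<in> A i"
      proof cases
        case 1
        with x have "\<exists>n\<ge>1. x i = a i n"
          unfolding product_grid_def by blast
        then obtain n where "n \<ge> 1" "x i = a i n"
          by blast
        then show ?thesis
          using 1 by (cases n) (auto simp: A_def I_def wa)
      next
        case 2
        with x j[OF 2] have "\<exists>n\<ge>1. x (d + (i - d)) = b (i - d) n"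
          unfolding product_grid_def by blast
        then obtain n where "n \<ge> 1" "x (d + (i - d)) = b (i - d) n"
          by blast
        moreover have "d + (i - d) = i"
          using 2 by (auto simp: I_def)
        ultimately show ?thesis
          using 2 by (cases n) (auto simp: A_def wb)
      next
        case 3
        then show ?thesis
          using x by (auto simp: product_grid_def A_def I_def PiE_def extensional_def)
      qed
    qed
  next
    fix x assume x: "x \<in> Pi UNIV A"
    then have xA: "x i \<in> A i" for i
      by auto
    have "x \<in> {1..d + q} \<rightarrow>\<^sub>E UNIV"
    proof -
      have "x i = undefined" if "i \<notin> {1..d + q}" for i
        using xA[of i] that by (auto simp: A_def I_def split: if_splits)
      then show ?thesis
        by (simp add: PiE_def extensional_def)
    qed
    moreover have "\<exists>n\<ge>1. x i = a i n" if "i \<in> {1..d}" for i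
      using xA[of i] that wa[OF that] by (auto simp: A_def I_def)
    moreover have "\<exists>m\<ge>1. x (d + j) = b j m" if "j \<in> {1..q}" for j
    proof -
      have "d + j \<in> I - {1..d}"
        using that by (auto simp: I_def)
      then show ?thesis
        using xA[of "d + j"] wb[of "d + j"] by (auto simp: A_def)
    qed
    ultimately show "x \<in> product_grid d q a b"
      by (simp add: product_grid_def)
  qed
  have p': "p \<in> Pi UNIV A"
    using p S by simp
  have "ciso (lspace_of (submetric (sup_metric (d + q)) (product_grid d q a b)) p) (punctured (based A I 0 p) p)"
    unfolding I_def by (rule ciso_sup_based[OF S]) (auto simp: product_grid_def)
  moreover have "ciso (punctured (based A I 0 p) p) (model d)"
  proof (rule ciso_punctured_model[OF _ _ _ \<kappa> p'])
    show "finite I" "{1..d} \<subseteq> I" "I \<noteq> {}"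
      using dq by (auto simp: I_def)
    have top: "filterlim (w i) at_top sequentially" if "i \<in> I" for i
      using a_w(3)[of i] lacunary_range(2)[OF b_w, of i] that by blast
    show "finite (A i \<inter> {t. \<bar>t - p i\<bar> \<le> r})" if "i \<in> I" for i r
      using finite_range_interval[OF top[OF that]] that by (simp add: A_def)
    show "lacunary \<kappa> (A i)" if "i \<in> I - {1..d}" for i
      using lacunary_mono[OF _ \<kappa>_le[OF that]] k[OF that] that by (simp add: A_def)
    show "A i = {p i}" if "i \<notin> I" for i
      using p' that by (auto simp: A_def Pi_def dest!: spec[of _ i])
    show "slow (A i)" if "i \<in> {1..d}" for i
      using slow_range[OF a_w[OF that]] that by (simp add: A_def I_def)
    show "\<exists>v. (\<forall>j. v j \<in> A i \<and> v j < v (Suc j)) \<and> filterlim v at_top sequentially" if "i \<in> I - {1..d}" for i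
      using top[of i] b_w(1)[OF that] that by (intro exI[of _ "w i"]) (auto simp: A_def strict_mono_Suc_iff)
  qed
  ultimately show ?thesis
    by (rule ciso_trans)
qed

text \<open>Rounding up adds at most \<open>1\<close>, and \<open>1 \<le> \<epsilon> * R\<close>
  from \<open>1 / \<epsilon>\<close> on.\<close>

lemma slow_Ints: "slow \<int>"
  unfolding slow_def
proof (intro allI impI)
  fix \<epsilon> :: real assume \<epsilon>: "0 < \<epsilon>"
  show "\<exists>R0. \<forall>R\<ge>R0. \<exists>x\<in>\<int>. R \<le> x \<and> x \<le> (1 + \<epsilon>) * R"
  proof (intro exI[of _ "1 / \<epsilon>"] allI impI)
    fix R assume "1 / \<epsilon> \<le> R"
    then have "1 \<le> \<epsilon> * R"
      using \<epsilon> by (simp add: pos_divide_le_eq mult.commute)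
    then have "R \<le> of_int \<lceil>R\<rceil>" "of_int \<lceil>R\<rceil> \<le> (1 + \<epsilon>) * R"
      unfolding distrib_right by linarith+
    then show "\<exists>x\<in>\<int>. R \<le> x \<and> x \<le> (1 + \<epsilon>) * R"
      using Ints_of_int by blast
  qed
qed

lemma ciso_int_lattice:
  assumes d: "1 \<le> d" and z: "z \<in> int_lattice d"
  shows "ciso (lspace_of (submetric (sup_metric d) (int_lattice d)) z) (model d)"
proof -
  define A :: "nat \<Rightarrow> real set" where "A i = (if i \<in> {1..d} then \<int> else {undefined})" for i
  have S: "int_lattice d = Pi UNIV A"
    by (auto simp: int_lattice_def A_def PiE_def Pi_def extensional_def)
  have z': "z \<in> Pi UNIV A"
    using z S by simp
  have "ciso (lspace_of (submetric (sup_metric d) (int_lattice d)) z) (punctured (based A {1..d} 0 z) z)"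
    by (rule ciso_sup_based[OF S]) (auto simp: int_lattice_def)
  moreover have "ciso (punctured (based A {1..d} 0 z) z) (model d)"
  \<comment> \<open>All coordinates are slow here, so any ratio above \<open>1\<close> can be
    chosen.\<close>
  proof (rule ciso_punctured_model[OF _ _ _ _ z', where \<kappa> = 2])
    show "finite (A i \<inter> {t. \<bar>t - z i\<bar> \<le> r})" if "i \<in> {1..d}" for i r
    proof -
      have "A i \<inter> {t. \<bar>t - z i\<bar> \<le> r} \<subseteq> {x \<in> \<int>. z i - r \<le> x \<and> x \<le> z i + r}"
        using that by (auto simp: A_def)
      then show ?thesis
        using finite_int_segment finite_subset by blast
    qed
    show "A i = {z i}" if "i \<notin> {1..d}" for i
      using z' that by (auto simp: A_def Pi_def dest!: spec[of _ i])
    show "slow (A i)" if "i \<in> {1..d}" for i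
      using that slow_Ints by (simp add: A_def)
  qed (use d in auto)
  ultimately show ?thesis
    by (rule ciso_trans)
qed

theorem theorem1:
  fixes d q :: nat
    and a b :: "nat \<Rightarrow> nat \<Rightarrow> real"
    and N Zd :: "(nat \<Rightarrow> real) metric"
    and p z :: "nat \<Rightarrow> real"
  assumes dq: "d + q \<ge> 1"
    and a_pos: "\<And>i. i \<in> {1..d} \<Longrightarrow> 0 < a i 1"
    and a_mono: "\<And>i. i \<in> {1..d} \<Longrightarrow> strict_mono_on {1..} (a i)"
    and a_top: "\<And>i. i \<in> {1..d} \<Longrightarrow> filterlim (a i) at_top sequentially"
    and a_ratio: "\<And>i. i \<in> {1..d} \<Longrightarrow> (\<lambda>n. a i (Suc n) / a i n) \<longlonglongrightarrow> 1"
    and b_pos: "\<And>j. j \<in> {1..q} \<Longrightarrow> 0 < b j 1"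
    and b_mono: "\<And>j. j \<in> {1..q} \<Longrightarrow> strict_mono_on {1..} (b j)"
    and b_ratio: "\<And>j. j \<in> {1..q} \<Longrightarrow> liminf (\<lambda>m. ereal (b j (Suc m) / b j m)) > 1"
    and N_def: "N = submetric (sup_metric (d + q)) (product_grid d q a b)"
    and Zd_def: "Zd = submetric (sup_metric d) (int_lattice d)"
    and p: "p \<in> mspace N"
    and z: "z \<in> mspace Zd"
  shows "(d > 0 \<longrightarrow> lipschitz_free N p \<sim>\<^sub>B lipschitz_free Zd z) \<and>
         (d = 0 \<and> q > 0 \<longrightarrow> lipschitz_free N p \<sim>\<^sub>B ell1)"
proof -
  have N: "ciso (lspace_of N p) (model d)"
    unfolding N_def
    by (rule ciso_product_grid[OF dq a_pos a_mono a_top a_ratio b_pos b_mono b_ratio])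
      (use p N_def in auto)
  have "lipschitz_free N p \<sim>\<^sub>B lipschitz_free Zd z" if "d > 0"
  proof (rule ciso_imp_free_isomorphic[OF p z])
    have "ciso (lspace_of Zd z) (model d)"
      unfolding Zd_def by (rule ciso_int_lattice) (use that z Zd_def in auto)
    then show "ciso (lspace_of N p) (lspace_of Zd z)"
      using ciso_trans[OF N ciso_sym] by blast
  qed
  moreover have "lipschitz_free N p \<sim>\<^sub>B ell1" if "d = 0"
    using ciso_star_imp_free_isomorphic_ell1[OF p] ciso_trans[OF N] ciso_model_0_star that by blast
  ultimately show ?thesis
    by blast
qed

end
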